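(* Let $A$ be a Lie algebroid of rank $n$ over a manifold $M$ and let $\nabla_0$ be an $A$-connection on $\wedge^nA$ that admits a global nowhere vanishing horizontal section $\Lambda\in\Gamma(\wedge^nA)$ (that is, $(\nabla_0)_X\Lambda=0$ for all $X\in\Gamma(A)$). Then $$H_*(A,\nabla_0)\cong H^{n-*}(A,\mathbb{R}).$$
   Context: A Lie algebroid is a real vector bundle $A\to M$ with anchor $a:A\to TM$ and a Lie bracket $[\,,]$ on $\Gamma(A)$ satisfying $[X,fY]=f[X,Y]+(a(X)f)Y$. Its Gerstenhaber algebra is $\big(\mathcal{A}=\bigoplus_{i\ge0}\Gamma(\wedge^iA),\wedge,[\,,]\big)$, with $[\,,]$ the generalized Schouten bracket, i.e. the degree $-1$ super-Lie bracket with $[X,f]=a(X)f$, $[a,b]=-(-1)^{(|a|-1)(|b|-1)}[b,a]$ and $[a,b\wedge c]=[a,b]\wedge c+(-1)^{(|a|-1)|b|}b\wedge[a,c]$, extending the bracket of $\Gamma(A)$. $L_X\Lambda=[X,\Lambda]$ for $X\in\Gamma(A)$, $\Lambda\in\Gamma(\wedge^nA)$. An $A$-connection on a vector bundle $E\to M$ is an $\mathbb{R}$-linear map $\nabla:\Gamma(A)\otimes\Gamma(E)\to\Gamma(E)$ with $\nabla_{fX}s=f\nabla_Xs$ and $\nabla_X(fs)=(a(X)f)s+f\nabla_Xs$; it is flat if $\nabla_X\nabla_Y-\nabla_Y\nabla_X-\nabla_{[X,Y]}=0$ for all $X,Y\in\Gamma(A)$. To an $A$-connection $\nabla$ on $\wedge^nA$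 is associated the unique degree $-1$ linear operator $\widetilde D$ on $\mathcal{A}$ such that $\widetilde Df=0$ for $f\in C^\infty(M)$, $(\widetilde DX)\Lambda'=L_X\Lambda'-\nabla_X\Lambda'$ for $X\in\Gamma(A)$ and all $\Lambda'\in\Gamma(\wedge^nA)$, and $\widetilde D(a\wedge b)=(-1)^{|a|}[a,b]+\widetilde Da\wedge b+(-1)^{|a|}a\wedge\widetilde Db$ for $a\in\mathcal{A}^{|a|}$, $b\in\mathcal{A}$. For $\nabla$ flat one has $\widetilde D^2=0$; setting $\partial=(-1)^{n-k}\widetilde D$ on $\Gamma(\wedge^kA)$ gives a chain complex, and $H_*(A,\nabla)=\ker\partial/\operatorname{Im}\partial$ is its homology. (A connection on $\wedge^nA$ with a nowhere vanishing horizontal section is flat.) $H^*(A,\mathbb{R})$ is the Lie algebroid cohomology with trivial coefficients, i.e. the cohomology of $(\Gamma(\wedge^*A^* ),d)$ with the Lie algebroid coboundary $$d\omega(X_1,\dots,X_{k+1})=\sum_{i}(-1)^{i+1}a(X_i)\big(\omega(X_1,\dots,\hat X_i,\dots,X_{k+1})\big)+\sum_{i<j}(-1)^{i+j}\omega([X_i,X_j],X_1,\dots,\hat X_i,\dots,\hat X_j,\dots,X_{k+1}).$$ *)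

theory Defs
  imports "HOL-Analysis.Analysis" "HOL-Library.Function_Algebras"
begin

text \<open>
  Functions into a real vector space form a real vector space pointwise (the additive structure
  comes from \<^theory>\<open>HOL-Library.Function_Algebras\<close>). Spaces of smooth functions, sections, forms
  and multivector fields are subspaces of such function spaces.
\<close>

instantiation "fun" :: (type, real_vector) real_vector
begin

definition scaleR_fun :: "real \<Rightarrow> ('a \<Rightarrow> 'b) \<Rightarrow> 'a \<Rightarrow> 'b"
  where "scaleR_fun c f = (\<lambda>x. c *\<^sub>R f x)"

instance
  by standard (simp_all add: scaleR_fun_def plus_fun_def fun_eq_iff scaleR_add_right scaleR_add_left)

end

definition linear_on :: "'a::real_vector set \<Rightarrow> 'b::real_vector set \<Rightarrow> ('a \<Rightarrow> 'b) \<Rightarrow> bool"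
  where "linear_on V W f \<longleftrightarrow> f ` V \<subseteq> W \<and>
    (\<forall>u\<in>V. \<forall>v\<in>V. \<forall>a b. f (a *\<^sub>R u + b *\<^sub>R v) = a *\<^sub>R f u + b *\<^sub>R f v)"

definition bilinear_on ::
    "'a::real_vector set \<Rightarrow> 'b::real_vector set \<Rightarrow> 'c::real_vector set \<Rightarrow> ('a \<Rightarrow> 'b \<Rightarrow> 'c) \<Rightarrow> bool"
  where "bilinear_on U V W h \<longleftrightarrow>
    (\<forall>u\<in>U. linear_on V W (h u)) \<and> (\<forall>v\<in>V. linear_on U W (\<lambda>u. h u v))"

section \<open>Smooth manifolds\<close>

text \<open>
  The model of dimension \<open>m\<close> is \<^term>\<open>Euclidean_space m\<close>, i.e. the sequences vanishing from
  index \<open>m\<close> on; \<open>m = 0\<close> is allowed. Smoothness on an open set of the model is existence and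
  continuity of all iterated partial derivatives.
\<close>

definition partial_deriv :: "nat \<Rightarrow> ((nat \<Rightarrow> real) \<Rightarrow> real) \<Rightarrow> (nat \<Rightarrow> real) \<Rightarrow> real"
  where "partial_deriv i f p = deriv (\<lambda>t. f (p(i := t))) (p i)"

fun Ck_on :: "nat \<Rightarrow> nat \<Rightarrow> (nat \<Rightarrow> real) set \<Rightarrow> ((nat \<Rightarrow> real) \<Rightarrow> real) \<Rightarrow> bool" where
  "Ck_on m 0 W f = continuous_on W f"
| "Ck_on m (Suc k) W f = (continuous_on W f \<and>
     (\<forall>i<m. (\<forall>p\<in>W. (\<lambda>t. f (p(i := t))) field_differentiable at (p i)) \<and>
            Ck_on m k W (partial_deriv i f)))"

definition Cinf_on :: "nat \<Rightarrow> (nat \<Rightarrow> real) set \<Rightarrow> ((nat \<Rightarrow> real) \<Rightarrow> real) \<Rightarrow> bool"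
  where "Cinf_on m W f \<longleftrightarrow> (\<forall>k. Ck_on m k W f)"

record 'm manifold =
  mdim :: nat
  atlas :: "('m set \<times> ('m \<Rightarrow> nat \<Rightarrow> real)) set"

definition smooth_manifold ::
    "('m::{t2_space, second_countable_topology}) manifold \<Rightarrow> bool"
  where "smooth_manifold M \<longleftrightarrow>
    (\<Union>(U, \<phi>)\<in>atlas M. U) = UNIV \<and>
    (\<forall>(U, \<phi>)\<in>atlas M. open U \<and> openin (Euclidean_space (mdim M)) (\<phi> ` U) \<and>
       homeomorphic_map (top_of_set U) (subtopology (Euclidean_space (mdim M)) (\<phi> ` U)) \<phi>) \<and>
    (\<forall>(U, \<phi>)\<in>atlas M. \<forall>(V, \<psi>)\<in>atlas M. \<forall>i<mdim M.
       Cinf_on (mdim M) (\<phi> ` (U \<inter> V)) (\<lambda>p. \<psi> (inv_into U \<phi> p) i))"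

definition smooth_fun_on :: "'m manifold \<Rightarrow> 'm set \<Rightarrow> ('m \<Rightarrow> real) \<Rightarrow> bool"
  where "smooth_fun_on M U f \<longleftrightarrow>
    (\<forall>(V, \<phi>)\<in>atlas M. Cinf_on (mdim M) (\<phi> ` (U \<inter> V)) (\<lambda>p. f (inv_into V \<phi> p)))"

definition smooth_funs :: "'m manifold \<Rightarrow> ('m \<Rightarrow> real) set"
  where "smooth_funs M = {f. smooth_fun_on M UNIV f}"

text \<open>
  Tangent vectors at \<open>x\<close> are the point derivations of the algebra of smooth functions; they are
  set to zero on non-smooth functions, so that equal derivations are equal functions.
\<close>

definition tangent_space :: "'m manifold \<Rightarrow> 'm \<Rightarrow> (('m \<Rightarrow> real) \<Rightarrow> real) set"
  where "tangent_space M x = {v. (\<forall>f. f \<notin> smooth_funs M \<longrightarrow> v f = 0) \<and>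
    linear_on (smooth_funs M) UNIV v \<and>
    (\<forall>f\<in>smooth_funs M. \<forall>g\<in>smooth_funs M. v (\<lambda>y. f y * g y) = v f * g x + f x * v g)}"

section \<open>Vector bundles\<close>

text \<open>
  The fibres are linear subspaces of an arbitrary real vector space. The bundle structure is
  given by a family of local frames (equivalently, local trivializations) with smooth transition
  functions; only \<open>e i\<close> with \<open>i\<close> below the rank matters in a frame \<open>(U, e)\<close>.
\<close>

record ('m, 'v) vbundle =
  brank :: nat
  fibre :: "'m \<Rightarrow> 'v set"
  frames :: "('m set \<times> (nat \<Rightarrow> 'm \<Rightarrow> 'v)) set"

text \<open>The components of \<open>s\<close> in every local frame are smooth on the part of the frame domain in \<open>U\<close>.\<close>

definition smooth_components ::
    "'m manifold \<Rightarrow> ('m, 'v::real_vector, 'z) vbundle_scheme \<Rightarrow> 'm set \<Rightarrow> ('m \<Rightarrow> 'v) \<Rightarrow> bool"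
  where "smooth_components M E U s \<longleftrightarrow>
    (\<forall>(V, e)\<in>frames E. \<exists>c. (\<forall>i<brank E. smooth_fun_on M (U \<inter> V) (c i)) \<and>
       (\<forall>x\<in>U \<inter> V. s x = (\<Sum>i<brank E. c i x *\<^sub>R e i x)))"

definition vector_bundle ::
    "('m::topological_space) manifold \<Rightarrow> ('m, 'v::real_vector, 'z) vbundle_scheme \<Rightarrow> bool"
  where "vector_bundle M E \<longleftrightarrow>
    (\<forall>x. subspace (fibre E x)) \<and>
    (\<Union>(U, e)\<in>frames E. U) = UNIV \<and>
    (\<forall>(U, e)\<in>frames E. open U \<and>
       (\<forall>x\<in>U. inj_on (\<lambda>i. e i x) {..<brank E} \<and> independent ((\<lambda>i. e i x) ` {..<brank E}) \<and>
               span ((\<lambda>i. e i x) ` {..<brank E}) = fibre E x) \<and>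
       (\<forall>i<brank E. smooth_components M E U (e i)))"

definition sections ::
    "'m manifold \<Rightarrow> ('m, 'v::real_vector, 'z) vbundle_scheme \<Rightarrow> ('m \<Rightarrow> 'v) set"
  where "sections M E = {s. (\<forall>x. s x \<in> fibre E x) \<and> smooth_components M E UNIV s}"

text \<open>
  The dual bundle: covectors are linear on the fibre and set to zero outside it; the local frames
  are the dual frames.
\<close>

definition dual_space :: "'v::real_vector set \<Rightarrow> ('v \<Rightarrow> real) set"
  where "dual_space V = {\<xi>. linear_on V UNIV \<xi> \<and> (\<forall>v. v \<notin> V \<longrightarrow> \<xi> v = 0)}"

definition dual_frame ::
    "('m, 'v::real_vector, 'z) vbundle_scheme \<Rightarrow> (nat \<Rightarrow> 'm \<Rightarrow> 'v) \<Rightarrow> nat \<Rightarrow> 'm \<Rightarrow> 'v \<Rightarrow> real"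
  where "dual_frame E e i x v =
    (if v \<in> fibre E x then representation ((\<lambda>j. e j x) ` {..<brank E}) v (e i x) else 0)"

definition dual_bundle ::
    "('m, 'v::real_vector, 'z) vbundle_scheme \<Rightarrow> ('m, 'v \<Rightarrow> real) vbundle"
  where "dual_bundle E = \<lparr>brank = brank E, fibre = (\<lambda>x. dual_space (fibre E x)),
    frames = (\<lambda>(U, e). (U, dual_frame E e)) ` frames E\<rparr>"

section \<open>Exterior powers\<close>

text \<open>
  \<open>alternating V k\<close> is the space of alternating \<open>k\<close>-linear forms on \<open>V\<close>, as functions on lists of
  arguments that vanish on every list that is not a list of \<open>k\<close> elements of \<open>V\<close>. So the spaces for
  different degrees are independent, and the space is zero for \<open>k < 0\<close>. Degrees are integers
  throughout, so that operators of degree -1 need no special case.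
\<close>

definition alternating :: "'v::real_vector set \<Rightarrow> int \<Rightarrow> ('v list \<Rightarrow> real) set"
  where "alternating V k = {\<omega>.
    (\<forall>vs. \<not> (int (length vs) = k \<and> set vs \<subseteq> V) \<longrightarrow> \<omega> vs = 0) \<and>
    (\<forall>vs. int (length vs) = k \<and> set vs \<subseteq> V \<longrightarrow>
       (\<forall>i<length vs. linear_on V UNIV (\<lambda>v. \<omega> (vs[i := v]))) \<and>
       (\<not> distinct vs \<longrightarrow> \<omega> vs = 0))}"

text \<open>
  Wedge product: a sum over shuffles. \<open>I\<close> is the set of argument positions given to \<open>\<alpha>\<close>, and the
  sign is that of the corresponding shuffle. On degree one, the product of \<open>k\<close> factors evaluates
  to the determinant (no factorials).
\<close>

definition wedge :: "('v list \<Rightarrow> real) \<Rightarrow> ('v list \<Rightarrow> real) \<Rightarrow> 'v list \<Rightarrow> real"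
  where "wedge \<alpha> \<beta> vs = (\<Sum>I\<in>Pow {..<length vs}.
    (- 1) ^ card {(i, j). i \<in> I \<and> j \<in> {..<length vs} - I \<and> j < i} * \<alpha> (nths vs I) * \<beta> (nths vs (- I)))"

definition alternating_sections ::
    "'m manifold \<Rightarrow> ('m, 'v::real_vector, 'z) vbundle_scheme \<Rightarrow> int \<Rightarrow> ('m \<Rightarrow> 'v list \<Rightarrow> real) set"
  where "alternating_sections M E k = {\<omega>. (\<forall>x. \<omega> x \<in> alternating (fibre E x) k) \<and>
    (\<forall>(U, e)\<in>frames E. \<forall>js. set js \<subseteq> {..<brank E} \<longrightarrow>
       smooth_fun_on M U (\<lambda>x. \<omega> x (map (\<lambda>j. e j x) js)))}"

text \<open>
  Sections of the \<open>k\<close>-th exterior power of the dual of \<open>E\<close> are alternating forms on \<open>E\<close>; sections of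
  the \<open>k\<close>-th exterior power of \<open>E\<close> itself are alternating forms on the dual of \<open>E\<close> (the fibres are
  finite-dimensional).
\<close>

abbreviation forms ::
    "'m manifold \<Rightarrow> ('m, 'v::real_vector, 'z) vbundle_scheme \<Rightarrow> int \<Rightarrow> ('m \<Rightarrow> 'v list \<Rightarrow> real) set"
  where "forms M E k \<equiv> alternating_sections M E k"

abbreviation multivectors ::
    "'m manifold \<Rightarrow> ('m, 'v::real_vector, 'z) vbundle_scheme \<Rightarrow> int \<Rightarrow> ('m \<Rightarrow> ('v \<Rightarrow> real) list \<Rightarrow> real) set"
  where "multivectors M E k \<equiv> alternating_sections M (dual_bundle E) k"

definition multivector_algebra ::
    "'m manifold \<Rightarrow> ('m, 'v::real_vector, 'z) vbundle_scheme \<Rightarrow> ('m \<Rightarrow> ('v \<Rightarrow> real) list \<Rightarrow> real) set"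
  where "multivector_algebra M E = span (\<Union>k. multivectors M E k)"

definition wedge_field ::
    "('m \<Rightarrow> 'v list \<Rightarrow> real) \<Rightarrow> ('m \<Rightarrow> 'v list \<Rightarrow> real) \<Rightarrow> 'm \<Rightarrow> 'v list \<Rightarrow> real"  (infixr \<open>\<and>\<^sub>w\<close> 75)
  where "(a \<and>\<^sub>w b) = (\<lambda>x. wedge (a x) (b x))"

definition of_fun :: "('m \<Rightarrow> real) \<Rightarrow> 'm \<Rightarrow> ('v \<Rightarrow> real) list \<Rightarrow> real"
  where "of_fun f x \<xi>s = (if \<xi>s = [] then f x else 0)"

definition of_section ::
    "('m, 'v::real_vector, 'z) vbundle_scheme \<Rightarrow> ('m \<Rightarrow> 'v) \<Rightarrow> 'm \<Rightarrow> ('v \<Rightarrow> real) list \<Rightarrow> real"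
  where "of_section E X x \<xi>s =
    (if length \<xi>s = 1 \<and> hd \<xi>s \<in> dual_space (fibre E x) then hd \<xi>s (X x) else 0)"

section \<open>Lie algebroids\<close>

record ('m, 'v) algebroid = "('m, 'v) vbundle" +
  anchor :: "'m \<Rightarrow> 'v \<Rightarrow> ('m \<Rightarrow> real) \<Rightarrow> real"
  bracket :: "('m \<Rightarrow> 'v) \<Rightarrow> ('m \<Rightarrow> 'v) \<Rightarrow> 'm \<Rightarrow> 'v"

definition act :: "('m, 'v) algebroid \<Rightarrow> ('m \<Rightarrow> 'v) \<Rightarrow> ('m \<Rightarrow> real) \<Rightarrow> 'm \<Rightarrow> real"
  where "act A X f x = anchor A x (X x) f"

text \<open>
  The anchor is a smooth bundle map to the tangent bundle: it is linear into the tangent space on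
  each fibre and maps smooth sections to smooth vector fields, i.e. to fields of tangent vectors
  that map smooth functions to smooth functions.
\<close>

definition lie_algebroid ::
    "('m::topological_space) manifold \<Rightarrow> ('m, 'v::real_vector) algebroid \<Rightarrow> bool"
  where "lie_algebroid M A \<longleftrightarrow>
    vector_bundle M A \<and>
    (\<forall>x. linear_on (fibre A x) (tangent_space M x) (anchor A x)) \<and>
    (\<forall>X\<in>sections M A. \<forall>f\<in>smooth_funs M. act A X f \<in> smooth_funs M) \<and>
    bilinear_on (sections M A) (sections M A) (sections M A) (bracket A) \<and>
    (\<forall>X\<in>sections M A. bracket A X X = 0) \<and>
    (\<forall>X\<in>sections M A. \<forall>Y\<in>sections M A. \<forall>Z\<in>sections M A.
       bracket A X (bracket A Y Z) + bracket A Y (bracket A Z X) + bracket A Z (bracket A X Y) = 0) \<and>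
    (\<forall>X\<in>sections M A. \<forall>Y\<in>sections M A. \<forall>f\<in>smooth_funs M.
       bracket A X (\<lambda>x. f x *\<^sub>R Y x) = (\<lambda>x. f x *\<^sub>R bracket A X Y x + act A X f x *\<^sub>R Y x))"

text \<open>
  \<open>S\<close> is the generalized Schouten bracket. The conditions determine it uniquely on the multivector
  algebra; its values elsewhere are irrelevant.
\<close>

definition schouten_bracket ::
    "'m manifold \<Rightarrow> ('m, 'v::real_vector) algebroid \<Rightarrow>
     (('m \<Rightarrow> ('v \<Rightarrow> real) list \<Rightarrow> real) \<Rightarrow> ('m \<Rightarrow> ('v \<Rightarrow> real) list \<Rightarrow> real) \<Rightarrow>
      'm \<Rightarrow> ('v \<Rightarrow> real) list \<Rightarrow> real) \<Rightarrow> bool"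
  where "schouten_bracket M A S \<longleftrightarrow>
    bilinear_on (multivector_algebra M A) (multivector_algebra M A) (multivector_algebra M A) S \<and>
    (\<forall>p q. \<forall>a\<in>multivectors M A p. \<forall>b\<in>multivectors M A q. S a b \<in> multivectors M A (p + q - 1)) \<and>
    (\<forall>X\<in>sections M A. \<forall>f\<in>smooth_funs M. S (of_section A X) (of_fun f) = of_fun (act A X f)) \<and>
    (\<forall>X\<in>sections M A. \<forall>Y\<in>sections M A.
       S (of_section A X) (of_section A Y) = of_section A (bracket A X Y)) \<and>
    (\<forall>p q. \<forall>a\<in>multivectors M A p. \<forall>b\<in>multivectors M A q.
       S a b = - ((- 1) powi ((p - 1) * (q - 1)) *\<^sub>R S b a)) \<and>
    (\<forall>p q. \<forall>a\<in>multivectors M A p. \<forall>b\<in>multivectors M A q. \<forall>c\<in>multivector_algebra M A.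
       S a (S b c) = S (S a b) c + (- 1) powi ((p - 1) * (q - 1)) *\<^sub>R S b (S a c)) \<and>
    (\<forall>p q. \<forall>a\<in>multivectors M A p. \<forall>b\<in>multivectors M A q. \<forall>c\<in>multivector_algebra M A.
       S a (b \<and>\<^sub>w c) = S a b \<and>\<^sub>w c + (- 1) powi ((p - 1) * q) *\<^sub>R (b \<and>\<^sub>w S a c))"

text \<open>\<open>A\<close>-connections on a vector bundle, through its space \<open>\<Gamma>\<close> of smooth sections.\<close>

definition A_connection ::
    "'m manifold \<Rightarrow> ('m, 'v::real_vector) algebroid \<Rightarrow> ('m \<Rightarrow> 'e::real_vector) set \<Rightarrow>
     (('m \<Rightarrow> 'v) \<Rightarrow> ('m \<Rightarrow> 'e) \<Rightarrow> 'm \<Rightarrow> 'e) \<Rightarrow> bool"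
  where "A_connection M A \<Gamma> nab \<longleftrightarrow>
    bilinear_on (sections M A) \<Gamma> \<Gamma> nab \<and>
    (\<forall>f\<in>smooth_funs M. \<forall>X\<in>sections M A. \<forall>s\<in>\<Gamma>.
       nab (\<lambda>x. f x *\<^sub>R X x) s = (\<lambda>x. f x *\<^sub>R nab X s x) \<and>
       nab X (\<lambda>x. f x *\<^sub>R s x) = (\<lambda>x. act A X f x *\<^sub>R s x + f x *\<^sub>R nab X s x))"

text \<open>
  \<open>D\<close> is the operator associated to the connection \<open>nab\<close> on the top exterior power; again it is
  uniquely determined on the multivector algebra.
\<close>

definition associated_operator ::
    "'m manifold \<Rightarrow> ('m, 'v::real_vector) algebroid \<Rightarrow>
     (('m \<Rightarrow> ('v \<Rightarrow> real) list \<Rightarrow> real) \<Rightarrow> ('m \<Rightarrow> ('v \<Rightarrow> real) list \<Rightarrow> real) \<Rightarrow>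
      'm \<Rightarrow> ('v \<Rightarrow> real) list \<Rightarrow> real) \<Rightarrow>
     (('m \<Rightarrow> 'v) \<Rightarrow> ('m \<Rightarrow> ('v \<Rightarrow> real) list \<Rightarrow> real) \<Rightarrow> 'm \<Rightarrow> ('v \<Rightarrow> real) list \<Rightarrow> real) \<Rightarrow>
     (('m \<Rightarrow> ('v \<Rightarrow> real) list \<Rightarrow> real) \<Rightarrow> 'm \<Rightarrow> ('v \<Rightarrow> real) list \<Rightarrow> real) \<Rightarrow> bool"
  where "associated_operator M A S nab D \<longleftrightarrow>
    linear_on (multivector_algebra M A) (multivector_algebra M A) D \<and>
    (\<forall>p. \<forall>a\<in>multivectors M A p. D a \<in> multivectors M A (p - 1)) \<and>
    (\<forall>f\<in>smooth_funs M. D (of_fun f) = 0) \<and>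
    (\<forall>X\<in>sections M A. \<forall>L\<in>multivectors M A (int (brank A)).
       D (of_section A X) \<and>\<^sub>w L = S (of_section A X) L - nab X L) \<and>
    (\<forall>p. \<forall>a\<in>multivectors M A p. \<forall>b\<in>multivector_algebra M A.
       D (a \<and>\<^sub>w b) = (- 1) powi p *\<^sub>R S a b + D a \<and>\<^sub>w b + (- 1) powi p *\<^sub>R (a \<and>\<^sub>w D b))"

section \<open>Homology and cohomology\<close>

definition quotient_space :: "'a::real_vector set \<Rightarrow> 'a set \<Rightarrow> 'a set set"
  where "quotient_space Z B = (\<lambda>z. (+) z ` B) ` Z"

text \<open>
  Linear isomorphism of two quotient spaces. In a quotient space, a coset \<open>R\<close> is the linear
  combination of the cosets \<open>P\<close> and \<open>Q\<close> with coefficients \<open>a\<close> and \<open>b\<close> iff it contains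
  \<open>a *\<^sub>R p + b *\<^sub>R q\<close> for some (equivalently, all) representatives \<open>p\<close> of \<open>P\<close> and \<open>q\<close> of \<open>Q\<close>.
\<close>

definition quotients_isomorphic ::
    "'a::real_vector set set \<Rightarrow> 'b::real_vector set set \<Rightarrow> bool"
  where "quotients_isomorphic H H' \<longleftrightarrow> (\<exists>\<Phi>. bij_betw \<Phi> H H' \<and>
    (\<forall>P\<in>H. \<forall>Q\<in>H. \<forall>R\<in>H. \<forall>p\<in>P. \<forall>q\<in>Q. \<forall>a b. a *\<^sub>R p + b *\<^sub>R q \<in> R \<longrightarrow>
       (\<forall>p'\<in>\<Phi> P. \<forall>q'\<in>\<Phi> Q. a *\<^sub>R p' + b *\<^sub>R q' \<in> \<Phi> R)))"

definition boundary ::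
    "('m, 'v::real_vector) algebroid \<Rightarrow>
     (('m \<Rightarrow> ('v \<Rightarrow> real) list \<Rightarrow> real) \<Rightarrow> 'm \<Rightarrow> ('v \<Rightarrow> real) list \<Rightarrow> real) \<Rightarrow>
     int \<Rightarrow> ('m \<Rightarrow> ('v \<Rightarrow> real) list \<Rightarrow> real) \<Rightarrow> 'm \<Rightarrow> ('v \<Rightarrow> real) list \<Rightarrow> real"
  where "boundary A D k a = (- 1) powi (int (brank A) - k) *\<^sub>R D a"

definition algebroid_homology ::
    "'m manifold \<Rightarrow> ('m, 'v::real_vector) algebroid \<Rightarrow>
     (('m \<Rightarrow> ('v \<Rightarrow> real) list \<Rightarrow> real) \<Rightarrow> 'm \<Rightarrow> ('v \<Rightarrow> real) list \<Rightarrow> real) \<Rightarrow>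
     int \<Rightarrow> ('m \<Rightarrow> ('v \<Rightarrow> real) list \<Rightarrow> real) set set"
  where "algebroid_homology M A D k =
    quotient_space {a \<in> multivectors M A k. boundary A D k a = 0}
      (boundary A D (k + 1) ` multivectors M A (k + 1))"

text \<open>
  The value of \<open>d\<omega>\<close> on sections \<open>Xs\<close>, as a function on the base. List positions start at 0, which
  turns the sign \<open>(-1)^(i+1)\<close> of the first sum of the usual formula into \<open>(-1)^i\<close>.
\<close>

definition coboundary_formula ::
    "('m, 'v) algebroid \<Rightarrow> ('m \<Rightarrow> 'v list \<Rightarrow> real) \<Rightarrow> ('m \<Rightarrow> 'v) list \<Rightarrow> 'm \<Rightarrow> real"
  where "coboundary_formula A \<omega> Xs x =
    (\<Sum>i<length Xs. (- 1) ^ i * act A (Xs ! i) (\<lambda>y. \<omega> y (map (\<lambda>X. X y) (nths Xs (- {i})))) x) +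
    (\<Sum>j<length Xs. \<Sum>i<j. (- 1) ^ (i + j) *
       \<omega> x (map (\<lambda>X. X x) (bracket A (Xs ! i) (Xs ! j) # nths Xs (- {i, j}))))"

definition coboundary ::
    "'m manifold \<Rightarrow> ('m, 'v::real_vector) algebroid \<Rightarrow> int \<Rightarrow>
     ('m \<Rightarrow> 'v list \<Rightarrow> real) \<Rightarrow> 'm \<Rightarrow> 'v list \<Rightarrow> real"
  where "coboundary M A k \<omega> = (THE \<eta>. \<eta> \<in> forms M A (k + 1) \<and>
    (\<forall>Xs. set Xs \<subseteq> sections M A \<and> int (length Xs) = k + 1 \<longrightarrow>
       (\<forall>x. \<eta> x (map (\<lambda>X. X x) Xs) = coboundary_formula A \<omega> Xs x)))"

definition algebroid_cohomology ::
    "'m manifold \<Rightarrow> ('m, 'v::real_vector) algebroid \<Rightarrow> int \<Rightarrow> ('m \<Rightarrow> 'v list \<Rightarrow> real) set set"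
  where "algebroid_cohomology M A k =
    quotient_space {\<omega> \<in> forms M A k. coboundary M A k \<omega> = 0}
      (coboundary M A (k - 1) ` forms M A (k - 1))"

end

theory Submission
  imports Defs
begin

text \<open>
  The volume element \<open>\<Lambda>\<close> turns a multivector \<open>a\<close> of degree \<open>k\<close> into the form \<open>star a\<close> of degree \<open>n - k\<close>
  whose value on \<open>v\<^sub>1, \<dots>, v\<^bsub>n-k\<^esub>\<close> is the coefficient of \<open>a \<and> v\<^sub>1 \<and> \<dots> \<and> v\<^bsub>n-k\<^esub>\<close> with respect to \<open>\<Lambda>\<close>.
  On a fibre this is bijective: it is injective because \<open>a \<and> v = 0\<close> for all \<open>v\<close> forces \<open>a = 0\<close> below
  the top degree, and contraction of \<open>\<Lambda>\<close> inverts it (\<open>contraction_star\<close>). In local frames both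
  directions have smooth coefficients, because \<open>\<Lambda>\<close> has no zero. So \<open>star\<close> is a bijection between
  smooth multivector fields and smooth forms, and it remains to see that it carries \<open>D\<close> to the
  Lie algebroid coboundary \<open>d\<close> up to sign.

  Horizontality of \<open>\<Lambda>\<close> makes \<open>D X\<close> the divergence of \<open>X\<close>: \<open>[X, \<Lambda>] = (D X) \<Lambda>\<close>. The identity that generates
  the bracket from \<open>D\<close> then reads \<open>D a \<and> X = D (a \<and> X) + (-1)^k ([X, a] - (D X) a)\<close> for \<open>a\<close> of degree
  \<open>k\<close>. Pass to coefficients of \<open>\<Lambda>\<close>: the product with \<open>X\<close> becomes contraction with \<open>X\<close>, and \<open>[X, a] - (D X) a\<close>
  becomes the Lie derivative along \<open>X\<close>, by the Leibniz rule. What results is Cartan's formula, which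
  \<open>d\<close> satisfies too (\<open>coboundary_formula_Cons\<close>), and induction on the number of arguments gives
  \<open>star (D a) = (-1)^k d (star a)\<close> on sections (\<open>wedge_sections_D\<close>).

  The coboundary is specified only by its values on global sections. The same equation shows that a form
  with these values exists, because \<open>star (D a)\<close> is one up to sign. Uniqueness holds because every vector
  extends to a global section; this is where smooth bump functions on the manifold enter. Signs
  change neither kernels nor images, so \<open>star\<close> induces the isomorphism of the quotients.
\<close>


section \<open>Differentiable functions on open subsets of the model\<close>

lemma openin_Euclidean_space_iff:
  "openin (Euclidean_space m) W \<longleftrightarrow> (\<exists>T. open T \<and> W = {p. \<forall>i\<ge>m. p i = 0} \<inter> T)"
proof -
  have "powertop_real UNIV = (euclidean :: (nat \<Rightarrow> real) topology)"
    using euclidean_product_topology by metis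
  then have "openin (Euclidean_space m) W \<longleftrightarrow> openin (top_of_set {p. \<forall>i\<ge>m. p i = 0}) W"
    by (simp only: Euclidean_space_def)
  then show ?thesis
    by (simp only: openin_open)
qed

lemma continuous_fun_upd:
  fixes p :: "nat \<Rightarrow> real"
  shows "continuous_on UNIV (\<lambda>t::real. p(i := t))"
proof (rule continuous_on_coordinatewise_then_product)
  show "continuous_on UNIV (\<lambda>t. (p(i := t)) j)" for j
    by (cases "j = i") auto
qed

lemma eventually_slice_in_open:
  assumes W: "openin (Euclidean_space m) W" and p: "p \<in> W" and i: "i < m"
  shows "eventually (\<lambda>t. p(i := t) \<in> W) (nhds (p i))"
proof -
  obtain T where T: "open T" "W = {p. \<forall>i\<ge>m. p i = 0} \<inter> T"
    using W by (auto simp: openin_Euclidean_space_iff)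
  have "open ((\<lambda>t. p(i := t)) -` T)"
    by (rule open_vimage[OF T(1) continuous_fun_upd])
  moreover have "p i \<in> (\<lambda>t. p(i := t)) -` T"
    using p T by simp
  ultimately have "eventually (\<lambda>t. t \<in> (\<lambda>t. p(i := t)) -` T) (nhds (p i))"
    by (rule eventually_nhds_in_open)
  then show ?thesis
    by eventually_elim (use p T i in auto)
qed

lemma slice_derivative_cong:
  assumes W: "openin (Euclidean_space m) W" and p: "p \<in> W" and i: "i < m"
    and eq: "\<And>q. q \<in> W \<Longrightarrow> f q = g q"
  shows "((\<lambda>t. f (p(i := t))) has_field_derivative D) (at (p i)) \<longleftrightarrow>
         ((\<lambda>t. g (p(i := t))) has_field_derivative D) (at (p i))"
proof (rule DERIV_cong_ev)
  show "eventually (\<lambda>t. f (p(i := t)) = g (p(i := t))) (nhds (p i))"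
    using eventually_slice_in_open[OF W p i] by eventually_elim (rule eq)
qed auto

lemma partial_deriv_cong:
  assumes "openin (Euclidean_space m) W" "p \<in> W" "i < m" "\<And>q. q \<in> W \<Longrightarrow> f q = g q"
  shows "partial_deriv i f p = partial_deriv i g p"
  by (simp only: partial_deriv_def deriv_def slice_derivative_cong[of m W p i f g, OF assms])

lemma Ck_on_continuous: "Ck_on m k W f \<Longrightarrow> continuous_on W f"
  by (cases k) auto

lemma Ck_on_has_partial_deriv:
  assumes "Ck_on m (Suc k) W f" "i < m" "p \<in> W"
  shows "((\<lambda>t. f (p(i := t))) has_field_derivative partial_deriv i f p) (at (p i))"
  using assms by (auto simp: partial_deriv_def field_differentiable_derivI)

lemma Ck_on_cong:
  assumes "openin (Euclidean_space m) W" "\<And>q. q \<in> W \<Longrightarrow> f q = g q" "Ck_on m k W f"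
  shows "Ck_on m k W g"
  using assms(2,3)
proof (induction k arbitrary: f g)
  case 0
  then show ?case using continuous_on_cong[OF refl, of W f g] by simp
next
  case (Suc k)
  show ?case unfolding Ck_on.simps
  proof (intro conjI allI impI ballI)
    show "continuous_on W g"
      using Ck_on_continuous[OF Suc.prems(2)] Suc.prems(1) continuous_on_cong[OF refl, of W f g] by blast
  next
    fix i p assume "i < m" "p \<in> W"
    then show "(\<lambda>t. g (p(i := t))) field_differentiable at (p i)"
      using Ck_on_has_partial_deriv[OF Suc.prems(2)] Suc.prems(1)
        slice_derivative_cong[OF assms(1), of p i f g] unfolding field_differentiable_def by blast
  next
    fix i assume i: "i < m"
    show "Ck_on m k W (partial_deriv i g)"
      by (rule Suc.IH[of "partial_deriv i f"])
         (use Suc.prems i partial_deriv_cong[OF assms(1) _ i, of _ f g] in auto)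
  qed
qed

text \<open>Continuous differentiability is checked by exhibiting the partial derivatives on the open set only.\<close>

lemma Ck_on_SucI:
  assumes W: "openin (Euclidean_space m) W" and f: "continuous_on W f"
    and D: "\<And>i p. i < m \<Longrightarrow> p \<in> W \<Longrightarrow>
              ((\<lambda>t. f (p(i := t))) has_field_derivative f' i p) (at (p i))"
    and C: "\<And>i. i < m \<Longrightarrow> Ck_on m k W (f' i)"
  shows "Ck_on m (Suc k) W f"
  unfolding Ck_on.simps
proof (intro conjI allI impI ballI f)
  fix i p assume "i < m" "p \<in> W"
  then show "(\<lambda>t. f (p(i := t))) field_differentiable at (p i)"
    using D field_differentiable_def by blast
next
  fix i assume i: "i < m"
  show "Ck_on m k W (partial_deriv i f)"
    by (rule Ck_on_cong[OF W _ C[OF i]]) (simp add: partial_deriv_def DERIV_imp_deriv[OF D[OF i]])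
qed

lemma Ck_on_Suc_imp: "Ck_on m (Suc k) W f \<Longrightarrow> Ck_on m k W f"
  by (induction k arbitrary: f) auto

lemma Ck_on_const: "openin (Euclidean_space m) W \<Longrightarrow> Ck_on m k W (\<lambda>_. c)"
proof (induction k arbitrary: c)
  case (Suc k)
  then show ?case
    by (intro Ck_on_SucI[where f' = "\<lambda>_ _. 0"]) auto
qed simp

lemma Ck_on_add:
  assumes W: "openin (Euclidean_space m) W"
  shows "Ck_on m k W f \<Longrightarrow> Ck_on m k W g \<Longrightarrow> Ck_on m k W (\<lambda>p. f p + g p)"
proof (induction k arbitrary: f g)
  case 0
  then show ?case by (auto intro: continuous_intros)
next
  case (Suc k)
  show ?case
    by (rule Ck_on_SucI[OF W, where f' = "\<lambda>i p. partial_deriv i f p + partial_deriv i g p"])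
       (use Suc Ck_on_has_partial_deriv[OF Suc.prems(1)] Ck_on_has_partial_deriv[OF Suc.prems(2)]
        in \<open>auto intro!: derivative_eq_intros continuous_intros\<close>)
qed

lemma Ck_on_mult:
  assumes W: "openin (Euclidean_space m) W"
  shows "Ck_on m k W f \<Longrightarrow> Ck_on m k W g \<Longrightarrow> Ck_on m k W (\<lambda>p. f p * g p)"
proof (induction k arbitrary: f g)
  case 0
  then show ?case by (auto intro: continuous_intros)
next
  case (Suc k)
  show ?case
  proof (rule Ck_on_SucI[OF W, where f' = "\<lambda>i p. partial_deriv i f p * g p + f p * partial_deriv i g p"])
    show "continuous_on W (\<lambda>p. f p * g p)"
      using Suc.prems by (auto intro: continuous_intros)
  next
    fix i p assume ip: "i < m" "p \<in> W"
    show "((\<lambda>t. f (p(i := t)) * g (p(i := t))) has_field_derivative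
            partial_deriv i f p * g p + f p * partial_deriv i g p) (at (p i))"
      using DERIV_mult[OF Ck_on_has_partial_deriv[OF Suc.prems(1) ip] Ck_on_has_partial_deriv[OF Suc.prems(2) ip]]
      by (simp only: fun_upd_triv mult.commute add.commute)
  next
    fix i assume i: "i < m"
    then show "Ck_on m k W (\<lambda>p. partial_deriv i f p * g p + f p * partial_deriv i g p)"
      using Suc.prems Ck_on_Suc_imp[OF Suc.prems(1)] Ck_on_Suc_imp[OF Suc.prems(2)]
      by (intro Ck_on_add[OF W] Suc.IH) auto
  qed
qed

text \<open>
  The only compositions that occur are with functions of one real variable: they give bump functions
  and reciprocals, and they avoid the general chain rule. The sequence \<open>h\<close> lists the derivatives.
\<close>

lemma Ck_on_compose:
  assumes W: "openin (Euclidean_space m) W" and sub: "f ` W \<subseteq> T"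
    and h: "\<And>n t. t \<in> T \<Longrightarrow> (h n has_field_derivative h (Suc n) t) (at t)"
  shows "Ck_on m k W f \<Longrightarrow> Ck_on m k W (\<lambda>p. h n (f p))"
proof (induction k arbitrary: n)
  case 0
  have "continuous_on T (h n)"
    using h by (meson DERIV_isCont continuous_at_imp_continuous_on)
  then show ?case
    using 0 sub by (auto intro: continuous_on_compose2)
next
  case (Suc k)
  show ?case
  proof (rule Ck_on_SucI[OF W, where f' = "\<lambda>i p. h (Suc n) (f p) * partial_deriv i f p"])
    have "continuous_on T (h n)"
      using h by (meson DERIV_isCont continuous_at_imp_continuous_on)
    then show "continuous_on W (\<lambda>p. h n (f p))"
      using Suc.prems sub by (auto intro: continuous_on_compose2)
  next
    fix i p assume ip: "i < m" "p \<in> W"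
    have "(h n has_field_derivative h (Suc n) (f p)) (at (f (p(i := p i))))"
      using h sub ip by (simp add: image_subset_iff)
    from DERIV_chain2[OF this Ck_on_has_partial_deriv[OF Suc.prems ip]]
    show "((\<lambda>t. h n (f (p(i := t)))) has_field_derivative h (Suc n) (f p) * partial_deriv i f p) (at (p i))" .
  next
    fix i assume i: "i < m"
    then show "Ck_on m k W (\<lambda>p. h (Suc n) (f p) * partial_deriv i f p)"
      using Suc.prems Suc.IH[OF Ck_on_Suc_imp[OF Suc.prems]] by (intro Ck_on_mult[OF W]) auto
  qed
qed

lemma Ck_on_subset: "Ck_on m k W f \<Longrightarrow> W' \<subseteq> W \<Longrightarrow> Ck_on m k W' f"
  by (induction k arbitrary: f) (auto intro: continuous_on_subset)

lemma Ck_on_local: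
  assumes W: "openin (Euclidean_space m) W"
    and loc: "\<And>p. p \<in> W \<Longrightarrow> \<exists>W'. openin (Euclidean_space m) W' \<and> p \<in> W' \<and> Ck_on m k W' f"
  shows "Ck_on m k W f"
  using loc
proof (induction k arbitrary: f)
  have cont: "continuous_on W f"
    if loc: "\<And>p. p \<in> W \<Longrightarrow> \<exists>W'. openin (Euclidean_space m) W' \<and> p \<in> W' \<and> continuous_on W' f"
    for f :: "(nat \<Rightarrow> real) \<Rightarrow> real"
    unfolding continuous_on_def
  proof
    fix p assume p: "p \<in> W"
    obtain W' where W': "openin (Euclidean_space m) W'" "p \<in> W'" "continuous_on W' f"
      using loc[OF p] by blast
    obtain T' where T': "open T'" "W' = {p. \<forall>i\<ge>m. p i = 0} \<inter> T'"
      using W'(1) by (auto simp: openin_Euclidean_space_iff)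
    obtain T where T: "open T" "W = {p. \<forall>i\<ge>m. p i = 0} \<inter> T"
      using W by (auto simp: openin_Euclidean_space_iff)
    have "at p within W = at p within W'"
      by (rule at_within_nhd[of p "T \<inter> T'"]) (use p W' T T' in auto)
    then show "(f \<longlongrightarrow> f p) (at p within W)"
      using W' by (auto simp: continuous_on_def)
  qed
  {
    case 0
    show ?case unfolding Ck_on.simps
      by (rule cont) (rule 0[unfolded Ck_on.simps])
  next
    case (Suc k)
    show ?case unfolding Ck_on.simps
    proof (intro conjI allI impI ballI)
      show "continuous_on W f"
        by (rule cont) (meson Suc.prems Ck_on_continuous)
    next
      fix i p assume "i < m" "p \<in> W"
      then show "(\<lambda>t. f (p(i := t))) field_differentiable at (p i)"
        using Suc.prems[of p] by auto
    next
      fix i assume "i < m"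
      then show "Ck_on m k W (partial_deriv i f)"
        by (intro Suc.IH) (meson Suc.prems Ck_on.simps(2))
    qed
  }
qed

section \<open>A smooth function on the line supported in the positive half-line\<close>

text \<open>
  The functions \<open>p(1/t) exp(-1/t)\<close> for \<open>t > 0\<close>, continued by zero, are closed under differentiation;
  on the coefficient polynomial the derivative is \<open>p \<mapsto> X^2 (p - p')\<close>.
\<close>

definition flat_fun :: "real poly \<Rightarrow> real \<Rightarrow> real"
  where "flat_fun p t = (if t > 0 then poly p (1 / t) * exp (- (1 / t)) else 0)"

definition flat_deriv :: "real poly \<Rightarrow> real poly"
  where "flat_deriv p = [:0, 0, 1:] * (p - pderiv p)"

lemma poly_over_exp_tendsto_0: "((\<lambda>x::real. poly p x * exp (- x)) \<longlongrightarrow> 0) at_top"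
proof -
  have "((\<lambda>x::real. (\<Sum>i\<le>degree p. coeff p i * (x ^ i / exp x))) \<longlongrightarrow> (\<Sum>i\<le>degree p. coeff p i * 0)) at_top"
    by (intro tendsto_intros tendsto_power_div_exp_0)
  then show ?thesis
    by (simp add: poly_altdef sum_distrib_right sum_divide_distrib exp_minus field_simps)
qed

lemma flat_fun_has_derivative:
  "(flat_fun p has_field_derivative flat_fun (flat_deriv p) t) (at t)"
proof (cases "t > 0")
  case True
  have "((\<lambda>t. poly p (1 / t) * exp (- (1 / t))) has_field_derivative flat_fun (flat_deriv p) t) (at t)"
    using True unfolding flat_fun_def flat_deriv_def
    by (auto intro!: derivative_eq_intros poly_DERIV[THEN DERIV_chain2]
             simp: field_simps power2_eq_square)
  moreover have "eventually (\<lambda>s. flat_fun p s = poly p (1 / s) * exp (- (1 / s))) (nhds t)"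
    using eventually_nhds_in_open[of "{0<..}" t] True
    by (auto elim!: eventually_mono simp: flat_fun_def)
  ultimately show ?thesis
    by (subst DERIV_cong_ev[OF refl _ refl])
next
  case False
  show ?thesis
  proof (cases "t < 0")
    case True
    have "eventually (\<lambda>s. flat_fun p s = 0) (nhds t)"
      using eventually_nhds_in_open[of "{..<0}" t] True
      by (auto elim!: eventually_mono simp: flat_fun_def)
    moreover have "((\<lambda>_. 0) has_field_derivative flat_fun (flat_deriv p) t) (at t)"
      using True by (simp add: flat_fun_def)
    ultimately show ?thesis
      by (subst DERIV_cong_ev[OF refl _ refl])
  next
    case False
    with \<open>\<not> t > 0\<close> have t: "t = 0" by simp
    have "((\<lambda>s. flat_fun p s / s) \<longlongrightarrow> 0) (at 0)"
    proof (rule filterlim_split_at)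
      show "((\<lambda>s. flat_fun p s / s) \<longlongrightarrow> 0) (at_left 0)"
        by (rule tendsto_eventually)
           (auto simp: flat_fun_def eventually_at_filter)
      have "((\<lambda>s. poly ([:0, 1:] * p) (inverse s) * exp (- inverse s)) \<longlongrightarrow> 0) (at_right 0)"
        by (rule filterlim_compose[OF poly_over_exp_tendsto_0 filterlim_inverse_at_top_right])
      moreover have "eventually (\<lambda>s. poly ([:0, 1:] * p) (inverse s) * exp (- inverse s) = flat_fun p s / s) (at_right 0)"
        by (auto simp: flat_fun_def eventually_at_filter field_simps)
      ultimately show "((\<lambda>s. flat_fun p s / s) \<longlongrightarrow> 0) (at_right 0)"
        by (rule Lim_transform_eventually)
    qed
    then show ?thesis
      by (simp add: DERIV_def flat_fun_def t)
  qed
qed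

section \<open>Smooth functions on a manifold\<close>

lemma chart_open_image:
  fixes M :: "('m::{t2_space, second_countable_topology}) manifold"
  assumes M: "smooth_manifold M" and c: "(V, \<phi>) \<in> atlas M" and U: "open U"
  shows "openin (Euclidean_space (mdim M)) (\<phi> ` (U \<inter> V))"
proof -
  have V: "openin (Euclidean_space (mdim M)) (\<phi> ` V)"
    and h: "homeomorphic_map (top_of_set V) (subtopology (Euclidean_space (mdim M)) (\<phi> ` V)) \<phi>"
    using M c unfolding smooth_manifold_def by auto
  have "openin (top_of_set V) (U \<inter> V)"
    using U by (auto simp: openin_open)
  then have "openin (subtopology (Euclidean_space (mdim M)) (\<phi> ` V)) (\<phi> ` (U \<inter> V))"
    using homeomorphic_imp_open_map[OF h] by (simp add: open_map_def)
  then show ?thesis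
    using V by (rule openin_trans_full)
qed

lemma chart_inj:
  assumes "smooth_manifold M" "(V, \<phi>) \<in> atlas M"
  shows "inj_on \<phi> V"
proof -
  have "homeomorphic_map (top_of_set V) (subtopology (Euclidean_space (mdim M)) (\<phi> ` V)) \<phi>"
    using assms unfolding smooth_manifold_def by auto
  then show ?thesis
    using homeomorphic_imp_injective_map by fastforce
qed

lemma chart_inverse:
  assumes "smooth_manifold M" "(V, \<phi>) \<in> atlas M" "y \<in> V"
  shows "inv_into V \<phi> (\<phi> y) = y"
  using inv_into_f_f[OF chart_inj[OF assms(1,2)]] assms(3) by simp

lemma smooth_fun_onI:
  assumes "\<And>V \<phi> k. (V, \<phi>) \<in> atlas M \<Longrightarrow> Ck_on (mdim M) k (\<phi> ` (U \<inter> V)) (\<lambda>p. f (inv_into V \<phi> p))"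
  shows "smooth_fun_on M U f"
  using assms by (auto simp: smooth_fun_on_def Cinf_on_def)

lemma smooth_fun_onD:
  "smooth_fun_on M U f \<Longrightarrow> (V, \<phi>) \<in> atlas M \<Longrightarrow>
    Ck_on (mdim M) k (\<phi> ` (U \<inter> V)) (\<lambda>p. f (inv_into V \<phi> p))"
  by (auto simp: smooth_fun_on_def Cinf_on_def)

lemma smooth_fun_on_subset: "smooth_fun_on M U f \<Longrightarrow> U' \<subseteq> U \<Longrightarrow> smooth_fun_on M U' f"
  by (rule smooth_fun_onI, rule Ck_on_subset[OF smooth_fun_onD]) auto

lemma smooth_funs_on: "f \<in> smooth_funs M \<Longrightarrow> smooth_fun_on M U f"
  unfolding smooth_funs_def using smooth_fun_on_subset by blast

context
  fixes M :: "('m::{t2_space, second_countable_topology}) manifold"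
  assumes M: "smooth_manifold M"
begin

lemma smooth_fun_on_cong:
  assumes U: "open U" and eq: "\<And>y. y \<in> U \<Longrightarrow> f y = g y" and f: "smooth_fun_on M U f"
  shows "smooth_fun_on M U g"
proof (rule smooth_fun_onI)
  fix V \<phi> k assume c: "(V, \<phi>) \<in> atlas M"
  show "Ck_on (mdim M) k (\<phi> ` (U \<inter> V)) (\<lambda>p. g (inv_into V \<phi> p))"
    by (rule Ck_on_cong[OF chart_open_image[OF M c U] _ smooth_fun_onD[OF f c]])
       (use eq in \<open>auto simp: chart_inverse[OF M c]\<close>)
qed

lemma smooth_fun_on_const: "open U \<Longrightarrow> smooth_fun_on M U (\<lambda>_. c)"
  by (rule smooth_fun_onI) (rule Ck_on_const[OF chart_open_image[OF M]])

lemma smooth_fun_on_add: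
  "open U \<Longrightarrow> smooth_fun_on M U f \<Longrightarrow> smooth_fun_on M U g \<Longrightarrow> smooth_fun_on M U (\<lambda>y. f y + g y)"
  by (rule smooth_fun_onI) (rule Ck_on_add[OF chart_open_image[OF M] smooth_fun_onD smooth_fun_onD])

lemma smooth_fun_on_mult:
  "open U \<Longrightarrow> smooth_fun_on M U f \<Longrightarrow> smooth_fun_on M U g \<Longrightarrow> smooth_fun_on M U (\<lambda>y. f y * g y)"
  by (rule smooth_fun_onI) (rule Ck_on_mult[OF chart_open_image[OF M] smooth_fun_onD smooth_fun_onD])

lemma smooth_fun_on_diff:
  assumes "open U" "smooth_fun_on M U f" "smooth_fun_on M U g"
  shows "smooth_fun_on M U (\<lambda>y. f y - g y)"
  using smooth_fun_on_add[OF assms(1,2) smooth_fun_on_mult[OF assms(1) smooth_fun_on_const[OF assms(1), of "- 1"] assms(3)]]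
  by simp

lemma smooth_fun_on_sum:
  assumes "open U" "\<And>i. i \<in> I \<Longrightarrow> smooth_fun_on M U (f i)"
  shows "smooth_fun_on M U (\<lambda>y. \<Sum>i\<in>I. f i y)"
  using assms(2)
  by (induction I rule: infinite_finite_induct)
     (auto intro: smooth_fun_on_const smooth_fun_on_add assms(1))

lemma smooth_fun_on_prod:
  assumes "open U" "\<And>i. i \<in> I \<Longrightarrow> smooth_fun_on M U (f i)"
  shows "smooth_fun_on M U (\<lambda>y. \<Prod>i\<in>I. f i y)"
  using assms(2)
  by (induction I rule: infinite_finite_induct)
     (auto intro: smooth_fun_on_const smooth_fun_on_mult assms(1))

lemma smooth_fun_on_compose:
  assumes U: "open U" and f: "smooth_fun_on M U f" and sub: "f ` U \<subseteq> T"
    and h: "\<And>n t. t \<in> T \<Longrightarrow> (h n has_field_derivative h (Suc n) t) (at t)"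
  shows "smooth_fun_on M U (\<lambda>y. h n (f y))"
proof (rule smooth_fun_onI)
  fix V \<phi> k assume c: "(V, \<phi>) \<in> atlas M"
  show "Ck_on (mdim M) k (\<phi> ` (U \<inter> V)) (\<lambda>p. h n (f (inv_into V \<phi> p)))"
    by (rule Ck_on_compose[where T = T and h = h, OF chart_open_image[OF M c U] _ h smooth_fun_onD[OF f c]])
       (use sub in \<open>auto simp: chart_inverse[OF M c]\<close>)
qed

lemma smooth_fun_on_inverse:
  assumes U: "open U" and f: "smooth_fun_on M U f" and nz: "\<And>y. y \<in> U \<Longrightarrow> f y \<noteq> 0"
  shows "smooth_fun_on M U (\<lambda>y. inverse (f y))"
proof -
  \<comment> \<open>The \<open>n\<close>-th derivative of the reciprocal.\<close>
  define h where "h n t = (- 1) ^ n * fact n * inverse t ^ Suc n" for n and t :: real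
  have "(h n has_field_derivative h (Suc n) t) (at t)" if "t \<in> - {0}" for n t
    using DERIV_cmult[OF DERIV_power_Suc[OF DERIV_inverse, of t n], of "(- 1) ^ n * fact n"] that
    unfolding h_def by (simp add: algebra_simps)
  from smooth_fun_on_compose[where h = h and T = "- {0}" and n = 0, OF U f _ this] show ?thesis
    using nz by (fastforce simp: h_def)
qed

lemma smooth_fun_on_divide:
  assumes "open U" "smooth_fun_on M U f" "smooth_fun_on M U g" "\<And>y. y \<in> U \<Longrightarrow> g y \<noteq> 0"
  shows "smooth_fun_on M U (\<lambda>y. f y / g y)"
  using smooth_fun_on_mult[OF assms(1,2) smooth_fun_on_inverse[OF assms(1,3,4)]]
  by (simp add: divide_inverse)

lemma smooth_fun_on_local:
  assumes U: "open U"
    and loc: "\<And>y. y \<in> U \<Longrightarrow> \<exists>U'. open U' \<and> y \<in> U' \<and> smooth_fun_on M U' f"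
  shows "smooth_fun_on M U f"
proof (rule smooth_fun_onI)
  fix V \<phi> k assume c: "(V, \<phi>) \<in> atlas M"
  show "Ck_on (mdim M) k (\<phi> ` (U \<inter> V)) (\<lambda>p. f (inv_into V \<phi> p))"
  proof (rule Ck_on_local[OF chart_open_image[OF M c U]])
    fix p assume "p \<in> \<phi> ` (U \<inter> V)"
    then obtain y where y: "y \<in> U" "y \<in> V" "p = \<phi> y"
      by auto
    then obtain U' where U': "open U'" "y \<in> U'" "smooth_fun_on M U' f"
      using loc by meson
    have "p \<in> \<phi> ` (U' \<inter> V)"
      using y U' by auto
    then show "\<exists>W'. openin (Euclidean_space (mdim M)) W' \<and> p \<in> W' \<and>
                 Ck_on (mdim M) k W' (\<lambda>p. f (inv_into V \<phi> p))"
      using chart_open_image[OF M c U'(1)] smooth_fun_onD[OF U'(3) c] by meson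
  qed
qed

lemma smooth_fun_on_chart:
  assumes "(V, \<phi>) \<in> atlas M" "i < mdim M"
  shows "smooth_fun_on M V (\<lambda>y. \<phi> y i)"
  unfolding smooth_fun_on_def
proof (clarify)
  fix U \<psi> assume c: "(U, \<psi>) \<in> atlas M"
  have "\<forall>(U, \<phi>)\<in>atlas M. \<forall>(V, \<psi>)\<in>atlas M. \<forall>i<mdim M.
       Cinf_on (mdim M) (\<phi> ` (U \<inter> V)) (\<lambda>p. \<psi> (inv_into U \<phi> p) i)"
    using M unfolding smooth_manifold_def by (elim conjE)
  from bspec[OF bspec[OF this c, unfolded case_prod_conv] assms(1)] assms(2)
  show "Cinf_on (mdim M) (\<psi> ` (V \<inter> U)) (\<lambda>p. \<phi> (inv_into U \<psi> p) i)"
    by (simp add: Int_commute)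
qed

end

lemma Euclidean_space_box_in_open:
  assumes W: "openin (Euclidean_space m) W" and p: "p \<in> W"
  obtains r where "r > 0" "\<And>q. (\<forall>i\<ge>m. q i = 0) \<Longrightarrow> (\<forall>i<m. \<bar>q i - p i\<bar> \<le> r) \<Longrightarrow> q \<in> W"
proof -
  obtain T where T: "open T" "W = {p. \<forall>i\<ge>m. p i = 0} \<inter> T"
    using W by (auto simp: openin_Euclidean_space_iff)
  have "openin (product_topology (\<lambda>i. euclidean) UNIV) T"
    using T by (simp add: euclidean_product_topology)
  then obtain X where X: "p \<in> PiE UNIV X" "\<And>i. open (X i)" "PiE UNIV X \<subseteq> T"
    using product_topology_open_contains_basis[of "\<lambda>i. euclidean" UNIV T p] p T by auto
  have "\<exists>r>0. \<forall>t. \<bar>t - p i\<bar> \<le> r \<longrightarrow> t \<in> X i" for i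
  proof -
    have "p i \<in> X i" using X(1) by auto
    then obtain r where "r > 0" "cball (p i) r \<subseteq> X i"
      using X(2) open_contains_cball by blast
    then show ?thesis
      by (auto simp: subset_iff dist_real_def abs_minus_commute)
  qed
  then obtain r where r: "\<And>i. r i > 0" "\<And>i t. \<bar>t - p i\<bar> \<le> r i \<Longrightarrow> t \<in> X i"
    by metis
  define R where "R = Min (insert 1 (r ` {..<m}))"
  have R: "R > 0" "\<And>i. i < m \<Longrightarrow> R \<le> r i"
    using r(1) by (auto simp: R_def)
  show ?thesis
  proof (rule that[OF R(1)])
    fix q assume q: "\<forall>i\<ge>m. q i = 0" "\<forall>i<m. \<bar>q i - p i\<bar> \<le> R"
    have "q i \<in> X i" for i
    proof (cases "i < m")
      case True
      then show ?thesis using q(2) R(2)[OF True] by (intro r(2)) fastforce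
    next
      case False
      then have "q i = p i" using q(1) p T by auto
      then show ?thesis using X(1) by auto
    qed
    then show "q \<in> W" using X(3) q(1) T by auto
  qed
qed

lemma compact_Euclidean_space_box:
  "compact {q :: nat \<Rightarrow> real. (\<forall>i\<ge>m. q i = 0) \<and> (\<forall>i<m. \<bar>q i - p i\<bar> \<le> r)}"
proof -
  have eq: "{q. (\<forall>i\<ge>m. q i = 0) \<and> (\<forall>i<m. \<bar>q i - p i\<bar> \<le> r)} =
        (PiE UNIV (\<lambda>i. if i < m then cball (p i) r else {0}))" (is "?L = ?R")
  proof (intro set_eqI iffI)
    fix q assume "q \<in> ?L" then show "q \<in> ?R"
      by (auto simp: PiE_iff dist_real_def abs_minus_commute)
  next
    fix q assume "q \<in> ?R"
    then have "q i \<in> (if i < m then cball (p i) r else {0})" for i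
      by (auto simp: PiE_iff)
    then show "q \<in> ?L"
      by (simp add: dist_real_def abs_minus_commute if_split_mem2)
  qed
  have "compactin (product_topology (\<lambda>i. euclidean) UNIV) ?R"
    by (subst compactin_PiE) (auto simp: compactin_euclidean_iff)
  then show ?thesis
    unfolding eq by (simp only: euclidean_product_topology compactin_euclidean_iff)
qed

text \<open>
  The support of the bump is the image of a compact box under a chart; it is closed in the whole
  manifold because the manifold is Hausdorff, so the continuation by zero is smooth.
\<close>

lemma smooth_bump_function:
  fixes M :: "('m::{t2_space, second_countable_topology}) manifold"
  assumes M: "smooth_manifold M" and G: "open G" and x: "x \<in> G"
  obtains b K where "b \<in> smooth_funs M" "closed K" "K \<subseteq> G" "\<And>y. y \<notin> K \<Longrightarrow> b y = 0" "b x = 1"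
proof -
  define m where "m = mdim M"
  have "x \<in> (\<Union>(U, \<phi>)\<in>atlas M. U)"
    using M unfolding smooth_manifold_def by simp
  then obtain V \<phi> where c: "(V, \<phi>) \<in> atlas M" and xV: "x \<in> V"
    by auto
  have V: "open V"
    and hom: "homeomorphic_map (top_of_set V) (subtopology (Euclidean_space m) (\<phi> ` V)) \<phi>"
    using M c unfolding smooth_manifold_def m_def by auto
  have VE: "\<phi> ` V \<subseteq> {p. \<forall>i\<ge>m. p i = 0}"
    using openin_subset[OF chart_open_image[OF M c open_UNIV]] by (simp add: topspace_Euclidean_space m_def)
  have "\<phi> x \<in> \<phi> ` (G \<inter> V)"
    using x xV by auto
  then obtain r where r: "r > 0"
    "\<And>q. (\<forall>i\<ge>m. q i = 0) \<Longrightarrow> (\<forall>i<m. \<bar>q i - \<phi> x i\<bar> \<le> r) \<Longrightarrow> q \<in> \<phi> ` (G \<inter> V)"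
    using Euclidean_space_box_in_open[OF chart_open_image[OF M c G]] m_def by metis
  define B where "B = {q. (\<forall>i\<ge>m. q i = 0) \<and> (\<forall>i<m. \<bar>q i - \<phi> x i\<bar> \<le> r)}"
  have B: "B \<subseteq> \<phi> ` (G \<inter> V)"
    using r(2) by (auto simp: B_def)
  define K where "K = inv_into V \<phi> ` B"
  have K: "K = {y \<in> V. \<phi> y \<in> B}"
  proof (intro set_eqI iffI)
    fix y assume "y \<in> K"
    then obtain q where q: "q \<in> B" "y = inv_into V \<phi> q" by (auto simp: K_def)
    then show "y \<in> {y \<in> V. \<phi> y \<in> B}"
      using B by (auto simp: inv_into_into f_inv_into_f image_mono subset_iff)
  next
    fix y assume "y \<in> {y \<in> V. \<phi> y \<in> B}"
    then show "y \<in> K"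
      unfolding K_def by (auto simp: chart_inverse[OF M c] intro!: image_eqI[of y _ "\<phi> y"])
  qed
  have "continuous_on B (inv_into V \<phi>)"
  proof -
    obtain g where g: "homeomorphic_maps (top_of_set V) (subtopology (Euclidean_space m) (\<phi> ` V)) \<phi> g"
      using hom by (auto simp: homeomorphic_map_maps)
    have "Euclidean_space m = top_of_set {p. \<forall>i\<ge>m. p i = 0}"
      unfolding Euclidean_space_def by (simp only: euclidean_product_topology)
    then have "subtopology (Euclidean_space m) (\<phi> ` V) = top_of_set (\<phi> ` V)"
      using VE by (simp add: subtopology_subtopology Int_absorb1)
    then have "continuous_on (\<phi> ` V) g" "\<And>y. y \<in> V \<Longrightarrow> g (\<phi> y) = y"
      using g unfolding homeomorphic_maps_def by auto
    moreover from this have "continuous_on (\<phi> ` V) (inv_into V \<phi>) \<longleftrightarrow> continuous_on (\<phi> ` V) g"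
      by (intro continuous_on_cong) (auto simp: chart_inverse[OF M c])
    ultimately have "continuous_on (\<phi> ` V) (inv_into V \<phi>)"
      by simp
    then show ?thesis
      by (rule continuous_on_subset) (use B in auto)
  qed
  then have "compact K"
    unfolding K_def B_def by (rule compact_continuous_image) (rule compact_Euclidean_space_box)
  then have closed: "closed K"
    by (rule compact_imp_closed)
  have KG: "K \<subseteq> G"
  proof
    fix y assume "y \<in> K"
    then have y: "y \<in> V" "\<phi> y \<in> \<phi> ` (G \<inter> V)" using B K by auto
    then obtain z where z: "z \<in> G" "z \<in> V" "\<phi> y = \<phi> z" by auto
    then have "y = z" using chart_inj[OF M c] y by (meson inj_onD)
    then show "y \<in> G" using z by simp
  qed
  \<comment> \<open>The factor for coordinate \<open>i\<close> is positive exactly where that coordinate is less than \<open>r\<close> away from \<open>x\<close>.\<close>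
  define h where "h n = flat_fun ((flat_deriv ^^ n) 1)" for n
  have h: "(h n has_field_derivative h (Suc n) t) (at t)" for n t
    using flat_fun_has_derivative[of "(flat_deriv ^^ n) 1" t] by (simp add: h_def)
  have h0: "h 0 t = (if t > 0 then exp (- (1 / t)) else 0)" for t
    by (simp add: h_def flat_fun_def)
  define b where "b y = (if y \<in> V then \<Prod>i<m. h 0 (r\<^sup>2 - (\<phi> y i - \<phi> x i) * (\<phi> y i - \<phi> x i)) else 0)" for y
  have b0: "b y = 0" if "y \<notin> K" for y
  proof (cases "y \<in> V")
    case True
    with that obtain i where i: "i < m" "\<bar>\<phi> y i - \<phi> x i\<bar> > r"
      using VE by (auto simp: K B_def not_le)
    then have "r\<^sup>2 < (\<phi> y i - \<phi> x i) * (\<phi> y i - \<phi> x i)"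
      using r(1) power_strict_mono[OF i(2), of 2] by (simp add: power2_eq_square)
    then have "h 0 (r\<^sup>2 - (\<phi> y i - \<phi> x i) * (\<phi> y i - \<phi> x i)) = 0"
      by (simp add: h0)
    then show ?thesis
      using i(1) unfolding b_def by (auto intro!: prod_zero)
  qed (simp add: b_def)
  have bV: "smooth_fun_on M V b"
  proof (rule smooth_fun_on_cong[OF M V])
    show "smooth_fun_on M V (\<lambda>y. \<Prod>i<m. h 0 (r\<^sup>2 - (\<phi> y i - \<phi> x i) * (\<phi> y i - \<phi> x i)))"
      by (intro smooth_fun_on_prod[OF M V] smooth_fun_on_compose[OF M V, of _ UNIV h] h
          smooth_fun_on_diff[OF M V] smooth_fun_on_mult[OF M V] smooth_fun_on_const[OF M V]
          smooth_fun_on_chart[OF M c]) (auto simp: m_def)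
  qed (simp add: b_def)
  have "smooth_fun_on M UNIV b"
  proof (rule smooth_fun_on_local[OF M open_UNIV])
    fix y
    show "\<exists>U'. open U' \<and> y \<in> U' \<and> smooth_fun_on M U' b"
    proof (cases "y \<in> V")
      case True
      then show ?thesis using V bV by blast
    next
      case False
      have "smooth_fun_on M (- K) b"
        by (rule smooth_fun_on_cong[OF M _ _ smooth_fun_on_const[OF M, of _ 0]]) (use closed b0 in auto)
      then show ?thesis using closed False K by (intro exI[of _ "- K"]) auto
    qed
  qed
  then have b: "b \<in> smooth_funs M"
    by (simp add: smooth_funs_def)
  have bx: "b x \<noteq> 0"
    using xV r(1) by (simp add: b_def h0)
  show ?thesis
  proof (rule that[OF _ closed KG])
    show "(\<lambda>y. inverse (b x) * b y) \<in> smooth_funs M"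
      using smooth_fun_on_mult[OF M open_UNIV smooth_fun_on_const[OF M open_UNIV] smooth_funs_on[OF b]]
      by (simp add: smooth_funs_def)
  qed (use b0 bx in auto)
qed

section \<open>Sections through prescribed vectors\<close>

lemma frame_expansion:
  assumes E: "vector_bundle M E" and f: "(U, e) \<in> frames E" and x: "x \<in> U" and v: "v \<in> fibre E x"
  obtains c where "v = (\<Sum>i<brank E. c i *\<^sub>R e i x)"
proof -
  have s: "span ((\<lambda>i. e i x) ` {..<brank E}) = fibre E x" and i: "inj_on (\<lambda>i. e i x) {..<brank E}"
    using E f x unfolding vector_bundle_def by auto
  obtain u where "v = (\<Sum>w\<in>(\<lambda>i. e i x) ` {..<brank E}. u w *\<^sub>R w)"
    using v unfolding s[symmetric] by (auto simp: span_finite)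
  then show ?thesis
    using that[of "\<lambda>i. u (e i x)"] by (simp add: sum.reindex[OF i])
qed

text \<open>
  The local section with constant components is cut off by a bump function supported in the frame
  domain.
\<close>

lemma exists_section_through:
  fixes M :: "('m::{t2_space, second_countable_topology}) manifold"
  assumes M: "smooth_manifold M" and E: "vector_bundle M E" and v: "v \<in> fibre E x"
  obtains X where "X \<in> sections M E" "X x = v"
proof -
  define n where "n = brank E"
  have "x \<in> (\<Union>(U, e)\<in>frames E. U)"
    using E unfolding vector_bundle_def by simp
  then obtain U e where f: "(U, e) \<in> frames E" and xU: "x \<in> U"
    by auto
  have U: "open U" and es: "\<And>i. i < n \<Longrightarrow> smooth_components M E U (e i)"
    and sub: "\<And>x. subspace (fibre E x)"
    and span: "\<And>y. y \<in> U \<Longrightarrow> span ((\<lambda>i. e i y) ` {..<n}) = fibre E y"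
    using E f unfolding vector_bundle_def n_def by auto
  have ef: "e i y \<in> fibre E y" if "y \<in> U" "i < n" for i y
    unfolding span[OF that(1), symmetric] using that(2) by (intro span_base) auto
  obtain c where c: "v = (\<Sum>i<n. c i *\<^sub>R e i x)"
    using frame_expansion[OF E f xU v] n_def by metis
  obtain b K where b: "b \<in> smooth_funs M" "closed K" "K \<subseteq> U" "\<And>y. y \<notin> K \<Longrightarrow> b y = 0" "b x = 1"
    using smooth_bump_function[OF M U xU] by blast
  define X where "X y = (if y \<in> U then \<Sum>i<n. (b y * c i) *\<^sub>R e i y else 0)" for y
  have X0: "X y = 0" if "y \<notin> K" for y
    using b(4)[OF that] by (simp add: X_def)
  have "X \<in> sections M E"
    unfolding sections_def smooth_components_def
  proof (intro CollectI conjI allI ballI, goal_cases)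
    case (1 y)
    show ?case
      using sub[of y] ef[of y] by (auto simp: X_def intro!: subspace_sum subspace_scale subspace_0)
  next
    case (2 Ve)
    obtain V e' where Ve: "Ve = (V, e')" by (cases Ve)
    have V: "open V"
      using E 2 Ve unfolding vector_bundle_def by auto
    have "\<forall>i. \<exists>g. i < n \<longrightarrow> (\<forall>j<n. smooth_fun_on M (U \<inter> V) (g j)) \<and> (\<forall>y\<in>U \<inter> V. e i y = (\<Sum>j<n. g j y *\<^sub>R e' j y))"
      using es 2 unfolding smooth_components_def n_def Ve by blast
    then obtain g where g: "\<And>i j. i < n \<Longrightarrow> j < n \<Longrightarrow> smooth_fun_on M (U \<inter> V) (g i j)"
      "\<And>i y. i < n \<Longrightarrow> y \<in> U \<inter> V \<Longrightarrow> e i y = (\<Sum>j<n. g i j y *\<^sub>R e' j y)"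
      by metis
    define d where "d j y = (if y \<in> U then \<Sum>i<n. b y * c i * g i j y else 0)" for j y
    have "smooth_fun_on M V (d j)" if j: "j < n" for j
    proof (rule smooth_fun_on_local[OF M V])
      fix y assume y: "y \<in> V"
      show "\<exists>U'. open U' \<and> y \<in> U' \<and> smooth_fun_on M U' (d j)"
      proof (cases "y \<in> U")
        case True
        have "smooth_fun_on M (U \<inter> V) (\<lambda>y. \<Sum>i<n. b y * c i * g i j y)"
          using U V g(1) j smooth_funs_on[OF b(1)]
          by (intro smooth_fun_on_sum[OF M] smooth_fun_on_mult[OF M] smooth_fun_on_const[OF M]) auto
        then have "smooth_fun_on M (U \<inter> V) (d j)"
          by (rule smooth_fun_on_cong[OF M, rotated 2]) (use U V in \<open>auto simp: d_def\<close>)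
        then show ?thesis using U V y True by blast
      next
        case False
        have "smooth_fun_on M (- K) (d j)"
          by (rule smooth_fun_on_cong[OF M _ _ smooth_fun_on_const[OF M, of _ 0]]) (use b in \<open>auto simp: d_def\<close>)
        then show ?thesis using b False by (intro exI[of _ "- K"]) auto
      qed
    qed
    moreover have "X y = (\<Sum>j<n. d j y *\<^sub>R e' j y)" if y: "y \<in> V" for y
    proof (cases "y \<in> U")
      case True
      have "X y = (\<Sum>i<n. (b y * c i) *\<^sub>R (\<Sum>j<n. g i j y *\<^sub>R e' j y))"
        using True y by (simp add: X_def g(2))
      also have "\<dots> = (\<Sum>i<n. \<Sum>j<n. (b y * c i * g i j y) *\<^sub>R e' j y)"
        by (simp add: scaleR_sum_right)
      also have "\<dots> = (\<Sum>j<n. \<Sum>i<n. (b y * c i * g i j y) *\<^sub>R e' j y)"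
        by (rule sum.swap)
      finally show ?thesis using True by (simp add: d_def scaleR_sum_left)
    qed (simp add: X_def d_def)
    ultimately show ?case
      unfolding Ve n_def[symmetric] by auto
  qed
  moreover have "X x = v"
    using xU b(5) c by (simp add: X_def)
  ultimately show ?thesis
    using that by blast
qed

section \<open>Alternating forms\<close>

lemma alternating_off:
  "\<omega> \<in> alternating V k \<Longrightarrow> \<not> (int (length vs) = k \<and> set vs \<subseteq> V) \<Longrightarrow> \<omega> vs = 0"
  by (simp add: alternating_def)

lemma alternating_lincomb:
  assumes V: "subspace V" and \<omega>: "\<omega> \<in> alternating V k" and uv: "u \<in> V" "v \<in> V"
  shows "\<omega> (xs @ (a *\<^sub>R u + b *\<^sub>R v) # ys) = a * \<omega> (xs @ u # ys) + b * \<omega> (xs @ v # ys)"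
proof (cases "int (length xs + length ys + 1) = k \<and> set xs \<subseteq> V \<and> set ys \<subseteq> V")
  case True
  have "a *\<^sub>R u + b *\<^sub>R v \<in> V"
    using V uv by (simp add: subspace_add subspace_scale)
  let ?vs = "xs @ u # ys"
  have "int (length ?vs) = k \<and> set ?vs \<subseteq> V" "length xs < length ?vs"
    using True uv by auto
  then have "linear_on V UNIV (\<lambda>v. \<omega> (?vs[length xs := v]))"
    using \<omega> unfolding alternating_def by blast
  then show ?thesis
    using uv unfolding linear_on_def by simp
next
  case False
  then have "\<omega> (xs @ w # ys) = 0" for w
    by (intro alternating_off[OF \<omega>]) auto
  then show ?thesis by simp
qed

lemma alternating_sum:
  assumes V: "subspace V" and \<omega>: "\<omega> \<in> alternating V k" and w: "\<And>i. i \<in> I \<Longrightarrow> w i \<in> V" and I: "finite I"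
  shows "\<omega> (xs @ (\<Sum>i\<in>I. c i *\<^sub>R w i) # ys) = (\<Sum>i\<in>I. c i * \<omega> (xs @ w i # ys))"
  using I w
proof (induction I rule: finite_induct)
  case empty
  show ?case
    using alternating_lincomb[OF V \<omega> subspace_0[OF V] subspace_0[OF V], of xs 0 0 ys] by simp
next
  case (insert i I)
  have "(\<Sum>i\<in>I. c i *\<^sub>R w i) \<in> V"
    using V insert by (intro subspace_sum subspace_scale) auto
  then show ?case
    using insert alternating_lincomb[OF V \<omega>, of "w i" "\<Sum>i\<in>I. c i *\<^sub>R w i" xs "c i" 1 ys] by simp
qed

lemma alternating_not_distinct: "\<omega> \<in> alternating V k \<Longrightarrow> \<not> distinct vs \<Longrightarrow> \<omega> vs = 0"
  by (auto simp: alternating_def)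

text \<open>
  Polarization. It suffices to know that repeated neighbours give zero; this is the form of the
  alternating property that is easy to verify by induction on argument lists.
\<close>

lemma swap_of_adjacent_zero:
  assumes V: "subspace V"
    and lin: "\<And>xs ys u v a b. set xs \<subseteq> V \<Longrightarrow> set ys \<subseteq> V \<Longrightarrow> u \<in> V \<Longrightarrow> v \<in> V \<Longrightarrow>
       \<omega> (xs @ (a *\<^sub>R u + b *\<^sub>R v) # ys) = a * \<omega> (xs @ u # ys) + b * \<omega> (xs @ v # ys)"
    and adj: "\<And>xs ys v. set xs \<subseteq> V \<Longrightarrow> set ys \<subseteq> V \<Longrightarrow> v \<in> V \<Longrightarrow> \<omega> (xs @ v # v # ys) = (0::real)"
    and S: "set xs \<subseteq> V" "set ys \<subseteq> V" "u \<in> V" "v \<in> V"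
  shows "\<omega> (xs @ u # v # ys) = - \<omega> (xs @ v # u # ys)"
proof -
  have uv: "u + v \<in> V"
    using V S by (simp add: subspace_add)
  have l1: "\<omega> (xs @ (u + v) # ws) = \<omega> (xs @ u # ws) + \<omega> (xs @ v # ws)" if "set ws \<subseteq> V" for ws
    using lin[OF S(1) that S(3,4), of 1 1] by simp
  have l2: "\<omega> (xs @ w # (u + v) # ys) = \<omega> (xs @ w # u # ys) + \<omega> (xs @ w # v # ys)" if "w \<in> V" for w
    using lin[of "xs @ [w]" ys u v 1 1] S that by simp
  have "0 = \<omega> (xs @ (u + v) # (u + v) # ys)"
    using adj S uv by simp
  also have "\<dots> = \<omega> (xs @ u # u # ys) + \<omega> (xs @ u # v # ys) + \<omega> (xs @ v # u # ys) + \<omega> (xs @ v # v # ys)"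
    using l1 l2 S uv by simp
  finally show ?thesis
    using adj S by simp
qed

lemma alternatingI:
  assumes V: "subspace V"
    and off: "\<And>vs. \<not> (int (length vs) = k \<and> set vs \<subseteq> V) \<Longrightarrow> \<omega> vs = 0"
    and lin: "\<And>xs ys u v a b. set xs \<subseteq> V \<Longrightarrow> set ys \<subseteq> V \<Longrightarrow> u \<in> V \<Longrightarrow> v \<in> V \<Longrightarrow>
       \<omega> (xs @ (a *\<^sub>R u + b *\<^sub>R v) # ys) = a * \<omega> (xs @ u # ys) + b * \<omega> (xs @ v # ys)"
    and adj: "\<And>xs ys v. set xs \<subseteq> V \<Longrightarrow> set ys \<subseteq> V \<Longrightarrow> v \<in> V \<Longrightarrow> \<omega> (xs @ v # v # ys) = 0"
  shows "\<omega> \<in> alternating V k"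
proof -
  note swap = swap_of_adjacent_zero[OF V lin adj]
  have rep: "\<omega> (xs @ z # ys @ z # zs) = 0"
    if "set xs \<subseteq> V" "set ys \<subseteq> V" "set zs \<subseteq> V" "z \<in> V" for xs ys zs z
    using that
  proof (induction ys arbitrary: xs)
    case Nil
    then show ?case using adj by simp
  next
    case (Cons y ys)
    have "\<omega> (xs @ z # y # ys @ z # zs) = - \<omega> (xs @ y # z # ys @ z # zs)"
      using Cons.prems by (intro swap) auto
    moreover have "\<omega> ((xs @ [y]) @ z # ys @ z # zs) = 0"
      by (rule Cons.IH) (use Cons.prems in auto)
    ultimately show ?case by simp
  qed
  show ?thesis
    unfolding alternating_def
  proof (intro CollectI conjI allI impI)
    fix vs assume "\<not> (int (length vs) = k \<and> set vs \<subseteq> V)"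
    then show "\<omega> vs = 0" by (rule off)
  next
    fix vs i assume vs: "int (length vs) = k \<and> set vs \<subseteq> V" and i: "i < length vs"
    have S: "set (take i vs) \<subseteq> V" "set (drop (Suc i) vs) \<subseteq> V"
      using vs set_take_subset set_drop_subset by fastforce+
    show "linear_on V UNIV (\<lambda>v. \<omega> (vs[i := v]))"
      using lin[OF S] i by (auto simp: linear_on_def upd_conv_take_nth_drop)
  next
    fix vs assume vs: "int (length vs) = k \<and> set vs \<subseteq> V" and "\<not> distinct vs"
    then obtain xs ys zs z where "vs = xs @ [z] @ ys @ [z] @ zs"
      using not_distinct_decomp by blast
    then show "\<omega> vs = 0"
      using rep[of xs ys zs z] vs by auto
  qed
qed

lemma alternating_swap:
  assumes V: "subspace V" and \<omega>: "\<omega> \<in> alternating V k"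
  shows "\<omega> (xs @ u # v # ys) = - \<omega> (xs @ v # u # ys)"
proof (cases "set (u # v # xs @ ys) \<subseteq> V")
  case True
  show ?thesis
    by (rule swap_of_adjacent_zero[OF V alternating_lincomb[OF V \<omega>]])
       (use True alternating_not_distinct[OF \<omega>] in auto)
next
  case False
  then have "\<omega> (xs @ u # v # ys) = 0" "\<omega> (xs @ v # u # ys) = 0"
    by (auto intro!: alternating_off[OF \<omega>])
  then show ?thesis by simp
qed

lemma alternating_move:
  assumes V: "subspace V" and \<omega>: "\<omega> \<in> alternating V k"
  shows "\<omega> (xs @ z # ys @ zs) = (- 1) ^ length ys * \<omega> (xs @ ys @ z # zs)"
proof (induction ys arbitrary: xs)
  case (Cons y ys)
  have "\<omega> (xs @ z # y # ys @ zs) = - \<omega> ((xs @ [y]) @ z # ys @ zs)"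
    using alternating_swap[OF V \<omega>, of xs z y "ys @ zs"] by simp
  then show ?case
    using Cons.IH[of "xs @ [y]"] by simp
qed simp

lemma alternating_combination:
  assumes "subspace V" "\<alpha> \<in> alternating V k" "\<beta> \<in> alternating V k"
  shows "(\<lambda>xs. a * \<alpha> xs + b * \<beta> xs) \<in> alternating V k"
  by (rule alternatingI[OF assms(1)])
     (simp_all add: alternating_off[OF assms(2)] alternating_off[OF assms(3)]
        alternating_lincomb[OF assms(1,2)] alternating_lincomb[OF assms(1,3)]
        alternating_not_distinct[OF assms(2)] alternating_not_distinct[OF assms(3)] algebra_simps)

lemma alternating_zero: "subspace V \<Longrightarrow> (\<lambda>_. 0) \<in> alternating V k"
  by (rule alternatingI) auto

lemma alternating_sum_forms:
  assumes V: "subspace V" and "\<And>i. i \<in> I \<Longrightarrow> \<alpha> i \<in> alternating V k"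
  shows "(\<lambda>xs. c * (\<Sum>i\<in>I. \<alpha> i xs)) \<in> alternating V k"
proof -
  have "(\<lambda>xs. \<Sum>i\<in>I. \<alpha> i xs) \<in> alternating V k"
    using assms(2)
  proof (induction I rule: infinite_finite_induct)
    case (insert i I)
    then show ?case
      using alternating_combination[OF V, of "\<alpha> i" k "\<lambda>xs. \<Sum>i\<in>I. \<alpha> i xs" 1 1] by simp
  qed (simp_all add: alternating_zero[OF V])
  then show ?thesis
    using alternating_combination[OF V _ alternating_zero[OF V], of _ k c 0] by simp
qed

lemma alternating_contract_head:
  assumes V: "subspace V" and \<omega>: "\<omega> \<in> alternating V k"
  shows "(\<lambda>xs. \<omega> (v # xs)) \<in> alternating V (k - 1)"
proof (rule alternatingI[OF V])
  fix xs assume "\<not> (int (length xs) = k - 1 \<and> set xs \<subseteq> V)"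
  then show "\<omega> (v # xs) = 0"
    by (intro alternating_off[OF \<omega>]) auto
next
  fix xs ys u w and a b :: real assume "u \<in> V" "w \<in> V"
  then show "\<omega> (v # xs @ (a *\<^sub>R u + b *\<^sub>R w) # ys) = a * \<omega> (v # xs @ u # ys) + b * \<omega> (v # xs @ w # ys)"
    using alternating_lincomb[OF V \<omega>, of u w "v # xs"] by simp
qed (simp add: alternating_not_distinct[OF \<omega>])

lemma alternating_contract_last:
  assumes V: "subspace V" and \<omega>: "\<omega> \<in> alternating V k"
  shows "(\<lambda>xs. \<omega> (xs @ [v])) \<in> alternating V (k - 1)"
proof (rule alternatingI[OF V])
  fix xs assume "\<not> (int (length xs) = k - 1 \<and> set xs \<subseteq> V)"
  then show "\<omega> (xs @ [v]) = 0"
    by (intro alternating_off[OF \<omega>]) auto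
next
  fix xs ys u w and a b :: real assume "u \<in> V" "w \<in> V"
  then show "\<omega> ((xs @ (a *\<^sub>R u + b *\<^sub>R w) # ys) @ [v]) =
      a * \<omega> ((xs @ u # ys) @ [v]) + b * \<omega> ((xs @ w # ys) @ [v])"
    using alternating_lincomb[OF V \<omega>, of u w xs a b "ys @ [v]"] by simp
qed (simp add: alternating_not_distinct[OF \<omega>])

subsection \<open>Forms and spanning families\<close>

definition spanned_by :: "'v::real_vector set \<Rightarrow> (nat \<Rightarrow> 'v) \<Rightarrow> nat \<Rightarrow> bool"
  where "spanned_by V b n \<longleftrightarrow> subspace V \<and> (\<forall>i<n. b i \<in> V) \<and> (\<forall>v\<in>V. \<exists>c. v = (\<Sum>i<n. c i *\<^sub>R b i))"

lemma alternating_eq_0_on_basis: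
  assumes V: "spanned_by V b n" and \<omega>: "\<omega> \<in> alternating V k"
    and 0: "\<And>is. set is \<subseteq> {..<n} \<Longrightarrow> distinct is \<Longrightarrow> int (length is) = k \<Longrightarrow> \<omega> (map b is) = 0"
  shows "\<omega> = (\<lambda>_. 0)"
proof
  fix vs
  have sub: "subspace V" and bV: "\<And>i. i < n \<Longrightarrow> b i \<in> V"
    and ex: "\<And>v. v \<in> V \<Longrightarrow> \<exists>c. v = (\<Sum>i<n. c i *\<^sub>R b i)"
    using V by (auto simp: spanned_by_def)
  have "\<omega> (us @ map b is) = 0" if "set us \<subseteq> V" "set is \<subseteq> {..<n}" for us "is"
    using that
  proof (induction us arbitrary: "is" rule: rev_induct)
    case Nil
    show ?case
    proof (cases "distinct is \<and> int (length is) = k")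
      case True
      then show ?thesis using 0 Nil by simp
    next
      case False
      then show ?thesis
        using alternating_off[OF \<omega>, of "map b is"] alternating_not_distinct[OF \<omega>, of "map b is"]
        by (auto simp: distinct_map)
    qed
  next
    case (snoc v us)
    then have "v \<in> V" by simp
    then obtain c where c: "v = (\<Sum>i<n. c i *\<^sub>R b i)"
      using ex by blast
    have "\<omega> (us @ v # map b is) = (\<Sum>i<n. c i * \<omega> (us @ b i # map b is))"
      unfolding c by (rule alternating_sum[OF sub \<omega>]) (auto simp: bV)
    also have "\<dots> = 0"
    proof (rule sum.neutral, safe)
      fix i assume "i < n"
      then show "c i * \<omega> (us @ b i # map b is) = 0"
        using snoc.IH[of "i # is"] snoc.prems by simp
    qed
    finally show ?case by simp
  qed
  from this[of vs "[]"] show "\<omega> vs = 0"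
    using alternating_off[OF \<omega>, of vs] by (cases "set vs \<subseteq> V") auto
qed

lemma alternating_above_dimension:
  assumes V: "spanned_by V b n" and \<omega>: "\<omega> \<in> alternating V k" and k: "int n < k"
  shows "\<omega> = (\<lambda>_. 0)"
proof (rule alternating_eq_0_on_basis[OF V \<omega>])
  fix "is" assume "set is \<subseteq> {..<n}" "distinct is" "int (length is) = k"
  then have "length is \<le> n"
    by (metis card_lessThan card_mono distinct_card finite_lessThan)
  with k \<open>int (length is) = k\<close> show "\<omega> (map b is) = 0" by simp
qed

text \<open>Insertion sort by adjacent transpositions changes the value only by a sign.\<close>

lemma alternating_sort_zero:
  assumes V: "subspace V" and \<omega>: "\<omega> \<in> alternating V k" and 0: "\<omega> (xs @ map b (sort is)) = 0"
  shows "\<omega> (xs @ map b is) = 0"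
  using 0
proof (induction "is" arbitrary: xs)
  case (Cons i "is")
  have ins: "\<omega> (ys @ map b (i # js)) = 0" if "\<omega> (ys @ map b (insort i js)) = 0" for ys js
    using that
  proof (induction js arbitrary: ys)
    case (Cons j js)
    show ?case
    proof (cases "i \<le> j")
      case False
      with Cons.prems have "\<omega> ((ys @ [b j]) @ map b (i # js)) = 0"
        by (intro Cons.IH) simp
      then show ?thesis
        using alternating_swap[OF V \<omega>, of ys "b i" "b j"] by simp
    qed (use Cons.prems in simp)
  qed simp
  have "\<omega> (xs @ map b (i # sort is)) = 0"
    by (rule ins) (use Cons.prems in simp)
  then have "\<omega> ((xs @ [b i]) @ map b is) = 0"
    by (intro Cons.IH) simp
  then show ?case by simp
qed simp

lemma alternating_top_degree_zero:
  assumes V: "spanned_by V b n" and \<omega>: "\<omega> \<in> alternating V (int n)" and 0: "\<omega> (map b [0..<n]) = 0"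
  shows "\<omega> = (\<lambda>_. 0)"
proof (rule alternating_eq_0_on_basis[OF V \<omega>])
  fix "is" assume i: "set is \<subseteq> {..<n}" "distinct is" "int (length is) = int n"
  have "set is = {..<n}"
    using i by (intro card_subset_eq) (auto simp: distinct_card)
  then have "sort is = [0..<n]"
    by (intro sorted_distinct_set_unique) (simp_all add: i(2) lessThan_atLeast0)
  then show "\<omega> (map b is) = 0"
    using alternating_sort_zero[OF _ \<omega>, of "[]" b "is"] V 0 by (simp add: spanned_by_def)
qed

section \<open>Wedge product with a vector\<close>

definition one_form :: "('w \<Rightarrow> real) \<Rightarrow> 'w list \<Rightarrow> real"
  where "one_form g xs = (if length xs = 1 then g (hd xs) else 0)"

lemma nths_cong: "(\<And>i. i < length xs \<Longrightarrow> i \<in> I \<longleftrightarrow> i \<in> J) \<Longrightarrow> nths xs I = nths xs J"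
  unfolding nths_def by (intro arg_cong[of _ _ "map fst"] filter_cong) (auto simp: set_zip)

lemma nths_all_indices: "{..<length xs} \<subseteq> I \<Longrightarrow> nths xs I = xs"
  using nths_cong[of xs I UNIV] by (simp add: subset_iff nths_all)

lemma wedge_one_form_Nil [simp]: "wedge \<alpha> (one_form g) [] = 0"
  by (simp add: wedge_def one_form_def)

text \<open>
  Expansion along the last argument: it goes either to the covector, as the last entry of the shuffle,
  or to \<open>\<alpha>\<close>, which moves it past the one argument of the covector and costs a sign. All identities
  for the product with a vector follow from this recursion by induction on the argument list.
\<close>

lemma wedge_one_form_snoc:
  "wedge \<alpha> (one_form g) (xs @ [x]) = \<alpha> xs * g x - wedge (\<lambda>ys. \<alpha> (ys @ [x])) (one_form g) xs"
proof -
  define n where "n = length xs"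
  define s where "s m I = (- 1 :: real) ^ card {(i, j). i \<in> I \<and> j \<in> {..<m} - I \<and> j < (i::nat)}" for m I
  define t where "t I = s (Suc n) I * \<alpha> (nths (xs @ [x]) I) * one_form g (nths (xs @ [x]) (- I))" for I
  have "wedge \<alpha> (one_form g) (xs @ [x]) = sum t (Pow {..<Suc n})"
    by (simp add: wedge_def t_def s_def n_def)
  also have "Pow {..<Suc n} = Pow {..<n} \<union> insert n ` Pow {..<n}"
    by (simp add: lessThan_Suc Pow_insert)
  also have "sum t \<dots> = sum t (Pow {..<n}) + sum t (insert n ` Pow {..<n})"
    by (rule sum.union_disjoint) auto
  also have "sum t (insert n ` Pow {..<n}) = (\<Sum>I\<in>Pow {..<n}. t (insert n I))"
    by (rule sum.reindex_cong[OF _ refl refl]) (rule inj_on_inverseI[where g = "\<lambda>I. I - {n}"], auto)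
  also have "(\<Sum>I\<in>Pow {..<n}. t (insert n I)) =
      (\<Sum>I\<in>Pow {..<n}. - (s n I * \<alpha> (nths xs I @ [x]) * one_form g (nths xs (- I))))"
  proof (rule sum.cong[OF refl])
    fix I assume I: "I \<in> Pow {..<n}"
    have "{(i, j). i \<in> insert n I \<and> j \<in> {..<Suc n} - insert n I \<and> j < i} =
        {(i, j). i \<in> I \<and> j \<in> {..<n} - I \<and> j < i} \<union> {n} \<times> ({..<n} - I)"
      using I by auto
    moreover have "card \<dots> = card {(i, j). i \<in> I \<and> j \<in> {..<n} - I \<and> j < i} + card ({..<n} - I)"
    proof (subst card_Un_disjoint)
      show "finite {(i, j). i \<in> I \<and> j \<in> {..<n} - I \<and> j < i}"
        by (rule finite_subset[of _ "{..<n} \<times> {..<n}"]) (use I in auto)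
    qed (use I in \<open>auto simp: card_cartesian_product\<close>)
    ultimately have s: "s (Suc n) (insert n I) = s n I * (- 1) ^ card ({..<n} - I)"
      by (simp add: s_def power_add)
    have len: "length (nths xs (- I)) = card ({..<n} - I)"
      by (simp add: length_nths n_def) (rule arg_cong[of _ _ card], auto)
    have n1: "nths xs (insert n I) = nths xs I" "nths xs (- insert n I) = nths xs (- I)"
      by (rule nths_cong, simp add: n_def)+
    have n2: "nths (xs @ [x]) (insert n I) = nths xs I @ [x]" "nths (xs @ [x]) (- insert n I) = nths xs (- I)"
      using n1 by (simp_all add: nths_append n_def[symmetric] nths_singleton)
    show "t (insert n I) = - (s n I * \<alpha> (nths xs I @ [x]) * one_form g (nths xs (- I)))"
      unfolding t_def n2 s using len by (auto simp: one_form_def)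
  qed
  also have "\<dots> = - wedge (\<lambda>ys. \<alpha> (ys @ [x])) (one_form g) xs"
    by (simp add: wedge_def sum_negf s_def n_def)
  also have "sum t (Pow {..<n}) = sum t {{..<n}}"
  proof (rule sum.mono_neutral_right)
    show "\<forall>I\<in>Pow {..<n} - {{..<n}}. t I = 0"
    proof
      fix I assume I: "I \<in> Pow {..<n} - {{..<n}}"
      then have "card ({..<n} - I) \<noteq> 0" by auto
      moreover have "length (nths xs (- I)) = card ({..<n} - I)"
        by (simp add: length_nths n_def) (rule arg_cong[of _ _ card], auto)
      moreover have "nths (xs @ [x]) (- I) = nths xs (- I) @ [x]"
        using I by (auto simp: nths_append n_def[symmetric] nths_singleton)
      ultimately show "t I = 0"
        by (simp add: t_def one_form_def)
    qed
  qed auto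
  also have "sum t {{..<n}} = \<alpha> xs * g x"
  proof -
    have "nths (xs @ [x]) {..<n} = xs" "nths (xs @ [x]) (- {..<n}) = [x]"
      using nths_all_indices[of xs "{..<n}"] nths_cong[of xs "- {..<n}" "{}"]
      by (simp_all add: nths_append n_def[symmetric] nths_singleton)
    moreover have "s (Suc n) {..<n} = 1"
    proof -
      have "{(i, j). i \<in> {..<n} \<and> j \<in> {..<Suc n} - {..<n} \<and> j < i} = {}"
        by auto
      then show ?thesis
        by (simp only: s_def card.empty power_0)
    qed
    ultimately show ?thesis
      by (simp add: t_def one_form_def)
  qed
  finally show ?thesis by simp
qed

lemma wedge_scalar_left:
  assumes "\<And>xs. xs \<noteq> [] \<Longrightarrow> \<alpha> xs = 0"
  shows "wedge \<alpha> \<beta> xs = \<alpha> [] * \<beta> xs"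
proof -
  have "wedge \<alpha> \<beta> xs = (\<Sum>I\<in>{{}}. (- 1) ^ card {(i, j). i \<in> I \<and> j \<in> {..<length xs} - I \<and> j < i} *
      \<alpha> (nths xs I) * \<beta> (nths xs (- I)))"
    unfolding wedge_def
  proof (rule sum.mono_neutral_right)
    show "\<forall>I\<in>Pow {..<length xs} - {{}}. (- 1) ^ card {(i, j). i \<in> I \<and> j \<in> {..<length xs} - I \<and> j < i} *
      \<alpha> (nths xs I) * \<beta> (nths xs (- I)) = 0"
    proof
      fix I assume I: "I \<in> Pow {..<length xs} - {{}}"
      then have "{i. i < length xs \<and> i \<in> I} \<noteq> {}" by auto
      then have "length (nths xs I) \<noteq> 0"
        unfolding length_nths by (subst card_eq_0_iff) auto
      then have "\<alpha> (nths xs I) = 0" by (intro assms) auto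
      then show "(- 1) ^ card {(i, j). i \<in> I \<and> j \<in> {..<length xs} - I \<and> j < i} *
        \<alpha> (nths xs I) * \<beta> (nths xs (- I)) = 0" by simp
    qed
  qed auto
  then show ?thesis by (simp add: nths_all_indices)
qed

lemma wedge_scalar_right:
  assumes "\<And>xs. xs \<noteq> [] \<Longrightarrow> \<beta> xs = 0"
  shows "wedge \<alpha> \<beta> xs = \<alpha> xs * \<beta> []"
proof -
  let ?n = "length xs"
  have "wedge \<alpha> \<beta> xs = (\<Sum>I\<in>{{..<?n}}. (- 1) ^ card {(i, j). i \<in> I \<and> j \<in> {..<?n} - I \<and> j < i} *
      \<alpha> (nths xs I) * \<beta> (nths xs (- I)))"
    unfolding wedge_def
  proof (rule sum.mono_neutral_right)
    show "\<forall>I\<in>Pow {..<?n} - {{..<?n}}. (- 1) ^ card {(i, j). i \<in> I \<and> j \<in> {..<?n} - I \<and> j < i} *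
      \<alpha> (nths xs I) * \<beta> (nths xs (- I)) = 0"
    proof
      fix I assume I: "I \<in> Pow {..<?n} - {{..<?n}}"
      then have "{i. i < ?n \<and> i \<in> - I} \<noteq> {}" by auto
      then have "length (nths xs (- I)) \<noteq> 0"
        unfolding length_nths by (subst card_eq_0_iff) auto
      then have "\<beta> (nths xs (- I)) = 0" by (intro assms) auto
      then show "(- 1) ^ card {(i, j). i \<in> I \<and> j \<in> {..<?n} - I \<and> j < i} *
        \<alpha> (nths xs I) * \<beta> (nths xs (- I)) = 0" by simp
    qed
  qed auto
  moreover have "nths xs {..<?n} = xs" "nths xs (- {..<?n}) = []"
    using nths_all_indices[of xs "{..<?n}"] nths_cong[of xs "- {..<?n}" "{}"] by simp_all
  ultimately show ?thesis by simp
qed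

lemma wedge_one_form_linear_left:
  "wedge (\<lambda>ys. a * \<alpha> ys + b * \<beta> ys) (one_form g) xs =
     a * wedge \<alpha> (one_form g) xs + b * wedge \<beta> (one_form g) xs"
  by (induction xs arbitrary: \<alpha> \<beta> rule: rev_induct) (simp_all add: wedge_one_form_snoc algebra_simps)

lemma wedge_one_form_linear_right:
  "wedge \<alpha> (one_form (\<lambda>x. a * g x + b * h x)) xs =
     a * wedge \<alpha> (one_form g) xs + b * wedge \<alpha> (one_form h) xs"
  by (induction xs arbitrary: \<alpha> rule: rev_induct) (simp_all add: wedge_one_form_snoc algebra_simps)

lemma wedge_one_form_zero: "\<forall>x\<in>set xs. g x = 0 \<Longrightarrow> wedge \<alpha> (one_form g) xs = 0"
  by (induction xs arbitrary: \<alpha> rule: rev_induct) (simp_all add: wedge_one_form_snoc)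

lemma wedge_zero_left: "wedge (\<lambda>_. 0) \<beta> xs = 0"
  by (simp add: wedge_def)

lemma wedge_one_form_twice: "wedge (wedge \<alpha> (one_form g)) (one_form g) xs = 0"
proof (induction xs arbitrary: \<alpha> rule: rev_induct)
  case (snoc x xs)
  have "wedge (\<lambda>ys. wedge \<alpha> (one_form g) (ys @ [x])) (one_form g) xs =
      wedge (\<lambda>ys. g x * \<alpha> ys + (- 1) * wedge (\<lambda>zs. \<alpha> (zs @ [x])) (one_form g) ys) (one_form g) xs"
    by (simp add: wedge_one_form_snoc mult.commute)
  also have "\<dots> = g x * wedge \<alpha> (one_form g) xs"
    using snoc.IH by (simp only: wedge_one_form_linear_left)
  finally show ?case
    by (simp add: wedge_one_form_snoc)
qed simp

lemma wedge_one_form_alternating: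
  assumes W: "subspace W" and \<alpha>: "\<alpha> \<in> alternating W k" and g: "g \<in> dual_space W"
  shows "wedge \<alpha> (one_form g) \<in> alternating W (k + 1)"
proof (rule alternatingI[OF W])
  have g_lin: "g (a *\<^sub>R u + b *\<^sub>R v) = a * g u + b * g v" if "u \<in> W" "v \<in> W" for a b u v
    using g that by (simp add: dual_space_def linear_on_def)
  have g_off: "g u = 0" if "u \<notin> W" for u
    using g that by (simp add: dual_space_def)
  note last = alternating_contract_last[OF W]
  show "wedge \<alpha> (one_form g) xs = 0" if "\<not> (int (length xs) = k + 1 \<and> set xs \<subseteq> W)" for xs
    using \<alpha> that
  proof (induction xs arbitrary: \<alpha> k rule: rev_induct)
    case (snoc x xs)
    have "wedge (\<lambda>ys. \<alpha> (ys @ [x])) (one_form g) xs = 0"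
    proof (cases "x \<in> W")
      case True
      then show ?thesis using snoc.prems by (intro snoc.IH[OF last[OF snoc.prems(1)]]) auto
    next
      case False
      then have "(\<lambda>ys. \<alpha> (ys @ [x])) = (\<lambda>_. 0)"
        by (intro ext alternating_off[OF snoc.prems(1)]) auto
      then show ?thesis by (simp only: wedge_zero_left)
    qed
    moreover have "\<alpha> xs * g x = 0"
      using alternating_off[OF snoc.prems(1), of xs] g_off[of x] snoc.prems(2) by auto
    ultimately show ?case by (simp add: wedge_one_form_snoc)
  qed simp
  show "wedge \<alpha> (one_form g) (xs @ (a *\<^sub>R u + b *\<^sub>R v) # ys) =
      a * wedge \<alpha> (one_form g) (xs @ u # ys) + b * wedge \<alpha> (one_form g) (xs @ v # ys)"
    if "u \<in> W" "v \<in> W" for xs ys u v a b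
    using \<alpha>
  proof (induction ys arbitrary: \<alpha> k rule: rev_induct)
    case Nil
    have "\<alpha> (zs @ [a *\<^sub>R u + b *\<^sub>R v]) = a * \<alpha> (zs @ [u]) + b * \<alpha> (zs @ [v])" for zs
      using alternating_lincomb[OF W Nil that, of zs a b "[]"] by simp
    then show ?case
      by (simp add: wedge_one_form_snoc wedge_one_form_linear_left g_lin that algebra_simps)
  next
    case (snoc y ys)
    have e: "wedge \<alpha> (one_form g) (xs @ w # ys @ [y]) =
        \<alpha> (xs @ w # ys) * g y - wedge (\<lambda>zs. \<alpha> (zs @ [y])) (one_form g) (xs @ w # ys)" for w
      using wedge_one_form_snoc[of \<alpha> g "xs @ w # ys" y] by simp
    show ?case
      using snoc.IH[OF last[OF snoc.prems], of y] alternating_lincomb[OF W snoc.prems that, of xs a b ys]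
      by (simp add: e algebra_simps)
  qed
  show "wedge \<alpha> (one_form g) (xs @ v # v # ys) = 0" for xs ys v
    using \<alpha>
  proof (induction ys arbitrary: \<alpha> k rule: rev_induct)
    case Nil
    have "(\<lambda>zs. \<alpha> ((zs @ [v]) @ [v])) = (\<lambda>_. 0)"
      by (intro ext alternating_not_distinct[OF Nil]) simp
    then have "wedge (\<lambda>zs. \<alpha> (zs @ [v])) (one_form g) (xs @ [v]) = \<alpha> (xs @ [v]) * g v"
      by (simp only: wedge_one_form_snoc wedge_zero_left)
    then show ?case
      using wedge_one_form_snoc[of \<alpha> g "xs @ [v]" v] by simp
  next
    case (snoc y ys)
    show ?case
      using snoc.IH[OF last[OF snoc.prems], of y] alternating_not_distinct[OF snoc.prems, of "xs @ v # v # ys"]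
        wedge_one_form_snoc[of \<alpha> g "xs @ v # v # ys" y]
      by simp
  qed
qed

section \<open>Duality between multivectors and forms\<close>

lemma subspace_dual_space: "subspace (dual_space V)"
  by (rule subspaceI)
     (auto simp: dual_space_def linear_on_def scaleR_fun_def plus_fun_def zero_fun_def algebra_simps)

lemma dual_space_lincomb:
  "\<eta> \<in> dual_space V \<Longrightarrow> u \<in> V \<Longrightarrow> v \<in> V \<Longrightarrow> \<eta> (a *\<^sub>R u + b *\<^sub>R v) = a * \<eta> u + b * \<eta> v"
  by (simp add: dual_space_def linear_on_def)

lemma dual_space_off: "\<eta> \<in> dual_space V \<Longrightarrow> v \<notin> V \<Longrightarrow> \<eta> v = 0"
  by (simp add: dual_space_def)

text \<open>
  A vector as an element of the double dual; like all covectors it is set to zero outside the space on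
  which it is linear.
\<close>

definition eval_at :: "'v::real_vector set \<Rightarrow> 'v \<Rightarrow> ('v \<Rightarrow> real) \<Rightarrow> real"
  where "eval_at F v \<eta> = (if \<eta> \<in> dual_space F then \<eta> v else 0)"

lemma eval_at_dual: "eval_at F v \<in> dual_space (dual_space F)"
proof -
  have "a *\<^sub>R \<eta> + b *\<^sub>R \<zeta> \<in> dual_space F" if "\<eta> \<in> dual_space F" "\<zeta> \<in> dual_space F" for a b \<eta> \<zeta>
    using subspace_dual_space that by (intro subspace_add subspace_scale)
  moreover have "(a *\<^sub>R \<eta> + b *\<^sub>R \<zeta>) v = a * \<eta> v + b * \<zeta> v" for a b and \<eta> \<zeta> :: "'a \<Rightarrow> real"
    by (simp add: scaleR_fun_def plus_fun_def)
  ultimately have "linear_on (dual_space F) UNIV (eval_at F v)"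
    by (simp add: linear_on_def eval_at_def)
  then show ?thesis
    by (simp add: dual_space_def[of "dual_space F"] eval_at_def)
qed

definition vwedge :: "'v::real_vector set \<Rightarrow> (('v \<Rightarrow> real) list \<Rightarrow> real) \<Rightarrow> 'v \<Rightarrow> ('v \<Rightarrow> real) list \<Rightarrow> real"
  where "vwedge F \<alpha> v = wedge \<alpha> (one_form (eval_at F v))"

abbreviation vfold :: "'v::real_vector set \<Rightarrow> (('v \<Rightarrow> real) list \<Rightarrow> real) \<Rightarrow> 'v list \<Rightarrow> ('v \<Rightarrow> real) list \<Rightarrow> real"
  where "vfold F \<equiv> foldl (vwedge F)"

lemma vwedge_snoc:
  "vwedge F \<alpha> v (\<xi>s @ [\<xi>]) = \<alpha> \<xi>s * eval_at F v \<xi> - vwedge F (\<lambda>\<eta>s. \<alpha> (\<eta>s @ [\<xi>])) v \<xi>s"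
  by (simp add: vwedge_def wedge_one_form_snoc)

lemma vwedge_alternating:
  "\<alpha> \<in> alternating (dual_space F) k \<Longrightarrow> vwedge F \<alpha> v \<in> alternating (dual_space F) (k + 1)"
  unfolding vwedge_def by (rule wedge_one_form_alternating[OF subspace_dual_space _ eval_at_dual])

lemma vwedge_linear_left:
  "vwedge F (\<lambda>\<xi>s. a * \<alpha> \<xi>s + b * \<beta> \<xi>s) v = (\<lambda>\<xi>s. a * vwedge F \<alpha> v \<xi>s + b * vwedge F \<beta> v \<xi>s)"
  by (rule ext) (simp add: vwedge_def wedge_one_form_linear_left)

lemma vwedge_zero_left: "vwedge F (\<lambda>_. 0) v = (\<lambda>_. 0)"
  by (rule ext) (simp add: vwedge_def wedge_zero_left)

lemma vwedge_linear_right: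
  assumes "u \<in> F" "v \<in> F"
  shows "vwedge F \<alpha> (a *\<^sub>R u + b *\<^sub>R v) = (\<lambda>\<xi>s. a * vwedge F \<alpha> u \<xi>s + b * vwedge F \<alpha> v \<xi>s)"
proof -
  have "eval_at F (a *\<^sub>R u + b *\<^sub>R v) = (\<lambda>\<eta>. a * eval_at F u \<eta> + b * eval_at F v \<eta>)"
    by (rule ext) (simp add: eval_at_def dual_space_lincomb assms)
  then show ?thesis
    by (intro ext) (simp add: vwedge_def wedge_one_form_linear_right)
qed

lemma vwedge_off: "v \<notin> F \<Longrightarrow> vwedge F \<alpha> v = (\<lambda>_. 0)"
  by (rule ext) (auto simp: vwedge_def eval_at_def dual_space_off intro: wedge_one_form_zero)

lemma vwedge_twice: "vwedge F (vwedge F \<alpha> v) v = (\<lambda>_. 0)"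
  by (rule ext) (simp add: vwedge_def wedge_one_form_twice)

lemma vfold_alternating:
  "\<alpha> \<in> alternating (dual_space F) k \<Longrightarrow> vfold F \<alpha> vs \<in> alternating (dual_space F) (k + int (length vs))"
proof (induction vs arbitrary: \<alpha> k)
  case (Cons v vs)
  show ?case
    using Cons.IH[OF vwedge_alternating[OF Cons.prems]] by (simp add: add.assoc)
qed simp

lemma vfold_linear:
  "vfold F (\<lambda>\<xi>s. a * \<alpha> \<xi>s + b * \<beta> \<xi>s) vs = (\<lambda>\<xi>s. a * vfold F \<alpha> vs \<xi>s + b * vfold F \<beta> vs \<xi>s)"
  by (induction vs arbitrary: \<alpha> \<beta>) (simp_all add: vwedge_linear_left)

lemma vfold_zero: "vfold F (\<lambda>_. 0) vs = (\<lambda>_. 0)"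
  by (induction vs) (simp_all add: vwedge_zero_left)

locale dual_frames =
  fixes F :: "'v::real_vector set" and e :: "nat \<Rightarrow> 'v" and \<xi> :: "nat \<Rightarrow> 'v \<Rightarrow> real" and n :: nat
  assumes F: "subspace F"
    and e: "\<And>i. i < n \<Longrightarrow> e i \<in> F"
    and \<xi>: "\<And>i. i < n \<Longrightarrow> \<xi> i \<in> dual_space F"
    and \<xi>_e: "\<And>i j. i < n \<Longrightarrow> j < n \<Longrightarrow> \<xi> i (e j) = (if i = j then 1 else 0)"
    and expand: "\<And>v. v \<in> F \<Longrightarrow> v = (\<Sum>i<n. \<xi> i v *\<^sub>R e i)"
begin

lemma dual_sum:
  assumes "\<eta> \<in> dual_space F" "\<And>i. i \<in> I \<Longrightarrow> w i \<in> F" "finite I"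
  shows "\<eta> (\<Sum>i\<in>I. c i *\<^sub>R w i) = (\<Sum>i\<in>I. c i * \<eta> (w i))"
  using assms(3,2)
proof (induction I rule: finite_induct)
  case empty
  show ?case
    using dual_space_lincomb[OF assms(1) subspace_0[OF F] subspace_0[OF F], of 0 0] by simp
next
  case (insert i I)
  have "(\<Sum>i\<in>I. c i *\<^sub>R w i) \<in> F"
    using F insert by (intro subspace_sum subspace_scale) auto
  then show ?case
    using insert dual_space_lincomb[OF assms(1), of "w i" "\<Sum>i\<in>I. c i *\<^sub>R w i" "c i" 1] by simp
qed

lemma sum_fun_apply: "(\<Sum>i\<in>I. c i *\<^sub>R f i) x = (\<Sum>i\<in>I. c i *\<^sub>R (f i x :: real))"
  by (induction I rule: infinite_finite_induct)
     (simp_all add: scaleR_fun_def plus_fun_def zero_fun_def)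

lemma dual_expand:
  assumes \<eta>: "\<eta> \<in> dual_space F"
  shows "\<eta> = (\<Sum>i<n. \<eta> (e i) *\<^sub>R \<xi> i)"
proof
  fix v
  show "\<eta> v = (\<Sum>i<n. \<eta> (e i) *\<^sub>R \<xi> i) v"
  proof (cases "v \<in> F")
    case True
    have "\<eta> v = (\<Sum>i<n. \<xi> i v * \<eta> (e i))"
      by (rule trans[OF arg_cong[OF expand[OF True], of \<eta>] dual_sum[OF \<eta>]]) (auto simp: e)
    then show ?thesis by (simp add: sum_fun_apply mult.commute)
  next
    case False
    then show ?thesis
      using dual_space_off[OF \<eta>] dual_space_off[OF \<xi>] by (simp add: sum_fun_apply)
  qed
qed

lemma spanned_dual: "spanned_by (dual_space F) \<xi> n"
  unfolding spanned_by_def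
proof (intro conjI allI impI ballI subspace_dual_space \<xi>)
  show "\<exists>c. \<eta> = (\<Sum>i<n. c i *\<^sub>R \<xi> i)" if "\<eta> \<in> dual_space F" for \<eta>
    by (intro exI[of _ "\<lambda>i. \<eta> (e i)"] dual_expand that)
qed

lemma eval_at_frame: "i < n \<Longrightarrow> j < n \<Longrightarrow> eval_at F (e j) (\<xi> i) = (if i = j then 1 else 0)"
  by (simp add: eval_at_def \<xi> \<xi>_e)

lemma eval_at_dual_frame: "i < n \<Longrightarrow> eval_at F v (\<xi> i) = \<xi> i v"
  by (simp add: eval_at_def \<xi>)

text \<open>
  Below the top degree some index \<open>j\<close> does not occur among the arguments \<open>\<xi>\<^sub>i\<close>, and then the product
  with \<open>e\<^sub>j\<close>, evaluated with \<open>\<xi>\<^sub>j\<close> appended, gives back the coefficient.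
\<close>

lemma vwedge_injective:
  assumes \<alpha>: "\<alpha> \<in> alternating (dual_space F) k" and k: "k < int n"
    and 0: "\<And>v. v \<in> F \<Longrightarrow> vwedge F \<alpha> v = (\<lambda>_. 0)"
  shows "\<alpha> = (\<lambda>_. 0)"
proof (rule alternating_eq_0_on_basis[OF spanned_dual \<alpha>])
  fix "is" assume i: "set is \<subseteq> {..<n}" "distinct is" "int (length is) = k"
  have "set is \<noteq> {..<n}"
  proof
    assume "set is = {..<n}"
    then have "length is = n"
      using distinct_card[OF i(2)] by simp
    with i(3) k show False by simp
  qed
  then obtain j where j: "j < n" "j \<notin> set is"
    using i(1) by blast
  have "vwedge F (\<lambda>\<eta>s. \<alpha> (\<eta>s @ [\<xi> j])) (e j) (map \<xi> is) = 0"
    unfolding vwedge_def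
  proof (rule wedge_one_form_zero, safe)
    fix \<eta> assume "\<eta> \<in> set (map \<xi> is)"
    then obtain l where "l \<in> set is" "\<eta> = \<xi> l" by auto
    then show "eval_at F (e j) \<eta> = 0"
      using i(1) j by (subst \<open>\<eta> = \<xi> l\<close>, subst eval_at_frame) auto
  qed
  then have "vwedge F \<alpha> (e j) (map \<xi> is @ [\<xi> j]) = \<alpha> (map \<xi> is)"
    using j by (simp add: vwedge_snoc eval_at_frame)
  then show "\<alpha> (map \<xi> is) = 0"
    using 0[OF e[OF j(1)]] by simp
qed

lemma vfold_injective:
  assumes "\<alpha> \<in> alternating (dual_space F) k" "k + int m = int n"
    and "\<And>vs. length vs = m \<Longrightarrow> set vs \<subseteq> F \<Longrightarrow> vfold F \<alpha> vs = (\<lambda>_. 0)"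
  shows "\<alpha> = (\<lambda>_. 0)"
  using assms
proof (induction m arbitrary: \<alpha> k)
  case 0
  then show ?case using 0(3)[of "[]"] by simp
next
  case (Suc m)
  show ?case
  proof (rule vwedge_injective[OF Suc.prems(1)])
    fix v assume v: "v \<in> F"
    show "vwedge F \<alpha> v = (\<lambda>_. 0)"
    proof (rule Suc.IH[OF vwedge_alternating[OF Suc.prems(1)]])
      fix vs assume "length vs = m" "set vs \<subseteq> F"
      then show "vfold F (vwedge F \<alpha> v) vs = (\<lambda>_. 0)"
        using Suc.prems(3)[of "v # vs"] v by simp
    qed (use Suc.prems(2) in simp)
  qed (use Suc.prems(2) in simp)
qed

text \<open>
  The opposite order of the two operations of \<open>wedge_contract_trace\<close>: contracting with \<open>\<xi>\<^sub>j\<close> and then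
  wedging with \<open>e\<^sub>j\<close> counts, when summed over \<open>j\<close>, the directions present in \<open>\<beta>\<close>.
\<close>

lemma wedge_contract_trace_aux:
  "\<beta> \<in> alternating (dual_space F) p \<Longrightarrow>
   (\<Sum>j<n. vwedge F (\<lambda>\<eta>s. \<beta> (\<eta>s @ [\<xi> j])) (e j) \<xi>s) = of_int p * \<beta> \<xi>s"
proof (induction \<xi>s arbitrary: \<beta> p rule: rev_induct)
  case Nil
  then show ?case
    using alternating_off[OF Nil, of "[]"] by (cases "p = 0") (simp_all add: vwedge_def)
next
  case (snoc \<eta> \<xi>s)
  note W = subspace_dual_space[of F]
  show ?case
  proof (cases "\<eta> \<in> dual_space F")
    case False
    then have "vwedge F (\<lambda>\<eta>s. \<beta> (\<eta>s @ [\<xi> j])) (e j) (\<xi>s @ [\<eta>]) = 0" for j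
      by (intro alternating_off[OF vwedge_alternating[OF alternating_contract_last[OF W snoc.prems]]]) auto
    moreover have "\<beta> (\<xi>s @ [\<eta>]) = 0"
      using False by (intro alternating_off[OF snoc.prems]) auto
    ultimately show ?thesis by simp
  next
    case True
    have swap: "(\<lambda>\<eta>s. \<beta> ((\<eta>s @ [\<eta>]) @ [\<xi> j])) = (\<lambda>\<eta>s. - \<beta> ((\<eta>s @ [\<xi> j]) @ [\<eta>]))" for j
      using alternating_swap[OF W snoc.prems, of _ \<eta> "\<xi> j" "[]"] by simp
    have "vwedge F (\<lambda>\<eta>s. \<beta> (\<eta>s @ [\<xi> j])) (e j) (\<xi>s @ [\<eta>]) =
        \<beta> (\<xi>s @ [\<xi> j]) * \<eta> (e j) + vwedge F (\<lambda>\<eta>s. \<beta> ((\<eta>s @ [\<xi> j]) @ [\<eta>])) (e j) \<xi>s" for j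
      using vwedge_linear_left[of F "- 1" "\<lambda>\<eta>s. \<beta> ((\<eta>s @ [\<xi> j]) @ [\<eta>])" 0 "\<lambda>_. 0" "e j"]
      unfolding vwedge_snoc swap using True by (simp add: eval_at_def)
    then have "(\<Sum>j<n. vwedge F (\<lambda>\<eta>s. \<beta> (\<eta>s @ [\<xi> j])) (e j) (\<xi>s @ [\<eta>])) =
        (\<Sum>j<n. \<eta> (e j) * \<beta> (\<xi>s @ [\<xi> j])) + (\<Sum>j<n. vwedge F (\<lambda>\<eta>s. \<beta> ((\<eta>s @ [\<xi> j]) @ [\<eta>])) (e j) \<xi>s)"
      by (simp add: sum.distrib mult.commute)
    also have "(\<Sum>j<n. \<eta> (e j) * \<beta> (\<xi>s @ [\<xi> j])) = \<beta> (\<xi>s @ [\<eta>])"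
      using alternating_sum[OF W snoc.prems, of "{..<n}" \<xi> \<xi>s "\<lambda>j. \<eta> (e j)" "[]"] dual_expand[OF True] \<xi>
      by simp
    also have "(\<Sum>j<n. vwedge F (\<lambda>\<eta>s. \<beta> ((\<eta>s @ [\<xi> j]) @ [\<eta>])) (e j) \<xi>s) = of_int (p - 1) * \<beta> (\<xi>s @ [\<eta>])"
      by (rule snoc.IH[OF alternating_contract_last[OF W snoc.prems]])
    finally show ?thesis by (simp add: algebra_simps)
  qed
qed

text \<open>
  Wedging with \<open>e\<^sub>j\<close> and contracting with \<open>\<xi>\<^sub>j\<close>, summed over \<open>j\<close>, counts the directions missing
  from \<open>\<beta>\<close>: there are \<open>n\<close> in total, and \<open>p\<close> of them are present.
\<close>

lemma wedge_contract_trace: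
  assumes "\<beta> \<in> alternating (dual_space F) p"
  shows "(\<Sum>j<n. vwedge F \<beta> (e j) (\<xi>s @ [\<xi> j])) = of_int (int n - p) * \<beta> \<xi>s"
  using wedge_contract_trace_aux[OF assms, of \<xi>s]
  by (simp add: vwedge_snoc eval_at_frame sum_subtractf algebra_simps)

end

text \<open>
  The form \<open>star F \<Lambda> \<alpha>\<close> is the coefficient of \<open>\<alpha> \<and> v\<^sub>1 \<and> \<dots> \<and> v\<^sub>m\<close> with respect to the volume element \<open>\<Lambda>\<close>.
  The choice of the evaluation point does not matter, because the top exterior power is a line; in
  the other degrees the quotient is zero.
\<close>

definition star :: "'v::real_vector set \<Rightarrow> (('v \<Rightarrow> real) list \<Rightarrow> real) \<Rightarrow>
    (('v \<Rightarrow> real) list \<Rightarrow> real) \<Rightarrow> 'v list \<Rightarrow> real"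
  where "star F \<Lambda> \<alpha> vs = vfold F \<alpha> vs (SOME \<xi>s. \<Lambda> \<xi>s \<noteq> 0) / \<Lambda> (SOME \<xi>s. \<Lambda> \<xi>s \<noteq> 0)"

text \<open>
  Contraction of the volume element with a form of degree \<open>m\<close>, one frame vector at a time. The
  factors multiply up to \<open>1 / m!\<close>, since the sum runs over all index sequences rather than the
  increasing ones. This is the inverse of \<open>star\<close>.
\<close>

primrec contraction :: "(nat \<Rightarrow> 'v) \<Rightarrow> (nat \<Rightarrow> 'v \<Rightarrow> real) \<Rightarrow> nat \<Rightarrow> (('v \<Rightarrow> real) list \<Rightarrow> real) \<Rightarrow>
    nat \<Rightarrow> ('v list \<Rightarrow> real) \<Rightarrow> ('v \<Rightarrow> real) list \<Rightarrow> real" where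
  "contraction e \<xi> n \<Lambda> 0 \<omega> \<eta>s = \<omega> [] * \<Lambda> \<eta>s"
| "contraction e \<xi> n \<Lambda> (Suc m) \<omega> \<eta>s =
     (1 / real (Suc m)) * (\<Sum>j<n. contraction e \<xi> n \<Lambda> m (\<lambda>vs. \<omega> (e j # vs)) (\<eta>s @ [\<xi> j]))"

lemma contraction_linear:
  "contraction e \<xi> n \<Lambda> m (\<lambda>vs. a * \<omega> vs + b * \<omega>' vs) \<eta>s =
     a * contraction e \<xi> n \<Lambda> m \<omega> \<eta>s + b * contraction e \<xi> n \<Lambda> m \<omega>' \<eta>s"
  by (induction m arbitrary: \<omega> \<omega>' \<eta>s) (simp_all add: sum.distrib sum_distrib_left algebra_simps)

lemma contraction_sum:
  "contraction e \<xi> n \<Lambda> m (\<lambda>vs. \<Sum>i\<in>I. c i * \<omega> i vs) \<eta>s =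
     (\<Sum>i\<in>I. c i * contraction e \<xi> n \<Lambda> m (\<omega> i) \<eta>s)"
proof (induction I rule: infinite_finite_induct)
  case (insert i I)
  then show ?case
    using contraction_linear[of e \<xi> n \<Lambda> m "c i" "\<omega> i" 1 "\<lambda>vs. \<Sum>i\<in>I. c i * \<omega> i vs"] by simp
qed (use contraction_linear[of e \<xi> n \<Lambda> m 0 "\<lambda>_. 0" 0 "\<lambda>_. 0"] in simp_all)

lemma star_linear:
  "star F \<Lambda> (\<lambda>\<xi>s. a * \<alpha> \<xi>s + b * \<beta> \<xi>s) vs = a * star F \<Lambda> \<alpha> vs + b * star F \<Lambda> \<beta> vs"
  by (simp add: star_def vfold_linear add_divide_distrib)

lemma star_zero: "star F \<Lambda> (\<lambda>_. 0) vs = 0"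
  by (simp add: star_def vfold_zero)

lemma star_Cons: "star F \<Lambda> \<alpha> (v # vs) = star F \<Lambda> (vwedge F \<alpha> v) vs"
  by (simp add: star_def)

locale volume_frames = dual_frames F e \<xi> n
  for F :: "'v::real_vector set" and e \<xi> n +
  fixes \<Lambda> :: "('v \<Rightarrow> real) list \<Rightarrow> real"
  assumes \<Lambda>: "\<Lambda> \<in> alternating (dual_space F) (int n)" and \<Lambda>_nz: "\<Lambda> \<noteq> (\<lambda>_. 0)"
begin

lemma volume_frame_nz: "\<Lambda> (map \<xi> [0..<n]) \<noteq> 0"
  using alternating_top_degree_zero[OF spanned_dual \<Lambda>] \<Lambda>_nz by blast

lemma top_degree_proportional:
  assumes \<beta>: "\<beta> \<in> alternating (dual_space F) (int n)"
  shows "\<beta> \<eta>s * \<Lambda> \<zeta>s = \<beta> \<zeta>s * \<Lambda> \<eta>s"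
proof -
  let ?f = "map \<xi> [0..<n]"
  have "(\<lambda>\<eta>s. \<Lambda> ?f * \<beta> \<eta>s + (- \<beta> ?f) * \<Lambda> \<eta>s) = (\<lambda>_. 0)"
    by (rule alternating_top_degree_zero[OF spanned_dual alternating_combination[OF subspace_dual_space \<beta> \<Lambda>]])
       simp
  then have "\<Lambda> ?f * \<beta> \<eta>s = \<beta> ?f * \<Lambda> \<eta>s" for \<eta>s
    by (simp add: fun_eq_iff)
  then have "\<Lambda> ?f * (\<beta> \<eta>s * \<Lambda> \<zeta>s) = \<Lambda> ?f * (\<beta> \<zeta>s * \<Lambda> \<eta>s)"
    by (metis mult.assoc mult.commute)
  then show ?thesis
    using volume_frame_nz by simp
qed

lemma volume_point: "\<Lambda> (SOME \<xi>s. \<Lambda> \<xi>s \<noteq> 0) \<noteq> 0"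
  by (rule someI[of "\<lambda>\<xi>s. \<Lambda> \<xi>s \<noteq> 0", OF volume_frame_nz])

lemma volume_off: "\<Lambda> \<xi>s \<noteq> 0 \<Longrightarrow> length \<xi>s = n"
  using alternating_off[OF \<Lambda>, of \<xi>s] by auto

lemma vfold_eq_star:
  assumes \<alpha>: "\<alpha> \<in> alternating (dual_space F) k" and k: "k + int (length vs) = int n"
  shows "vfold F \<alpha> vs \<eta>s = star F \<Lambda> \<alpha> vs * \<Lambda> \<eta>s"
  using top_degree_proportional[of "vfold F \<alpha> vs" \<eta>s "SOME \<xi>s. \<Lambda> \<xi>s \<noteq> 0"] vfold_alternating[OF \<alpha>, of vs] k volume_point
  by (simp add: star_def field_simps)

lemma star_wrong_degree:
  assumes \<alpha>: "\<alpha> \<in> alternating (dual_space F) k" and k: "k + int (length vs) \<noteq> int n"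
  shows "star F \<Lambda> \<alpha> vs = 0"
proof -
  have "vfold F \<alpha> vs (SOME \<xi>s. \<Lambda> \<xi>s \<noteq> 0) = 0"
    by (rule alternating_off[OF vfold_alternating[OF \<alpha>]]) (use k volume_off[OF volume_point] in auto)
  then show ?thesis by (simp add: star_def)
qed

lemma star_eq_frame_quotient:
  assumes \<alpha>: "\<alpha> \<in> alternating (dual_space F) k"
  shows "star F \<Lambda> \<alpha> vs = vfold F \<alpha> vs (map \<xi> [0..<n]) / \<Lambda> (map \<xi> [0..<n])"
proof (cases "k + int (length vs) = int n")
  case True
  then show ?thesis
    using vfold_eq_star[OF \<alpha>] volume_frame_nz by simp
next
  case False
  then have "vfold F \<alpha> vs (map \<xi> [0..<n]) = 0"
    by (intro alternating_off[OF vfold_alternating[OF \<alpha>]]) auto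
  then show ?thesis using star_wrong_degree[OF \<alpha> False] by simp
qed

lemma star_alternating:
  assumes \<alpha>: "\<alpha> \<in> alternating (dual_space F) k"
  shows "star F \<Lambda> \<alpha> \<in> alternating F (int n - k)"
proof (rule alternatingI[OF F])
  fix vs assume vs: "\<not> (int (length vs) = int n - k \<and> set vs \<subseteq> F)"
  show "star F \<Lambda> \<alpha> vs = 0"
  proof (cases "set vs \<subseteq> F")
    case True
    then show ?thesis using vs by (intro star_wrong_degree[OF \<alpha>]) auto
  next
    case False
    then obtain xs v ys where "vs = xs @ v # ys" "v \<notin> F"
      by (metis split_list subsetI)
    then show ?thesis by (simp add: star_def vwedge_off vfold_zero)
  qed
next
  fix xs ys u v and a b :: real assume "u \<in> F" "v \<in> F"
  then show "star F \<Lambda> \<alpha> (xs @ (a *\<^sub>R u + b *\<^sub>R v) # ys) =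
      a * star F \<Lambda> \<alpha> (xs @ u # ys) + b * star F \<Lambda> \<alpha> (xs @ v # ys)"
    by (simp add: star_def vwedge_linear_right vfold_linear add_divide_distrib)
next
  fix xs ys v
  show "star F \<Lambda> \<alpha> (xs @ v # v # ys) = 0"
    by (simp add: star_def vwedge_twice vfold_zero)
qed

lemma star_injective:
  assumes \<alpha>: "\<alpha> \<in> alternating (dual_space F) k" and 0: "star F \<Lambda> \<alpha> = (\<lambda>_. 0)"
  shows "\<alpha> = (\<lambda>_. 0)"
proof (cases "k \<le> int n")
  case True
  then obtain m where m: "k + int m = int n"
    by (metis add.commute diff_add_cancel zle_iff_zadd)
  show ?thesis
  proof (rule vfold_injective[OF \<alpha> m])
    fix vs :: "'v list" assume "length vs = m"
    then have "vfold F \<alpha> vs \<eta>s = 0" for \<eta>s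
      using vfold_eq_star[OF \<alpha>, of vs] m 0 by simp
    then show "vfold F \<alpha> vs = (\<lambda>_. 0)" by (simp add: fun_eq_iff)
  qed
next
  case False
  then show ?thesis
    using alternating_above_dimension[OF spanned_dual \<alpha>] by simp
qed

text \<open>
  Write \<open>b\<^sub>v\<close> for the multivector that corresponds to the contraction of \<open>\<omega>\<close> with \<open>v\<close>. Since \<open>\<omega>\<close> is
  alternating, \<open>b\<^sub>v \<and> w + b\<^sub>w \<and> v = 0\<close>. With the trace identity this makes the normalized sum of the
  contractions of \<open>b\<^bsub>e_j\<^esub>\<close> with \<open>\<xi>\<^sub>j\<close> a multivector \<open>a\<close> such that \<open>a \<and> v = b\<^sub>v\<close>.
\<close>

lemma contraction_star:
  "\<omega> \<in> alternating F (int m) \<Longrightarrow>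
     contraction e \<xi> n \<Lambda> m \<omega> \<in> alternating (dual_space F) (int n - int m) \<and>
     star F \<Lambda> (contraction e \<xi> n \<Lambda> m \<omega>) = \<omega>"
proof (induction m arbitrary: \<omega>)
  case 0
  note W = subspace_dual_space[of F]
  have a: "(\<lambda>\<eta>s. \<omega> [] * \<Lambda> \<eta>s) \<in> alternating (dual_space F) (int n)"
    using alternating_combination[OF W \<Lambda> \<Lambda>, of "\<omega> []" 0] by simp
  have "star F \<Lambda> (\<lambda>\<eta>s. \<omega> [] * \<Lambda> \<eta>s) vs = \<omega> vs" for vs
  proof (cases vs)
    case Nil
    then show ?thesis using volume_point by (simp add: star_def)
  next
    case (Cons v ws)
    then show ?thesis
      using star_wrong_degree[OF a, of vs] alternating_off[OF 0, of vs] by simp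
  qed
  moreover have "contraction e \<xi> n \<Lambda> 0 \<omega> = (\<lambda>\<eta>s. \<omega> [] * \<Lambda> \<eta>s)"
    by (rule ext) simp
  ultimately show ?case using a by (simp add: fun_eq_iff)
next
  case (Suc m)
  note W = subspace_dual_space[of F]
  define b where "b v = contraction e \<xi> n \<Lambda> m (\<lambda>vs. \<omega> (v # vs))" for v
  have "(\<lambda>vs. \<omega> (v # vs)) \<in> alternating F (int m)" for v
    using alternating_contract_head[OF F Suc.prems, of v] by simp
  from Suc.IH[OF this]
  have b_alt: "b v \<in> alternating (dual_space F) (int n - int m)"
    and b_star: "star F \<Lambda> (b v) = (\<lambda>vs. \<omega> (v # vs))" for v
    by (simp_all add: b_def)
  have b_lin: "b v \<eta>s = (\<Sum>j<n. \<xi> j v * b (e j) \<eta>s)" if v: "v \<in> F" for v \<eta>s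
  proof -
    have "(\<lambda>vs. \<omega> (v # vs)) = (\<lambda>vs. \<Sum>j<n. \<xi> j v * \<omega> (e j # vs))"
    proof
      fix vs
      show "\<omega> (v # vs) = (\<Sum>j<n. \<xi> j v * \<omega> (e j # vs))"
        using alternating_sum[OF F Suc.prems, of "{..<n}" e "[]" "\<lambda>j. \<xi> j v" vs] e expand[OF v] by simp
    qed
    then show ?thesis
      by (simp add: b_def contraction_sum)
  qed
  have skew: "vwedge F (b v) w \<eta>s = - vwedge F (b w) v \<eta>s" for v w \<eta>s
  proof -
    have "(\<lambda>\<eta>s. 1 * vwedge F (b v) w \<eta>s + 1 * vwedge F (b w) v \<eta>s) = (\<lambda>_. 0)"
    proof (rule star_injective[OF alternating_combination[OF W vwedge_alternating[OF b_alt] vwedge_alternating[OF b_alt]]])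
      show "star F \<Lambda> (\<lambda>\<eta>s. 1 * vwedge F (b v) w \<eta>s + 1 * vwedge F (b w) v \<eta>s) = (\<lambda>_. 0)"
        unfolding star_linear star_Cons[symmetric] b_star
        using alternating_swap[OF F Suc.prems, of "[]" v w] by (auto simp: fun_eq_iff)
    qed
    from fun_cong[OF this, of \<eta>s] show ?thesis by simp
  qed
  define a where "a = contraction e \<xi> n \<Lambda> (Suc m) \<omega>"
  have a: "a \<eta>s = (1 / real (Suc m)) * (\<Sum>j<n. b (e j) (\<eta>s @ [\<xi> j]))" for \<eta>s
    by (simp add: a_def b_def)
  have a_alt: "a \<in> alternating (dual_space F) (int n - int m - 1)"
    unfolding a[abs_def] by (intro alternating_sum_forms[OF W] alternating_contract_last[OF W] b_alt)
  have a_v: "vwedge F a v = b v" if v: "v \<in> F" for v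
  proof
    fix \<eta>s
    have lin: "vwedge F (\<lambda>\<eta>s. c * (\<Sum>j\<in>J. f j \<eta>s)) v \<eta>s = c * (\<Sum>j\<in>J. vwedge F (f j) v \<eta>s)"
      if "finite J" for c :: real and f and J :: "nat set"
    proof -
      have "vwedge F (\<lambda>\<eta>s. \<Sum>j\<in>J. f j \<eta>s) v \<eta>s = (\<Sum>j\<in>J. vwedge F (f j) v \<eta>s)"
        using that
      proof (induction J rule: finite_induct)
        case (insert j J)
        then show ?case
          using vwedge_linear_left[of F 1 "f j" 1 "\<lambda>\<eta>s. \<Sum>j\<in>J. f j \<eta>s" v] by simp
      qed (simp add: vwedge_zero_left)
      then show ?thesis
        using vwedge_linear_left[of F c "\<lambda>\<eta>s. \<Sum>j\<in>J. f j \<eta>s" 0 "\<lambda>_. 0" v] by simp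
    qed
    have step: "vwedge F (\<lambda>\<eta>s. b (e j) (\<eta>s @ [\<xi> j])) v \<eta>s =
        \<xi> j v * b (e j) \<eta>s + vwedge F (b v) (e j) (\<eta>s @ [\<xi> j])" if "j < n" for j
      using vwedge_snoc[of F "b (e j)" v \<eta>s "\<xi> j"] skew[of v "e j"] eval_at_dual_frame[OF that, of v]
      by (simp add: mult.commute)
    have "vwedge F a v \<eta>s = (1 / real (Suc m)) * (\<Sum>j<n. vwedge F (\<lambda>\<eta>s. b (e j) (\<eta>s @ [\<xi> j])) v \<eta>s)"
      unfolding a[abs_def] by (rule lin) simp
    also have "(\<Sum>j<n. vwedge F (\<lambda>\<eta>s. b (e j) (\<eta>s @ [\<xi> j])) v \<eta>s) =
        b v \<eta>s + (\<Sum>j<n. vwedge F (b v) (e j) (\<eta>s @ [\<xi> j]))"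
      by (simp add: step sum.distrib b_lin[OF v, symmetric])
    also have "\<dots> = real (Suc m) * b v \<eta>s"
      by (simp add: wedge_contract_trace[OF b_alt] algebra_simps)
    finally show "vwedge F a v \<eta>s = b v \<eta>s" by simp
  qed
  have "star F \<Lambda> a vs = \<omega> vs" for vs
  proof (cases vs)
    case Nil
    then show ?thesis
      using star_wrong_degree[OF a_alt, of vs] alternating_off[OF Suc.prems, of vs] by simp
  next
    case (Cons v ws)
    show ?thesis
    proof (cases "v \<in> F")
      case True
      then show ?thesis by (simp add: Cons star_Cons a_v b_star)
    next
      case False
      then show ?thesis
        using alternating_off[OF Suc.prems, of vs] by (simp add: Cons star_Cons vwedge_off star_zero)
    qed
  qed
  then show ?case
    using a_alt by (simp add: a_def[symmetric] fun_eq_iff algebra_simps)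
qed

end

section \<open>The duality on smooth sections\<close>

lemma multivectors_iff:
  "a \<in> multivectors M E k \<longleftrightarrow>
    (\<forall>x. a x \<in> alternating (dual_space (fibre E x)) k) \<and>
    (\<forall>(U, e)\<in>frames E. \<forall>js. set js \<subseteq> {..<brank E} \<longrightarrow>
       smooth_fun_on M U (\<lambda>x. a x (map (\<lambda>j. dual_frame E e j x) js)))"
  unfolding alternating_sections_def dual_bundle_def by auto

lemma of_section_eq_one_form: "of_section E X x = one_form (eval_at (fibre E x) (X x))"
  by (auto simp: of_section_def one_form_def eval_at_def fun_eq_iff)

lemma wedge_of_section: "(a \<and>\<^sub>w of_section E X) x = vwedge (fibre E x) (a x) (X x)"
  by (simp add: wedge_field_def of_section_eq_one_form vwedge_def)

definition wedge_sections ::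
    "('m, 'v::real_vector, 'z) vbundle_scheme \<Rightarrow> ('m \<Rightarrow> ('v \<Rightarrow> real) list \<Rightarrow> real) \<Rightarrow> ('m \<Rightarrow> 'v) list \<Rightarrow>
      'm \<Rightarrow> ('v \<Rightarrow> real) list \<Rightarrow> real"
  where "wedge_sections E = foldl (\<lambda>a X. a \<and>\<^sub>w of_section E X)"

lemma wedge_sections_apply:
  "wedge_sections E a Xs x = vfold (fibre E x) (a x) (map (\<lambda>X. X x) Xs)"
  unfolding wedge_sections_def
  by (induction Xs arbitrary: a) (simp_all add: wedge_of_section)

definition star_field ::
    "('m, 'v::real_vector, 'z) vbundle_scheme \<Rightarrow> ('m \<Rightarrow> ('v \<Rightarrow> real) list \<Rightarrow> real) \<Rightarrow>
     ('m \<Rightarrow> ('v \<Rightarrow> real) list \<Rightarrow> real) \<Rightarrow> 'm \<Rightarrow> 'v list \<Rightarrow> real"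
  where "star_field E \<Lambda> a x = star (fibre E x) (\<Lambda> x) (a x)"

locale manifold_bundle =
  fixes M :: "('m::{t2_space, second_countable_topology}) manifold"
    and E :: "('m, 'v::real_vector, 'z) vbundle_scheme"
  assumes M: "smooth_manifold M" and E: "vector_bundle M E"
begin

lemma frame_open: "(U, e) \<in> frames E \<Longrightarrow> open U"
  using E unfolding vector_bundle_def by auto

lemma frame_at: obtains U e where "(U, e) \<in> frames E" "x \<in> U"
proof -
  have "x \<in> (\<Union>(U, e)\<in>frames E. U)"
    using E unfolding vector_bundle_def by simp
  then show ?thesis using that by auto
qed

lemma fibre_subspace: "subspace (fibre E x)"
  using E unfolding vector_bundle_def by auto

lemma dual_frames_fibre:
  assumes f: "(U, e) \<in> frames E" and x: "x \<in> U"
  shows "dual_frames (fibre E x) (\<lambda>i. e i x) (\<lambda>i. dual_frame E e i x) (brank E)"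
proof -
  define B where "B = (\<lambda>i. e i x) ` {..<brank E}"
  have inj: "inj_on (\<lambda>i. e i x) {..<brank E}" and ind: "independent B" and span: "span B = fibre E x"
    using E f x unfolding vector_bundle_def B_def by auto
  have df: "dual_frame E e i x v = representation B v (e i x)" if "v \<in> fibre E x" for i v
    using that by (simp add: dual_frame_def B_def)
  show ?thesis
  proof
    show "subspace (fibre E x)" by (rule fibre_subspace)
    show eF: "e i x \<in> fibre E x" if "i < brank E" for i
      unfolding span[symmetric] using that by (intro span_base) (simp add: B_def)
    show "dual_frame E e i x \<in> dual_space (fibre E x)" for i
    proof -
      have "dual_frame E e i x (a *\<^sub>R u + b *\<^sub>R v) = a * dual_frame E e i x u + b * dual_frame E e i x v"
        if "u \<in> fibre E x" "v \<in> fibre E x" for a b u v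
        using that fibre_subspace[of x]
        by (simp add: df subspace_add subspace_scale)
           (simp add: representation_add representation_scale span ind subspace_scale)
      then show ?thesis
        by (simp add: dual_space_def linear_on_def) (simp add: dual_frame_def)
    qed
    show "dual_frame E e i x (e j x) = (if i = j then 1 else 0)" if "i < brank E" "j < brank E" for i j
    proof -
      have "representation B (e j x) = (\<lambda>v. if v = e j x then 1 else 0)"
        using ind that by (intro representation_basis) (auto simp: B_def)
      then show ?thesis
        using that inj by (auto simp: df eF inj_on_def)
    qed
    show "v = (\<Sum>i<brank E. dual_frame E e i x v *\<^sub>R e i x)" if v: "v \<in> fibre E x" for v
    proof -
      have "(\<Sum>b\<in>B. representation B v b *\<^sub>R b) = v"
        using ind v span by (intro sum_representation_eq) (auto simp: B_def)
      moreover have "(\<Sum>b\<in>B. representation B v b *\<^sub>R b) = (\<Sum>i<brank E. representation B v (e i x) *\<^sub>R e i x)"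
        unfolding B_def by (simp add: sum.reindex[OF inj])
      ultimately show ?thesis by (simp add: df v)
    qed
  qed
qed

lemma multivector_alternating: "a \<in> multivectors M E k \<Longrightarrow> a x \<in> alternating (dual_space (fibre E x)) k"
  by (simp add: multivectors_iff)

lemma multivector_smooth:
  "a \<in> multivectors M E k \<Longrightarrow> (U, e) \<in> frames E \<Longrightarrow> set js \<subseteq> {..<brank E} \<Longrightarrow>
    smooth_fun_on M U (\<lambda>x. a x (map (\<lambda>j. dual_frame E e j x) js))"
  unfolding multivectors_iff by blast

lemma multivector_of_degree_0: "a \<in> multivectors M E 0 \<Longrightarrow> \<xi>s \<noteq> [] \<Longrightarrow> a x \<xi>s = 0"
  using alternating_off[OF multivector_alternating, of a 0 \<xi>s x] by auto

lemma multivectors_subspace: "subspace (multivectors M E k)"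
proof (rule subspaceI)
  show "0 \<in> multivectors M E k"
    unfolding multivectors_iff
    using alternating_zero[OF subspace_dual_space] frame_open
    by (auto simp: zero_fun_def intro: smooth_fun_on_const[OF M])
next
  fix a b assume ab: "a \<in> multivectors M E k" "b \<in> multivectors M E k"
  show "a + b \<in> multivectors M E k"
    unfolding multivectors_iff
  proof (intro conjI allI ballI, goal_cases)
    case (1 x)
    show ?case
      using alternating_combination[OF subspace_dual_space multivector_alternating[OF ab(1), of x]
          multivector_alternating[OF ab(2), of x], where a = 1 and b = 1]
      by (simp add: plus_fun_def)
  next
    case (2 Ue)
    then show ?case
      using ab[THEN multivector_smooth] frame_open
      by (auto simp: plus_fun_def intro!: smooth_fun_on_add[OF M])
  qed
next
  fix c a assume a: "a \<in> multivectors M E k"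
  show "c *\<^sub>R a \<in> multivectors M E k"
    unfolding multivectors_iff
  proof (intro conjI allI ballI, goal_cases)
    case (1 x)
    show ?case
      using alternating_combination[OF subspace_dual_space multivector_alternating[OF a, of x]
          multivector_alternating[OF a, of x], where a = c and b = 0]
      by (simp add: scaleR_fun_def)
  next
    case (2 Ue)
    then show ?case
      using multivector_smooth[OF a] frame_open
      by (auto simp: scaleR_fun_def intro!: smooth_fun_on_mult[OF M] smooth_fun_on_const[OF M])
  qed
qed

lemma smooth_on_frames_imp_smooth:
  assumes "\<And>U e. (U, e) \<in> frames E \<Longrightarrow> smooth_fun_on M U f"
  shows "f \<in> smooth_funs M"
  unfolding smooth_funs_def mem_Collect_eq
proof (rule smooth_fun_on_local[OF M open_UNIV])
  fix x
  obtain U e where "(U, e) \<in> frames E" "x \<in> U" by (rule frame_at)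
  then show "\<exists>U. open U \<and> x \<in> U \<and> smooth_fun_on M U f"
    using assms frame_open by blast
qed

lemma of_fun_multivector:
  assumes "f \<in> smooth_funs M"
  shows "of_fun f \<in> multivectors M E 0"
  unfolding multivectors_iff
proof (intro conjI allI ballI, goal_cases)
  case (1 x)
  show ?case
    by (rule alternatingI[OF subspace_dual_space]) (auto simp: of_fun_def)
next
  case (2 Ue)
  have "smooth_fun_on M U (\<lambda>x. of_fun f x (map (\<lambda>j. dual_frame E e j x) js))" if "open U" for U e js
    using that by (cases js) (simp_all add: of_fun_def smooth_funs_on[OF assms] smooth_fun_on_const[OF M])
  then show ?case
    using 2 frame_open by auto
qed

lemma section_smooth:
  assumes X: "X \<in> sections M E" and f: "(U, e) \<in> frames E" and i: "i < brank E"
  shows "smooth_fun_on M U (\<lambda>x. dual_frame E e i x (X x))"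
proof -
  obtain c where c: "\<And>i. i < brank E \<Longrightarrow> smooth_fun_on M U (c i)"
    "\<And>x. x \<in> U \<Longrightarrow> X x = (\<Sum>i<brank E. c i x *\<^sub>R e i x)"
    using X f unfolding sections_def smooth_components_def by fastforce
  show ?thesis
  proof (rule smooth_fun_on_cong[OF M frame_open[OF f] _ c(1)[OF i]])
    fix x assume x: "x \<in> U"
    interpret dual_frames "fibre E x" "\<lambda>i. e i x" "\<lambda>i. dual_frame E e i x" "brank E"
      by (rule dual_frames_fibre[OF f x])
    have "dual_frame E e i x (X x) = (\<Sum>j<brank E. c j x * dual_frame E e i x (e j x))"
      unfolding c(2)[OF x] by (rule dual_sum[OF \<xi>[OF i]]) (auto simp: e)
    also have "\<dots> = (\<Sum>j<brank E. if i = j then c j x else 0)"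
      by (intro sum.cong) (auto simp: \<xi>_e i)
    finally show "c i x = dual_frame E e i x (X x)"
      using i by simp
  qed
qed

lemma smooth_vwedge:
  assumes f: "(U, e) \<in> frames E"
    and a: "\<And>js. set js \<subseteq> {..<brank E} \<Longrightarrow> smooth_fun_on M U (\<lambda>x. a x (map (\<lambda>j. dual_frame E e j x) js))"
    and v: "\<And>i. i < brank E \<Longrightarrow> smooth_fun_on M U (\<lambda>x. dual_frame E e i x (v x))"
    and js: "set js \<subseteq> {..<brank E}"
  shows "smooth_fun_on M U (\<lambda>x. vwedge (fibre E x) (a x) (v x) (map (\<lambda>j. dual_frame E e j x) js))"
  using a js
proof (induction js arbitrary: a rule: rev_induct)
  case Nil
  show ?case
    using smooth_fun_on_const[OF M frame_open[OF f], of 0] by (simp add: vwedge_def)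
next
  case (snoc i js)
  have i: "i < brank E" and js: "set js \<subseteq> {..<brank E}"
    using snoc.prems(2) by auto
  have "smooth_fun_on M U (\<lambda>x. vwedge (fibre E x) (\<lambda>\<eta>s. a x (\<eta>s @ [dual_frame E e i x])) (v x)
      (map (\<lambda>j. dual_frame E e j x) js))"
  proof (rule snoc.IH[OF _ js])
    fix ks assume "set ks \<subseteq> {..<brank E}"
    then show "smooth_fun_on M U (\<lambda>x. a x (map (\<lambda>j. dual_frame E e j x) ks @ [dual_frame E e i x]))"
      using snoc.prems(1)[of "ks @ [i]"] i by simp
  qed
  then have "smooth_fun_on M U (\<lambda>x. a x (map (\<lambda>j. dual_frame E e j x) js) * dual_frame E e i x (v x) -
      vwedge (fibre E x) (\<lambda>\<eta>s. a x (\<eta>s @ [dual_frame E e i x])) (v x) (map (\<lambda>j. dual_frame E e j x) js))"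
    by (intro smooth_fun_on_diff[OF M frame_open[OF f]] smooth_fun_on_mult[OF M frame_open[OF f]]
        snoc.prems(1) js v i)
  then show ?case
  proof (rule smooth_fun_on_cong[OF M frame_open[OF f], rotated])
    fix x assume x: "x \<in> U"
    interpret dual_frames "fibre E x" "\<lambda>i. e i x" "\<lambda>i. dual_frame E e i x" "brank E"
      by (rule dual_frames_fibre[OF f x])
    show "a x (map (\<lambda>j. dual_frame E e j x) js) * dual_frame E e i x (v x) -
      vwedge (fibre E x) (\<lambda>\<eta>s. a x (\<eta>s @ [dual_frame E e i x])) (v x) (map (\<lambda>j. dual_frame E e j x) js) =
      vwedge (fibre E x) (a x) (v x) (map (\<lambda>j. dual_frame E e j x) (js @ [i]))"
      by (simp add: vwedge_snoc eval_at_dual_frame i)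
  qed
qed

lemma wedge_section_multivector:
  assumes a: "a \<in> multivectors M E p" and X: "X \<in> sections M E"
  shows "a \<and>\<^sub>w of_section E X \<in> multivectors M E (p + 1)"
  unfolding multivectors_iff wedge_of_section
  using vwedge_alternating[OF multivector_alternating[OF a]] smooth_vwedge multivector_smooth[OF a] section_smooth[OF X]
  by (auto split: prod.splits)

lemma of_section_multivector:
  assumes X: "X \<in> sections M E"
  shows "of_section E X \<in> multivectors M E 1"
proof -
  have "(of_fun (\<lambda>_. 1) \<and>\<^sub>w of_section E X) x \<xi>s = of_section E X x \<xi>s" for x \<xi>s
    unfolding wedge_field_def by (subst wedge_scalar_left) (auto simp: of_fun_def)
  then have "of_fun (\<lambda>_. 1) \<and>\<^sub>w of_section E X = of_section E X"
    by (simp add: fun_eq_iff)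
  moreover have "of_fun (\<lambda>_. 1) \<in> multivectors M E 0"
    by (rule of_fun_multivector) (simp add: smooth_funs_def smooth_fun_on_const[OF M])
  ultimately show ?thesis
    using wedge_section_multivector[OF _ X, of "of_fun (\<lambda>_. 1)" 0] by simp
qed

lemma wedge_sections_multivector:
  "a \<in> multivectors M E p \<Longrightarrow> set Xs \<subseteq> sections M E \<Longrightarrow>
    wedge_sections E a Xs \<in> multivectors M E (p + int (length Xs))"
  unfolding wedge_sections_def
proof (induction Xs arbitrary: a p)
  case (Cons X Xs)
  have "foldl (\<lambda>a X. a \<and>\<^sub>w of_section E X) (a \<and>\<^sub>w of_section E X) Xs
      \<in> multivectors M E ((p + 1) + int (length Xs))"
    using Cons.prems by (intro Cons.IH wedge_section_multivector) auto
  then show ?case by (simp add: add.assoc)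
qed simp

text \<open>Every vector extends to a global section, so global sections suffice to separate forms.\<close>

lemma forms_eqI:
  assumes \<omega>: "\<omega> \<in> forms M E k" and \<eta>: "\<eta> \<in> forms M E k"
    and eq: "\<And>Xs x. set Xs \<subseteq> sections M E \<Longrightarrow> int (length Xs) = k \<Longrightarrow>
               \<omega> x (map (\<lambda>X. X x) Xs) = \<eta> x (map (\<lambda>X. X x) Xs)"
  shows "\<omega> = \<eta>"
proof (intro ext)
  fix x vs
  have alt: "\<omega> x \<in> alternating (fibre E x) k" "\<eta> x \<in> alternating (fibre E x) k"
    using \<omega> \<eta> by (auto simp: alternating_sections_def)
  show "\<omega> x vs = \<eta> x vs"
  proof (cases "int (length vs) = k \<and> set vs \<subseteq> fibre E x")
    case True
    have "\<forall>v\<in>fibre E x. \<exists>X. X \<in> sections M E \<and> X x = v"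
      using exists_section_through[OF M E] by metis
    then obtain ext where ext: "\<And>v. v \<in> fibre E x \<Longrightarrow> ext v \<in> sections M E \<and> ext v x = v"
      by metis
    have "map (\<lambda>X. X x) (map ext vs) = vs"
      using True ext by (auto intro!: map_idI)
    moreover have "set (map ext vs) \<subseteq> sections M E"
      using True ext by auto
    ultimately show ?thesis
      using eq[of "map ext vs" x] True by simp
  next
    case False
    then show ?thesis using alternating_off[OF alt(1)] alternating_off[OF alt(2)] by simp
  qed
qed

end

locale volume_bundle = manifold_bundle M E
  for M :: "('m::{t2_space, second_countable_topology}) manifold"
    and E :: "('m, 'v::real_vector, 'z) vbundle_scheme" +
  fixes \<Lambda> :: "'m \<Rightarrow> ('v \<Rightarrow> real) list \<Rightarrow> real"
  assumes \<Lambda>_mv: "\<Lambda> \<in> multivectors M E (int (brank E))" and \<Lambda>_nowhere_zero: "\<And>x. \<Lambda> x \<noteq> 0"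
begin

lemma volume_frames_fibre:
  assumes "(U, e) \<in> frames E" "x \<in> U"
  shows "volume_frames (fibre E x) (\<lambda>i. e i x) (\<lambda>i. dual_frame E e i x) (brank E) (\<Lambda> x)"
proof -
  interpret dual_frames "fibre E x" "\<lambda>i. e i x" "\<lambda>i. dual_frame E e i x" "brank E"
    by (rule dual_frames_fibre[OF assms])
  show ?thesis
    by unfold_locales
       (use multivector_alternating[OF \<Lambda>_mv] \<Lambda>_nowhere_zero[of x] in \<open>auto simp: zero_fun_def\<close>)
qed

lemma volume_frames_at:
  obtains e \<xi> where "volume_frames (fibre E x) e \<xi> (brank E) (\<Lambda> x)"
proof -
  obtain U e where "(U, e) \<in> frames E" "x \<in> U" by (rule frame_at)
  from that[OF volume_frames_fibre[OF this]] show ?thesis .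
qed

lemma smooth_vfold:
  assumes f: "(U, e) \<in> frames E" and ix: "set is \<subseteq> {..<brank E}"
    and a: "\<And>js. set js \<subseteq> {..<brank E} \<Longrightarrow> smooth_fun_on M U (\<lambda>x. a x (map (\<lambda>j. dual_frame E e j x) js))"
    and js: "set js \<subseteq> {..<brank E}"
  shows "smooth_fun_on M U (\<lambda>x. vfold (fibre E x) (a x) (map (\<lambda>j. e j x) is) (map (\<lambda>j. dual_frame E e j x) js))"
  using a ix
proof (induction "is" arbitrary: a)
  case Nil
  then show ?case using js by simp
next
  case (Cons i "is")
  have i: "i < brank E" using Cons.prems by simp
  have e_smooth: "smooth_fun_on M U (\<lambda>x. dual_frame E e j x (e i x))" if j: "j < brank E" for j
  proof (rule smooth_fun_on_cong[OF M frame_open[OF f] _ smooth_fun_on_const[OF M frame_open[OF f]]])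
    fix x assume "x \<in> U"
    then interpret dual_frames "fibre E x" "\<lambda>i. e i x" "\<lambda>i. dual_frame E e i x" "brank E"
      by (rule dual_frames_fibre[OF f])
    show "(if j = i then 1 else 0) = dual_frame E e j x (e i x)"
      using \<xi>_e[OF j i] by simp
  qed
  have "smooth_fun_on M U (\<lambda>x. vfold (fibre E x) (vwedge (fibre E x) (a x) (e i x)) (map (\<lambda>j. e j x) is)
      (map (\<lambda>j. dual_frame E e j x) js))"
    using Cons.prems by (intro Cons.IH smooth_vwedge[OF f] e_smooth) auto
  then show ?case by simp
qed

lemma star_field_form:
  assumes a: "a \<in> multivectors M E k"
  shows "star_field E \<Lambda> a \<in> forms M E (int (brank E) - k)"
  unfolding alternating_sections_def
proof (intro CollectI conjI allI ballI, goal_cases)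
  case (1 x)
  obtain e \<xi> where "volume_frames (fibre E x) e \<xi> (brank E) (\<Lambda> x)" by (rule volume_frames_at)
  then show ?case
    unfolding star_field_def by (rule volume_frames.star_alternating[OF _ multivector_alternating[OF a]])
next
  case (2 Ue)
  obtain U e where Ue: "Ue = (U, e)" by (cases Ue)
  have f: "(U, e) \<in> frames E" using 2 Ue by simp
  have "smooth_fun_on M U (\<lambda>x. star_field E \<Lambda> a x (map (\<lambda>j. e j x) js))" if js: "set js \<subseteq> {..<brank E}" for js
  proof (rule smooth_fun_on_cong[OF M frame_open[OF f] _ smooth_fun_on_divide[OF M frame_open[OF f]]])
    let ?top = "\<lambda>x. map (\<lambda>j. dual_frame E e j x) [0..<brank E]"
    show "smooth_fun_on M U (\<lambda>x. vfold (fibre E x) (a x) (map (\<lambda>j. e j x) js) (?top x))"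
      by (rule smooth_vfold[where a = a, OF f js multivector_smooth[OF a f]]) auto
    show "smooth_fun_on M U (\<lambda>x. \<Lambda> x (?top x))"
      by (rule multivector_smooth[OF \<Lambda>_mv f]) auto
    fix x assume x: "x \<in> U"
    interpret volume_frames "fibre E x" "\<lambda>i. e i x" "\<lambda>i. dual_frame E e i x" "brank E" "\<Lambda> x"
      by (rule volume_frames_fibre[OF f x])
    show "\<Lambda> x (?top x) \<noteq> 0"
      by (rule volume_frame_nz)
    show "vfold (fibre E x) (a x) (map (\<lambda>j. e j x) js) (?top x) / \<Lambda> x (?top x) =
        star_field E \<Lambda> a x (map (\<lambda>j. e j x) js)"
      unfolding star_field_def by (rule star_eq_frame_quotient[OF multivector_alternating[OF a], symmetric])
  qed
  then show ?case by (simp add: Ue)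
qed

lemma star_field_linear:
  "star_field E \<Lambda> (c *\<^sub>R a + d *\<^sub>R b) = c *\<^sub>R star_field E \<Lambda> a + d *\<^sub>R star_field E \<Lambda> b"
  by (intro ext) (simp add: star_field_def plus_fun_def scaleR_fun_def star_linear)

lemma star_field_scale: "star_field E \<Lambda> (c *\<^sub>R a) = c *\<^sub>R star_field E \<Lambda> a"
  using star_field_linear[of c a 0 a] by simp

lemma star_field_injective:
  assumes a: "a \<in> multivectors M E k" and 0: "star_field E \<Lambda> a = 0"
  shows "a = 0"
proof
  fix x
  obtain e \<xi> where v: "volume_frames (fibre E x) e \<xi> (brank E) (\<Lambda> x)" by (rule volume_frames_at)
  have "star (fibre E x) (\<Lambda> x) (a x) = (\<lambda>_. 0)"
    using fun_cong[OF 0, of x] by (simp add: star_field_def zero_fun_def)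
  from volume_frames.star_injective[OF v multivector_alternating[OF a] this]
  show "a x = 0 x" by (simp add: zero_fun_def)
qed

lemma smooth_contraction:
  assumes f: "(U, e) \<in> frames E"
    and \<omega>: "\<And>js. set js \<subseteq> {..<brank E} \<Longrightarrow> smooth_fun_on M U (\<lambda>x. \<omega> x (map (\<lambda>j. e j x) js))"
    and ix: "set is \<subseteq> {..<brank E}"
  shows "smooth_fun_on M U (\<lambda>x. contraction (\<lambda>j. e j x) (\<lambda>j. dual_frame E e j x) (brank E) (\<Lambda> x) m (\<omega> x)
      (map (\<lambda>j. dual_frame E e j x) is))"
  using \<omega> ix
proof (induction m arbitrary: \<omega> "is")
  case 0
  have "smooth_fun_on M U (\<lambda>x. \<omega> x [])"
    using "0.prems"(1)[of "[]"] by simp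
  then show ?case
    using multivector_smooth[OF \<Lambda>_mv f "0.prems"(2)]
    by (simp add: smooth_fun_on_mult[OF M frame_open[OF f]])
next
  case (Suc m)
  have "smooth_fun_on M U (\<lambda>x. contraction (\<lambda>j. e j x) (\<lambda>j. dual_frame E e j x) (brank E) (\<Lambda> x) m
      (\<lambda>vs. \<omega> x (e i x # vs)) (map (\<lambda>j. dual_frame E e j x) is @ [dual_frame E e i x]))"
    if i: "i < brank E" for i
  proof -
    have "smooth_fun_on M U (\<lambda>x. contraction (\<lambda>j. e j x) (\<lambda>j. dual_frame E e j x) (brank E) (\<Lambda> x) m
      (\<lambda>vs. \<omega> x (e i x # vs)) (map (\<lambda>j. dual_frame E e j x) (is @ [i])))"
    proof (rule Suc.IH)
      fix js assume "set js \<subseteq> {..<brank E}"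
      then show "smooth_fun_on M U (\<lambda>x. \<omega> x (e i x # map (\<lambda>j. e j x) js))"
        using Suc.prems(1)[of "i # js"] i by simp
    qed (use Suc.prems(2) i in auto)
    then show ?thesis by simp
  qed
  then show ?case
    unfolding contraction.simps
    by (intro smooth_fun_on_mult[OF M frame_open[OF f]] smooth_fun_on_const[OF M frame_open[OF f]]
        smooth_fun_on_sum[OF M frame_open[OF f]]) auto
qed

text \<open>
  A pointwise preimage exists and is unique, so on every frame domain it agrees with the contraction
  formula for that frame. This makes it smooth without any gluing.
\<close>

lemma star_field_surjective:
  assumes \<omega>: "\<omega> \<in> forms M E (int (brank E) - k)"
  obtains a where "a \<in> multivectors M E k" "star_field E \<Lambda> a = \<omega>"
proof (cases "int (brank E) - k < 0")
  \<comment> \<open>There are no forms of negative degree, and the contraction is indexed by natural numbers.\<close>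
  case True
  have "\<omega> x vs = 0" for x vs
    by (rule alternating_off[of _ "fibre E x" "int (brank E) - k"])
       (use \<omega> True in \<open>auto simp: alternating_sections_def\<close>)
  then have "\<omega> = 0" by (simp add: fun_eq_iff)
  moreover have "star_field E \<Lambda> 0 = 0"
    using star_field_scale[of 0 0] by simp
  ultimately show ?thesis
    using that[of 0] subspace_0[OF multivectors_subspace] by simp
next
  case False
  then obtain m where m: "int (brank E) - k = int m"
    by (metis nonneg_int_cases not_less)
  have \<omega>_alt: "\<omega> x \<in> alternating (fibre E x) (int m)" for x
    using \<omega> m by (simp add: alternating_sections_def)
  have k: "k = int (brank E) - int m" using m by simp
  have contr: "contraction (\<lambda>j. e j x) (\<lambda>j. dual_frame E e j x) (brank E) (\<Lambda> x) m (\<omega> x)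
        \<in> alternating (dual_space (fibre E x)) k"
      "star (fibre E x) (\<Lambda> x) (contraction (\<lambda>j. e j x) (\<lambda>j. dual_frame E e j x) (brank E) (\<Lambda> x) m (\<omega> x)) = \<omega> x"
    if "(U, e) \<in> frames E" "x \<in> U" for U e x
    using volume_frames.contraction_star[OF volume_frames_fibre[OF that] \<omega>_alt] k by auto
  have "\<exists>\<alpha>. \<alpha> \<in> alternating (dual_space (fibre E x)) k \<and> star (fibre E x) (\<Lambda> x) \<alpha> = \<omega> x" for x
  proof -
    obtain U e where "(U, e) \<in> frames E" "x \<in> U" by (rule frame_at)
    from contr[OF this] show ?thesis by blast
  qed
  then obtain a where a: "\<And>x. a x \<in> alternating (dual_space (fibre E x)) k"
    "\<And>x. star (fibre E x) (\<Lambda> x) (a x) = \<omega> x"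
    by metis
  have a_eq: "a x = contraction (\<lambda>j. e j x) (\<lambda>j. dual_frame E e j x) (brank E) (\<Lambda> x) m (\<omega> x)" (is "_ = ?c")
    if "(U, e) \<in> frames E" "x \<in> U" for U e x
  proof -
    have "(\<lambda>\<xi>s. 1 * a x \<xi>s + (- 1) * ?c \<xi>s) = (\<lambda>_. 0)"
    proof (rule volume_frames.star_injective[OF volume_frames_fibre[OF that]])
      show "(\<lambda>\<xi>s. 1 * a x \<xi>s + (- 1) * ?c \<xi>s) \<in> alternating (dual_space (fibre E x)) k"
        by (rule alternating_combination[OF subspace_dual_space a(1) contr(1)[OF that]])
      show "star (fibre E x) (\<Lambda> x) (\<lambda>\<xi>s. 1 * a x \<xi>s + (- 1) * ?c \<xi>s) = (\<lambda>_. 0)"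
        unfolding star_linear using a(2) contr(2)[OF that] by (simp add: fun_eq_iff)
    qed
    then show ?thesis by (simp add: fun_eq_iff)
  qed
  have "a \<in> multivectors M E k"
    unfolding multivectors_iff
  proof (intro conjI allI ballI a(1), goal_cases)
    case (1 Ue)
    obtain U e where Ue: "Ue = (U, e)" by (cases Ue)
    have f: "(U, e) \<in> frames E" using 1 Ue by simp
    have \<omega>_smooth: "smooth_fun_on M U (\<lambda>x. \<omega> x (map (\<lambda>j. e j x) js))" if "set js \<subseteq> {..<brank E}" for js
      using \<omega> f that unfolding alternating_sections_def by auto
    have "smooth_fun_on M U (\<lambda>x. a x (map (\<lambda>j. dual_frame E e j x) js))" if js: "set js \<subseteq> {..<brank E}" for js
      by (rule smooth_fun_on_cong[OF M frame_open[OF f] _ smooth_contraction[where \<omega> = \<omega> and m = m, OF f \<omega>_smooth js]])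
         (simp_all add: a_eq[OF f])
    then show ?case by (simp add: Ue)
  qed
  moreover have "star_field E \<Lambda> a = \<omega>"
    by (rule ext) (simp add: star_field_def a(2))
  ultimately show ?thesis using that by blast
qed

lemma star_field_wedge_section:
  "star_field E \<Lambda> (a \<and>\<^sub>w of_section E X) x vs = star_field E \<Lambda> a x (X x # vs)"
  by (simp add: star_field_def wedge_of_section star_Cons)

lemma wedge_sections_top_degree:
  assumes a: "a \<in> multivectors M E k" and k: "k + int (length Xs) = int (brank E)"
  shows "wedge_sections E a Xs x \<eta>s = star_field E \<Lambda> a x (map (\<lambda>X. X x) Xs) * \<Lambda> x \<eta>s"
proof -
  obtain e \<xi> where v: "volume_frames (fibre E x) e \<xi> (brank E) (\<Lambda> x)" by (rule volume_frames_at)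
  show ?thesis
    using volume_frames.vfold_eq_star[OF v multivector_alternating[OF a], of "map (\<lambda>X. X x) Xs"] k
    by (simp add: wedge_sections_apply star_field_def)
qed

lemma star_field_smooth:
  assumes a: "a \<in> multivectors M E k" and Xs: "set Xs \<subseteq> sections M E"
  shows "(\<lambda>x. star_field E \<Lambda> a x (map (\<lambda>X. X x) Xs)) \<in> smooth_funs M"
proof (rule smooth_on_frames_imp_smooth)
  fix U e assume f: "(U, e) \<in> frames E"
  have "star_field E \<Lambda> (wedge_sections E a Xs) \<in> forms M E (int (brank E) - (k + int (length Xs)))"
    by (rule star_field_form[OF wedge_sections_multivector[OF a Xs]])
  then have "\<forall>js. set js \<subseteq> {..<brank E} \<longrightarrow>
      smooth_fun_on M U (\<lambda>x. star_field E \<Lambda> (wedge_sections E a Xs) x (map (\<lambda>j. e j x) js))"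
    using f unfolding alternating_sections_def by auto
  from this[rule_format, of "[]"]
  have "smooth_fun_on M U (\<lambda>x. star_field E \<Lambda> (wedge_sections E a Xs) x [])"
    by simp
  then show "smooth_fun_on M U (\<lambda>x. star_field E \<Lambda> a x (map (\<lambda>X. X x) Xs))"
    by (simp add: star_field_def star_def wedge_sections_apply)
qed

end

section \<open>The Lie algebroid differential\<close>

lemma nths_remove: "j < length xs \<Longrightarrow> nths xs (- {j}) = take j xs @ drop (Suc j) xs"
proof (induction xs arbitrary: j)
  case (Cons x xs)
  show ?case
  proof (cases j)
    case 0
    have "{i. Suc i \<in> - {0}} = UNIV" by auto
    then show ?thesis by (simp add: 0 nths_Cons nths_all)
  next
    case (Suc i)
    have "{l. Suc l \<in> - {Suc i}} = - {i}" by auto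
    then show ?thesis using Cons by (simp add: Suc nths_Cons)
  qed
qed simp

text \<open>
  Cartan's formula: peeling off the first argument of the coboundary gives the Lie derivative of \<open>\<omega>\<close>
  along \<open>X\<close> minus the coboundary formula for the contraction of \<open>\<omega>\<close> with \<open>X\<close>.
\<close>

lemma coboundary_formula_Cons:
  assumes V: "\<And>y. subspace (V y)" and \<omega>: "\<And>y. \<omega> y \<in> alternating (V y) k"
  shows "coboundary_formula A \<omega> (X # Xs) x =
    act A X (\<lambda>y. \<omega> y (map (\<lambda>X. X y) Xs)) x
    - (\<Sum>j<length Xs. \<omega> x (map (\<lambda>X. X x) (Xs[j := bracket A X (Xs ! j)])))
    - coboundary_formula A (\<lambda>y vs. \<omega> y (X y # vs)) Xs x"
proof -
  let ?m = "length Xs"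
  let ?ev = "map (\<lambda>X. X x)"
  have n0: "nths (X # Xs) (- {0}) = Xs"
  proof -
    have "{i. Suc i \<in> - {0}} = UNIV" by auto
    then show ?thesis by (simp add: nths_Cons nths_all)
  qed
  have n1: "nths (X # Xs) (- {Suc i}) = X # nths Xs (- {i})" for i
  proof -
    have "{l. Suc l \<in> - {Suc i}} = - {i}" by auto
    then show ?thesis by (simp add: nths_Cons)
  qed
  have n2: "nths (X # Xs) (- {0, Suc j}) = nths Xs (- {j})" for j
  proof -
    have "{l. Suc l \<in> - {0, Suc j}} = - {j}" by auto
    then show ?thesis by (simp add: nths_Cons)
  qed
  have n3: "nths (X # Xs) (- {Suc i, Suc j}) = X # nths Xs (- {i, j})" for i j
  proof -
    have "{l. Suc l \<in> - {Suc i, Suc j}} = - {i, j}" by auto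
    then show ?thesis by (simp add: nths_Cons)
  qed
  have lie: "(- 1) ^ j * \<omega> x (Z x # ?ev (nths Xs (- {j}))) = \<omega> x (?ev (Xs[j := Z]))" if "j < ?m" for j Z
  proof -
    have "\<omega> x (Z x # ?ev (take j Xs) @ ?ev (drop (Suc j) Xs)) =
        (- 1) ^ j * \<omega> x (?ev (take j Xs) @ Z x # ?ev (drop (Suc j) Xs))"
      using alternating_move[OF V \<omega>, of x "[]" "Z x" "?ev (take j Xs)"] that by simp
    then show ?thesis
      using that by (simp add: nths_remove upd_conv_take_nth_drop)
  qed
  have swap: "\<omega> x (u # X x # vs) = - \<omega> x (X x # u # vs)" for u vs
    using alternating_swap[OF V \<omega>, of x "[]" u "X x" vs] by simp
  have first: "(\<Sum>i<length (X # Xs). (- 1) ^ i * act A ((X # Xs) ! i) (\<lambda>y. \<omega> y (map (\<lambda>X. X y) (nths (X # Xs) (- {i})))) x) =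
      act A X (\<lambda>y. \<omega> y (map (\<lambda>X. X y) Xs)) x -
      (\<Sum>i<?m. (- 1) ^ i * act A (Xs ! i) (\<lambda>y. \<omega> y (X y # map (\<lambda>X. X y) (nths Xs (- {i})))) x)"
    by (simp add: sum.lessThan_Suc_shift n0 n1 sum_negf del: sum.lessThan_Suc)
  have "(\<Sum>j<length (X # Xs). \<Sum>i<j. (- 1) ^ (i + j) *
        \<omega> x (?ev (bracket A ((X # Xs) ! i) ((X # Xs) ! j) # nths (X # Xs) (- {i, j})))) =
      (\<Sum>j<?m. \<Sum>i<Suc j. (- 1) ^ (i + Suc j) *
        \<omega> x (?ev (bracket A ((X # Xs) ! i) (Xs ! j) # nths (X # Xs) (- {i, Suc j}))))"
    by (simp add: sum.lessThan_Suc_shift del: sum.lessThan_Suc)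
  also have "\<dots> = (\<Sum>j<?m. - \<omega> x (?ev (Xs[j := bracket A X (Xs ! j)])) -
      (\<Sum>i<j. (- 1) ^ (i + j) * \<omega> x (X x # ?ev (bracket A (Xs ! i) (Xs ! j) # nths Xs (- {i, j})))))"
  proof (rule sum.cong[OF refl])
    fix j assume "j \<in> {..<?m}"
    then have j: "j < ?m" by simp
    have "(\<Sum>i<Suc j. (- 1) ^ (i + Suc j) *
        \<omega> x (?ev (bracket A ((X # Xs) ! i) (Xs ! j) # nths (X # Xs) (- {i, Suc j})))) =
      - ((- 1) ^ j * \<omega> x (bracket A X (Xs ! j) x # ?ev (nths Xs (- {j})))) +
      (\<Sum>i<j. - ((- 1) ^ (i + j) * \<omega> x (X x # ?ev (bracket A (Xs ! i) (Xs ! j) # nths Xs (- {i, j})))))"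
      by (simp add: sum.lessThan_Suc_shift n2 n3 swap del: sum.lessThan_Suc)
    then show "(\<Sum>i<Suc j. (- 1) ^ (i + Suc j) *
        \<omega> x (?ev (bracket A ((X # Xs) ! i) (Xs ! j) # nths (X # Xs) (- {i, Suc j})))) =
      - \<omega> x (?ev (Xs[j := bracket A X (Xs ! j)])) -
      (\<Sum>i<j. (- 1) ^ (i + j) * \<omega> x (X x # ?ev (bracket A (Xs ! i) (Xs ! j) # nths Xs (- {i, j}))))"
      by (simp only: lie[OF j] sum_negf)
  qed
  finally have second: "(\<Sum>j<length (X # Xs). \<Sum>i<j. (- 1) ^ (i + j) *
        \<omega> x (?ev (bracket A ((X # Xs) ! i) ((X # Xs) ! j) # nths (X # Xs) (- {i, j})))) =
      - (\<Sum>j<?m. \<omega> x (?ev (Xs[j := bracket A X (Xs ! j)]))) -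
      (\<Sum>j<?m. \<Sum>i<j. (- 1) ^ (i + j) * \<omega> x (X x # ?ev (bracket A (Xs ! i) (Xs ! j) # nths Xs (- {i, j}))))"
    by (simp add: sum_subtractf sum_negf)
  show ?thesis
    unfolding coboundary_formula_def first second by simp
qed

section \<open>The operator of a connection with a horizontal volume element\<close>

locale horizontal_volume = volume_bundle M A \<Lambda>
  for M :: "('m::{t2_space, second_countable_topology}) manifold"
    and A :: "('m, 'v::real_vector) algebroid"
    and \<Lambda> +
  fixes S :: "('m \<Rightarrow> ('v \<Rightarrow> real) list \<Rightarrow> real) \<Rightarrow> ('m \<Rightarrow> ('v \<Rightarrow> real) list \<Rightarrow> real) \<Rightarrow> 'm \<Rightarrow> ('v \<Rightarrow> real) list \<Rightarrow> real"
    and nab :: "('m \<Rightarrow> 'v) \<Rightarrow> ('m \<Rightarrow> ('v \<Rightarrow> real) list \<Rightarrow> real) \<Rightarrow> 'm \<Rightarrow> ('v \<Rightarrow> real) list \<Rightarrow> real"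
    and D :: "('m \<Rightarrow> ('v \<Rightarrow> real) list \<Rightarrow> real) \<Rightarrow> 'm \<Rightarrow> ('v \<Rightarrow> real) list \<Rightarrow> real"
  assumes A: "lie_algebroid M A" and S: "schouten_bracket M A S"
    and horizontal: "\<And>X. X \<in> sections M A \<Longrightarrow> nab X \<Lambda> = 0"
    and D: "associated_operator M A S nab D"
begin

lemma multivector_in_algebra: "a \<in> multivectors M A p \<Longrightarrow> a \<in> multivector_algebra M A"
  unfolding multivector_algebra_def by (rule span_base) blast

lemma Lie_wedge:
  assumes X: "X \<in> sections M A" and b: "b \<in> multivectors M A q" and c: "c \<in> multivectors M A r"
  shows "S (of_section A X) (b \<and>\<^sub>w c) = S (of_section A X) b \<and>\<^sub>w c + b \<and>\<^sub>w S (of_section A X) c"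
proof -
  have "\<forall>p q. \<forall>a\<in>multivectors M A p. \<forall>b\<in>multivectors M A q. \<forall>c\<in>multivector_algebra M A.
       S a (b \<and>\<^sub>w c) = S a b \<and>\<^sub>w c + (- 1) powi ((p - 1) * q) *\<^sub>R (b \<and>\<^sub>w S a c)"
    using S unfolding schouten_bracket_def by (elim conjE)
  from this[rule_format, OF of_section_multivector[OF X] b multivector_in_algebra[OF c]]
  show ?thesis by simp
qed

lemma Lie_fun: "X \<in> sections M A \<Longrightarrow> f \<in> smooth_funs M \<Longrightarrow> S (of_section A X) (of_fun f) = of_fun (act A X f)"
  using S unfolding schouten_bracket_def by blast

lemma Lie_section:
  "X \<in> sections M A \<Longrightarrow> Y \<in> sections M A \<Longrightarrow> S (of_section A X) (of_section A Y) = of_section A (bracket A X Y)"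
  using S unfolding schouten_bracket_def by blast

lemma S_section_right:
  assumes a: "a \<in> multivectors M A p" and X: "X \<in> sections M A"
  shows "S a (of_section A X) = - S (of_section A X) a"
proof -
  have "\<forall>p q. \<forall>a\<in>multivectors M A p. \<forall>b\<in>multivectors M A q.
       S a b = - ((- 1) powi ((p - 1) * (q - 1)) *\<^sub>R S b a)"
    using S unfolding schouten_bracket_def by (elim conjE)
  from this[rule_format, OF a of_section_multivector[OF X]] show ?thesis by simp
qed

lemma D_degree: "a \<in> multivectors M A p \<Longrightarrow> D a \<in> multivectors M A (p - 1)"
  using D unfolding associated_operator_def by blast

lemma D_linear:
  assumes "a \<in> multivectors M A p" "b \<in> multivectors M A p"
  shows "D (c *\<^sub>R a + d *\<^sub>R b) = c *\<^sub>R D a + d *\<^sub>R D b"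
  using D multivector_in_algebra[OF assms(1)] multivector_in_algebra[OF assms(2)]
  unfolding associated_operator_def linear_on_def by blast

lemma D_scale: "a \<in> multivectors M A p \<Longrightarrow> D (c *\<^sub>R a) = c *\<^sub>R D a"
  using D_linear[of a p a c 0] by simp

definition divergence :: "('m \<Rightarrow> 'v) \<Rightarrow> 'm \<Rightarrow> real"
  where "divergence X x = D (of_section A X) x []"

text \<open>The volume element is horizontal, so its Lie derivative is the multiple of it given by \<open>D\<close>.\<close>

lemma Lie_volume:
  assumes X: "X \<in> sections M A"
  shows "S (of_section A X) \<Lambda> x \<xi>s = divergence X x * \<Lambda> x \<xi>s"
proof -
  have "\<forall>X\<in>sections M A. \<forall>L\<in>multivectors M A (int (brank A)).
       D (of_section A X) \<and>\<^sub>w L = S (of_section A X) L - nab X L"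
    using D unfolding associated_operator_def by (elim conjE)
  then have "D (of_section A X) \<and>\<^sub>w \<Lambda> = S (of_section A X) \<Lambda>"
    using X \<Lambda>_mv horizontal by simp
  then have "S (of_section A X) \<Lambda> x \<xi>s = wedge (D (of_section A X) x) (\<Lambda> x) \<xi>s"
    by (simp add: wedge_field_def fun_eq_iff)
  also have "\<dots> = divergence X x * \<Lambda> x \<xi>s"
    unfolding divergence_def
    by (rule wedge_scalar_left) (use multivector_of_degree_0 D_degree[OF of_section_multivector[OF X]] in auto)
  finally show ?thesis .
qed

lemma of_fun_wedge: "(of_fun g \<and>\<^sub>w a) x \<xi>s = g x * a x \<xi>s"
  unfolding wedge_field_def by (subst wedge_scalar_left) (auto simp: of_fun_def)

lemma Lie_fun_volume:
  assumes X: "X \<in> sections M A" and g: "g \<in> smooth_funs M"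
  shows "S (of_section A X) (of_fun g \<and>\<^sub>w \<Lambda>) x \<xi>s = (act A X g x + g x * divergence X x) * \<Lambda> x \<xi>s"
  unfolding Lie_wedge[OF X of_fun_multivector[OF g] \<Lambda>_mv] Lie_fun[OF X g]
  by (simp add: plus_fun_def of_fun_wedge Lie_volume[OF X] algebra_simps)

lemma wedge_sections_linear:
  "wedge_sections A (\<lambda>x \<xi>s. c x * a x \<xi>s + d x * b x \<xi>s) Xs x \<xi>s =
     c x * wedge_sections A a Xs x \<xi>s + d x * wedge_sections A b Xs x \<xi>s"
  by (simp add: wedge_sections_apply vfold_linear)

lemma Lie_wedge_sections:
  assumes X: "X \<in> sections M A"
  shows "a \<in> multivectors M A p \<Longrightarrow> set Ys \<subseteq> sections M A \<Longrightarrow>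
    S (of_section A X) (wedge_sections A a Ys) x \<xi>s =
      wedge_sections A (S (of_section A X) a) Ys x \<xi>s +
      (\<Sum>j<length Ys. wedge_sections A a (Ys[j := bracket A X (Ys ! j)]) x \<xi>s)"
proof (induction Ys arbitrary: a p)
  case Nil
  then show ?case by (simp add: wedge_sections_def)
next
  case (Cons Y Ys)
  have Y: "Y \<in> sections M A" and Ys: "set Ys \<subseteq> sections M A"
    using Cons.prems by auto
  let ?L = "S (of_section A X)"
  have Cons_eq: "wedge_sections A b (Z # Zs) = wedge_sections A (b \<and>\<^sub>w of_section A Z) Zs" for b Z Zs
    by (simp add: wedge_sections_def)
  have "?L (a \<and>\<^sub>w of_section A Y) = ?L a \<and>\<^sub>w of_section A Y + a \<and>\<^sub>w of_section A (bracket A X Y)"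
    using Lie_wedge[OF X Cons.prems(1) of_section_multivector[OF Y]] Lie_section[OF X Y] by simp
  also have "\<dots> = (\<lambda>x \<xi>s. 1 * (?L a \<and>\<^sub>w of_section A Y) x \<xi>s + 1 * (a \<and>\<^sub>w of_section A (bracket A X Y)) x \<xi>s)"
    by (simp add: plus_fun_def)
  finally have e: "wedge_sections A (?L (a \<and>\<^sub>w of_section A Y)) Ys x \<xi>s =
      wedge_sections A (?L a \<and>\<^sub>w of_section A Y) Ys x \<xi>s +
      wedge_sections A (a \<and>\<^sub>w of_section A (bracket A X Y)) Ys x \<xi>s"
    by (simp add: wedge_sections_linear[where c = "\<lambda>_. 1" and d = "\<lambda>_. 1", simplified])
  show ?case
    using Cons.IH[OF wedge_section_multivector[OF Cons.prems(1) Y] Ys]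
    by (simp add: Cons_eq e sum.lessThan_Suc_shift del: sum.lessThan_Suc)
qed

text \<open>
  The defining identity of \<open>D\<close> with a section as second factor. In the bracket term the graded
  antisymmetry with a section always gives a minus sign, since sections have shifted degree zero.
\<close>

lemma D_wedge_section:
  assumes a: "a \<in> multivectors M A p" and X: "X \<in> sections M A"
  shows "(D a \<and>\<^sub>w of_section A X) x \<xi>s = D (a \<and>\<^sub>w of_section A X) x \<xi>s +
    (- 1) powi p * (S (of_section A X) a x \<xi>s - divergence X x * a x \<xi>s)"
proof -
  have "\<forall>p. \<forall>a\<in>multivectors M A p. \<forall>b\<in>multivector_algebra M A.
       D (a \<and>\<^sub>w b) = (- 1) powi p *\<^sub>R S a b + D a \<and>\<^sub>w b + (- 1) powi p *\<^sub>R (a \<and>\<^sub>w D b)"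
    using D unfolding associated_operator_def by (elim conjE)
  from this[rule_format, OF a multivector_in_algebra[OF of_section_multivector[OF X]]]
  have "D (a \<and>\<^sub>w of_section A X) = (- 1) powi p *\<^sub>R (- S (of_section A X) a) + D a \<and>\<^sub>w of_section A X +
      (- 1) powi p *\<^sub>R (a \<and>\<^sub>w D (of_section A X))"
    unfolding S_section_right[OF a X] .
  moreover have "(a \<and>\<^sub>w D (of_section A X)) x \<xi>s = a x \<xi>s * divergence X x"
    unfolding wedge_field_def divergence_def
    by (rule wedge_scalar_right) (use multivector_of_degree_0 D_degree[OF of_section_multivector[OF X]] in auto)
  ultimately show ?thesis
    by (simp add: plus_fun_def scaleR_fun_def fun_Compl_def algebra_simps)
qed

text \<open>
  By induction on the number of sections: \<open>D_wedge_section\<close> becomes, in terms of coefficients of the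
  volume element, Cartan's recursion for the coboundary. The divergence term there cancels against the
  one from the Lie derivative of the volume element. The induction starts with multivectors of degree
  above the rank, which vanish.
\<close>

lemma wedge_sections_D:
  assumes "a \<in> multivectors M A p" "set Xs \<subseteq> sections M A" "p + int (length Xs) = int (brank A) + 1"
  shows "wedge_sections A (D a) Xs x \<xi>s =
    (- 1) powi p * coboundary_formula A (star_field A \<Lambda> a) Xs x * \<Lambda> x \<xi>s"
  using assms
proof (induction Xs arbitrary: a p)
  case Nil
  have "a y = (\<lambda>_. 0)" for y
  proof -
    obtain e \<xi> where "volume_frames (fibre A y) e \<xi> (brank A) (\<Lambda> y)" by (rule volume_frames_at)
    then interpret volume_frames "fibre A y" e \<xi> "brank A" "\<Lambda> y" .
    show ?thesis
      using Nil.prems by (intro alternating_above_dimension[OF spanned_dual multivector_alternating]) auto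
  qed
  then have "a = 0 *\<^sub>R a"
    by (simp add: fun_eq_iff)
  then have "D a = 0"
    using D_scale[OF Nil.prems(1), of 0] by simp
  then show ?case
    by (simp add: wedge_sections_def coboundary_formula_def)
next
  case (Cons X Xs)
  have X: "X \<in> sections M A" and Xs: "set Xs \<subseteq> sections M A"
    using Cons.prems by auto
  have a: "a \<in> multivectors M A p" by fact
  have p: "p + int (length Xs) = int (brank A)"
    using Cons.prems(3) by simp
  \<comment> \<open>The product \<open>a \<and> Xs\<close> has top degree, hence is \<open>g \<Lambda>\<close>; its Lie derivative is computed in two ways.\<close>
  define g where "g y = star_field A \<Lambda> a y (map (\<lambda>X. X y) Xs)" for y
  have g: "g \<in> smooth_funs M"
    unfolding g_def by (rule star_field_smooth[OF a Xs])
  have top: "wedge_sections A a Ys y \<eta>s = star_field A \<Lambda> a y (map (\<lambda>X. X y) Ys) * \<Lambda> y \<eta>s"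
    if "length Ys = length Xs" for Ys y \<eta>s
    using wedge_sections_top_degree[OF a, of Ys] p that by simp
  have "wedge_sections A a Xs = of_fun g \<and>\<^sub>w \<Lambda>"
    by (intro ext) (simp add: top of_fun_wedge g_def)
  then have "wedge_sections A (S (of_section A X) a) Xs x \<xi>s =
      (act A X g x + g x * divergence X x) * \<Lambda> x \<xi>s -
      (\<Sum>j<length Xs. star_field A \<Lambda> a x (map (\<lambda>X. X x) (Xs[j := bracket A X (Xs ! j)])) * \<Lambda> x \<xi>s)"
    using Lie_wedge_sections[OF X a Xs, of x \<xi>s] Lie_fun_volume[OF X g, of x \<xi>s] by (simp add: top)
  then have lie: "wedge_sections A (S (of_section A X) a) Xs x \<xi>s - divergence X x * wedge_sections A a Xs x \<xi>s =
      (act A X g x - (\<Sum>j<length Xs. star_field A \<Lambda> a x (map (\<lambda>X. X x) (Xs[j := bracket A X (Xs ! j)])))) * \<Lambda> x \<xi>s"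
    by (simp add: top g_def sum_distrib_left algebra_simps)
  have "D a \<and>\<^sub>w of_section A X = (\<lambda>x \<xi>s. 1 * D (a \<and>\<^sub>w of_section A X) x \<xi>s +
      (- 1) powi p * (1 * S (of_section A X) a x \<xi>s + (- divergence X x) * a x \<xi>s))"
    by (intro ext) (simp add: D_wedge_section[OF a X])
  then have "wedge_sections A (D a) (X # Xs) x \<xi>s =
      wedge_sections A (\<lambda>x \<xi>s. 1 * D (a \<and>\<^sub>w of_section A X) x \<xi>s +
        (- 1) powi p * (1 * S (of_section A X) a x \<xi>s + (- divergence X x) * a x \<xi>s)) Xs x \<xi>s"
    by (simp add: wedge_sections_def)
  also have "\<dots> = wedge_sections A (D (a \<and>\<^sub>w of_section A X)) Xs x \<xi>s +
      (- 1) powi p * (wedge_sections A (S (of_section A X) a) Xs x \<xi>s - divergence X x * wedge_sections A a Xs x \<xi>s)"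
    by (subst wedge_sections_linear[where c = "\<lambda>_. 1" and d = "\<lambda>_. (- 1) powi p"],
        subst wedge_sections_linear[where c = "\<lambda>_. 1" and d = "\<lambda>x. - divergence X x"]) simp
  also have "wedge_sections A (D (a \<and>\<^sub>w of_section A X)) Xs x \<xi>s =
      (- 1) powi (p + 1) * coboundary_formula A (star_field A \<Lambda> (a \<and>\<^sub>w of_section A X)) Xs x * \<Lambda> x \<xi>s"
    by (rule Cons.IH[OF wedge_section_multivector[OF a X] Xs]) (use p in simp)
  also have "star_field A \<Lambda> (a \<and>\<^sub>w of_section A X) = (\<lambda>y vs. star_field A \<Lambda> a y (X y # vs))"
    by (intro ext) (rule star_field_wedge_section)
  finally have main: "wedge_sections A (D a) (X # Xs) x \<xi>s = (- 1) powi p *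
      (act A X g x - (\<Sum>j<length Xs. star_field A \<Lambda> a x (map (\<lambda>X. X x) (Xs[j := bracket A X (Xs ! j)])))
       - coboundary_formula A (\<lambda>y vs. star_field A \<Lambda> a y (X y # vs)) Xs x) * \<Lambda> x \<xi>s"
    by (simp add: lie power_int_add algebra_simps)
  have "star_field A \<Lambda> a y \<in> alternating (fibre A y) (int (brank A) - p)" for y
    using star_field_form[OF a] by (simp add: alternating_sections_def)
  from coboundary_formula_Cons[where \<omega> = "star_field A \<Lambda> a" and A = A and X = X and Xs = Xs and x = x, OF fibre_subspace this]
  show ?case
    unfolding main by (simp add: g_def[abs_def])
qed

text \<open>
  The form corresponding to \<open>D a\<close> satisfies the defining formula of the coboundary up to sign. So the
  coboundary exists, and the duality intertwines it with \<open>D\<close>.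
\<close>

lemma coboundary_star_field:
  assumes a: "a \<in> multivectors M A k"
  shows "coboundary M A (int (brank A) - k) (star_field A \<Lambda> a) = (- 1) powi k *\<^sub>R star_field A \<Lambda> (D a)"
proof -
  define \<eta> where "\<eta> = (- 1) powi k *\<^sub>R star_field A \<Lambda> (D a)"
  have "\<eta> = star_field A \<Lambda> ((- 1) powi k *\<^sub>R D a)"
    by (simp add: \<eta>_def star_field_scale)
  moreover have "(- 1) powi k *\<^sub>R D a \<in> multivectors M A (k - 1)"
    by (rule subspace_scale[OF multivectors_subspace D_degree[OF a]])
  moreover have "int (brank A) - (k - 1) = int (brank A) - k + 1"
    by simp
  ultimately have \<eta>_form: "\<eta> \<in> forms M A (int (brank A) - k + 1)"
    using star_field_form by metis
  have \<eta>_values: "\<eta> x (map (\<lambda>X. X x) Xs) = coboundary_formula A (star_field A \<Lambda> a) Xs x"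
    if Xs: "set Xs \<subseteq> sections M A" "int (length Xs) = int (brank A) - k + 1" for Xs x
  proof -
    obtain \<xi>s where \<xi>s: "\<Lambda> x \<xi>s \<noteq> 0"
      using \<Lambda>_nowhere_zero[of x] by (auto simp: fun_eq_iff)
    have "star_field A \<Lambda> (D a) x (map (\<lambda>X. X x) Xs) * \<Lambda> x \<xi>s = wedge_sections A (D a) Xs x \<xi>s"
      using wedge_sections_top_degree[OF D_degree[OF a], of Xs] Xs(2) by simp
    also have "\<dots> = (- 1) powi k * coboundary_formula A (star_field A \<Lambda> a) Xs x * \<Lambda> x \<xi>s"
      by (rule wedge_sections_D[OF a Xs(1)]) (use Xs(2) in simp)
    finally have "star_field A \<Lambda> (D a) x (map (\<lambda>X. X x) Xs) =
        (- 1) powi k * coboundary_formula A (star_field A \<Lambda> a) Xs x"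
      using \<xi>s by simp
    moreover have "(- 1) powi k * (- 1) powi k = (1 :: real)"
      by (simp flip: power_int_add)
    ultimately show ?thesis
      by (simp add: \<eta>_def scaleR_fun_def flip: mult.assoc)
  qed
  show ?thesis
    unfolding coboundary_def \<eta>_def[symmetric]
  proof (rule the_equality)
    show "\<eta> \<in> forms M A (int (brank A) - k + 1) \<and>
      (\<forall>Xs. set Xs \<subseteq> sections M A \<and> int (length Xs) = int (brank A) - k + 1 \<longrightarrow>
         (\<forall>x. \<eta> x (map (\<lambda>X. X x) Xs) = coboundary_formula A (star_field A \<Lambda> a) Xs x))"
      using \<eta>_form \<eta>_values by blast
  next
    fix \<zeta>
    assume "\<zeta> \<in> forms M A (int (brank A) - k + 1) \<and>
      (\<forall>Xs. set Xs \<subseteq> sections M A \<and> int (length Xs) = int (brank A) - k + 1 \<longrightarrow>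
         (\<forall>x. \<zeta> x (map (\<lambda>X. X x) Xs) = coboundary_formula A (star_field A \<Lambda> a) Xs x))"
    then show "\<zeta> = \<eta>"
      using \<eta>_form \<eta>_values by (intro forms_eqI[of \<zeta> "int (brank A) - k + 1" \<eta>]) auto
  qed
qed

end

section \<open>Passage to homology\<close>

text \<open>The induced map sends a coset to its image, which is again a coset because \<open>f\<close> is additive.\<close>

lemma quotients_isomorphic_image:
  assumes V: "subspace V" and B: "subspace B" and sub: "Z \<subseteq> V" "B \<subseteq> V"
    and f: "linear_on V W f" and inj: "inj_on f V"
  shows "quotients_isomorphic (quotient_space Z B) (quotient_space (f ` Z) (f ` B))"
proof -
  have lin: "f (a *\<^sub>R u + b *\<^sub>R v) = a *\<^sub>R f u + b *\<^sub>R f v" if "u \<in> V" "v \<in> V" for a b u v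
    using f that by (simp add: linear_on_def)
  have add: "f (u + v) = f u + f v" if "u \<in> V" "v \<in> V" for u v
    using lin[OF that, of 1 1] by simp
  have coset: "f ` ((+) z ` B) = (+) (f z) ` (f ` B)" if "z \<in> V" for z
    using that sub(2) by (auto simp: image_image add subset_iff intro!: image_cong)
  have inV: "P \<subseteq> V" if "P \<in> quotient_space Z B" for P
    using that sub V by (auto simp: quotient_space_def intro!: subspace_add)
  have "inj_on ((`) f) (quotient_space Z B)"
    using inj inV by (intro inj_onI) (metis inj_on_image_eq_iff)
  moreover have "(`) f ` quotient_space Z B = quotient_space (f ` Z) (f ` B)"
  proof -
    have l: "(`) f ` quotient_space Z B = (\<lambda>z. f ` ((+) z ` B)) ` Z"
      unfolding quotient_space_def by (rule image_image)
    have r: "quotient_space (f ` Z) (f ` B) = (\<lambda>z. (+) (f z) ` (f ` B)) ` Z"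
      unfolding quotient_space_def by (rule image_image)
    show ?thesis
      unfolding l r using sub(1) by (intro image_cong refl coset) auto
  qed
  ultimately have "bij_betw ((`) f) (quotient_space Z B) (quotient_space (f ` Z) (f ` B))"
    by (simp add: bij_betw_def)
  moreover have "a *\<^sub>R p' + b *\<^sub>R q' \<in> f ` R"
    if P: "P \<in> quotient_space Z B" and Q: "Q \<in> quotient_space Z B" and R: "R \<in> quotient_space Z B"
      and pq: "p \<in> P" "q \<in> Q" and r: "a *\<^sub>R p + b *\<^sub>R q \<in> R" and pq': "p' \<in> f ` P" "q' \<in> f ` Q"
    for P Q R p q a b p' q'
  proof -
    obtain p1 q1 where p1: "p1 \<in> P" "p' = f p1" and q1: "q1 \<in> Q" "q' = f q1"
      using pq' by auto
    have diff: "u - v \<in> B" if "C \<in> quotient_space Z B" "u \<in> C" "v \<in> C" for C u v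
      using that B by (auto simp: quotient_space_def subspace_diff)
    have absorb: "u + v \<in> C" if "C \<in> quotient_space Z B" "u \<in> C" "v \<in> B" for C u v
      using that B by (auto simp: quotient_space_def add.assoc subspace_add)
    have "a *\<^sub>R (p1 - p) + b *\<^sub>R (q1 - q) \<in> B"
      using diff[OF P p1(1) pq(1)] diff[OF Q q1(1) pq(2)] B by (intro subspace_add subspace_scale)
    from absorb[OF R r this] have "a *\<^sub>R p1 + b *\<^sub>R q1 \<in> R"
      by (simp add: algebra_simps)
    moreover have "p1 \<in> V" "q1 \<in> V"
      using inV[OF P] inV[OF Q] p1 q1 by auto
    ultimately show ?thesis
      using lin p1 q1 by (metis imageI)
  qed
  ultimately show ?thesis
    unfolding quotients_isomorphic_def by blast
qed

context horizontal_volume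
begin

text \<open>Degreewise signs are absorbed by the arguments, which range over subspaces.\<close>

lemma boundary_image: "boundary A D k ` multivectors M A k = D ` multivectors M A k"
proof -
  have s: "(- 1) powi j * (- 1) powi j = (1 :: real)" for j :: int
    by (simp flip: power_int_add)
  show ?thesis
  proof (intro equalityI image_subsetI)
    fix a assume a: "a \<in> multivectors M A k"
    show "boundary A D k a \<in> D ` multivectors M A k"
      unfolding boundary_def D_scale[OF a, symmetric]
      by (intro imageI subspace_scale[OF multivectors_subspace a])
    have "D a = boundary A D k ((- 1) powi (int (brank A) - k) *\<^sub>R a)"
      by (simp add: boundary_def D_scale[OF a] s)
    then show "D a \<in> boundary A D k ` multivectors M A k"
      using subspace_scale[OF multivectors_subspace a] by blast
  qed
qed

lemma coboundary_image:
  "coboundary M A (int (brank A) - k) ` forms M A (int (brank A) - k) =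
     star_field A \<Lambda> ` D ` multivectors M A k"
proof -
  have s: "(- 1) powi j * (- 1) powi j = (1 :: real)" for j :: int
    by (simp flip: power_int_add)
  have "forms M A (int (brank A) - k) = star_field A \<Lambda> ` multivectors M A k"
    using star_field_form star_field_surjective by blast
  moreover have "coboundary M A (int (brank A) - k) (star_field A \<Lambda> a) =
      star_field A \<Lambda> (D ((- 1) powi k *\<^sub>R a))" if "a \<in> multivectors M A k" for a
    by (simp add: coboundary_star_field[OF that] D_scale[OF that] star_field_scale)
  moreover have "(\<lambda>a. (- 1) powi k *\<^sub>R a) ` multivectors M A k = multivectors M A k"
  proof (intro equalityI image_subsetI subsetI)
    fix a assume a: "a \<in> multivectors M A k"
    show "(- 1) powi k *\<^sub>R a \<in> multivectors M A k"
      by (rule subspace_scale[OF multivectors_subspace a])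
    then show "a \<in> (\<lambda>a. (- 1) powi k *\<^sub>R a) ` multivectors M A k"
      by (intro image_eqI[of _ _ "(- 1) powi k *\<^sub>R a"]) (simp_all add: s)
  qed
  ultimately show ?thesis
    by (smt (verit) image_cong image_image)
qed

lemma homology_isomorphic_cohomology:
  "quotients_isomorphic (algebroid_homology M A D k) (algebroid_cohomology M A (int (brank A) - k))"
proof -
  let ?n = "int (brank A)"
  have boundary_0: "boundary A D k a = 0 \<longleftrightarrow> D a = 0" for a
    by (simp add: boundary_def)
  have coboundary_0: "coboundary M A (?n - k) (star_field A \<Lambda> a) = 0 \<longleftrightarrow> D a = 0"
    if a: "a \<in> multivectors M A k" for a
    using star_field_injective[OF D_degree[OF a]] star_field_scale[of 0 0]
    by (auto simp: coboundary_star_field[OF a])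
  have cycles: "{\<omega> \<in> forms M A (?n - k). coboundary M A (?n - k) \<omega> = 0} =
      star_field A \<Lambda> ` {a \<in> multivectors M A k. boundary A D k a = 0}"
    using star_field_form star_field_surjective coboundary_0 boundary_0 by (auto, blast)
  have boundaries: "coboundary M A (?n - k - 1) ` forms M A (?n - k - 1) =
      star_field A \<Lambda> ` boundary A D (k + 1) ` multivectors M A (k + 1)"
    using coboundary_image[of "k + 1"] by (simp add: boundary_image algebra_simps)
  show ?thesis
    unfolding algebroid_homology_def algebroid_cohomology_def cycles boundaries
  proof (rule quotients_isomorphic_image)
    show "subspace (multivectors M A k)" by (rule multivectors_subspace)
    show "boundary A D (k + 1) ` multivectors M A (k + 1) \<subseteq> multivectors M A k"
      unfolding boundary_image using D_degree[of _ "k + 1"] by auto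
    show "linear_on (multivectors M A k) UNIV (star_field A \<Lambda>)"
      by (simp add: linear_on_def star_field_linear)
    show "inj_on (star_field A \<Lambda>) (multivectors M A k)"
    proof (rule inj_onI)
      fix a b assume ab: "a \<in> multivectors M A k" "b \<in> multivectors M A k"
        and eq: "star_field A \<Lambda> a = star_field A \<Lambda> b"
      have "a - b = 0"
      proof (rule star_field_injective[of _ k])
        show "a - b \<in> multivectors M A k"
          by (rule subspace_diff[OF multivectors_subspace ab])
        show "star_field A \<Lambda> (a - b) = 0"
          using star_field_linear[of 1 a "- 1" b] eq by simp
      qed
      then show "a = b" by simp
    qed
    show "subspace (boundary A D (k + 1) ` multivectors M A (k + 1))"
      unfolding boundary_image
    proof (rule subspaceI)
      show "0 \<in> D ` multivectors M A (k + 1)"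
        using D_scale[OF subspace_0[OF multivectors_subspace[of "k + 1"]], of 0]
          subspace_0[OF multivectors_subspace[of "k + 1"]]
        by (intro image_eqI[of _ _ 0]) auto
      show "u + v \<in> D ` multivectors M A (k + 1)"
        if uv: "u \<in> D ` multivectors M A (k + 1)" "v \<in> D ` multivectors M A (k + 1)" for u v
      proof -
        obtain a b where ab: "a \<in> multivectors M A (k + 1)" "b \<in> multivectors M A (k + 1)" "u = D a" "v = D b"
          using uv by auto
        then have "u + v = D (a + b)"
          using D_linear[OF ab(1,2), of 1 1] by simp
        then show ?thesis
          using subspace_add[OF multivectors_subspace ab(1,2)] by blast
      qed
      show "c *\<^sub>R u \<in> D ` multivectors M A (k + 1)" if u: "u \<in> D ` multivectors M A (k + 1)" for c u
      proof -
        obtain a where a: "a \<in> multivectors M A (k + 1)" "u = D a"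
          using u by auto
        then have "c *\<^sub>R u = D (c *\<^sub>R a)"
          using D_scale[OF a(1)] by simp
        then show ?thesis
          using subspace_scale[OF multivectors_subspace a(1)] by blast
      qed
    qed
  qed blast
qed

end

theorem theorem3p8:
  fixes M :: "('m::{t2_space, second_countable_topology}) manifold"
    and A :: "('m, 'v::real_vector) algebroid"
    and \<Lambda> :: "'m \<Rightarrow> ('v \<Rightarrow> real) list \<Rightarrow> real"
  assumes "smooth_manifold M"
    and "lie_algebroid M A"
    and "schouten_bracket M A S"
    and "brank A = n"
    and "A_connection M A (multivectors M A (int n)) nab0"
    and "\<Lambda> \<in> multivectors M A (int n)"
    and "\<forall>x. \<Lambda> x \<noteq> 0"
    and "\<forall>X\<in>sections M A. nab0 X \<Lambda> = 0"
    and "associated_operator M A S nab0 D"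
  shows "\<forall>k::int. quotients_isomorphic
           (algebroid_homology M A D k) (algebroid_cohomology M A (int n - k))"
proof -
  interpret horizontal_volume M A \<Lambda> S nab0 D
  proof unfold_locales
    show "vector_bundle M A"
      using assms(2) by (simp add: lie_algebroid_def)
  qed (use assms in auto)
  show ?thesis
    using homology_isomorphic_cohomology assms(4) by simp
qed

end
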